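(* Let $m\geq 2$, $i\in\{1,\dots,m\}$, let $\vec{q_k}=(q_{k1},\dots,q_{kn})$ with $1<\vec{q_k}<\infty$ (that is, $1<q_{kj}<\infty$ for $j=1,\dots,n$) for all $k=1,\dots,m$, and let $\vec q=(q_1,\dots,q_n)$ be given by $1/\vec q=1/\vec{q_1}+\cdots+1/\vec{q_m}$ (componentwise: $1/q_j=\sum_{k=1}^m 1/q_{kj}$). Let $\varphi,\varphi_1,\dots,\varphi_m:\mathbb{R}^n\times(0,\infty)\to(0,\infty)$ be Lebesgue measurable functions satisfying $$\int_r^\infty\left(1+\ln\frac{t}{r}\right)\frac{\varphi_i(x,t)}{t}\,dt\times\prod_{k=1,\,k\neq i}^m\int_r^\infty\frac{\varphi_k(x,t)}{t}\,dt\le C_0\,\varphi(x,r)$$ with a constant $C_0>0$ independent of $x\in\mathbb R^n$ and $r>0$. If $b\in{\rm BMO}$ and $T^b_{m,i}$ is a multi-sublinear operator which satisfies the size condition (S$_b$) and is bounded from $L^{\vec{q_1}}(\mathbb{R}^n)\times\cdots\times L^{\vec{q_m}}(\mathbb{R}^n)$ to $L^{\vec{q}}(\mathbb{R}^n)$, then $T^b_{m,i}$ is also bounded from $M^{\varphi_1}_{\vec{q_1}}(\mathbb{R}^n)\times\cdots\times M^{\varphi_m}_{\vec{q_m}}(\mathbb{R}^n)$ to $M^{\varphi}_{\vec{q}}(\mathbb{R}^n)$.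
   Context: Mixed Lebesgue spaces: for $\vec p=(p_1,\dots,p_n)\in(0,\infty]^n$ and measurable $f:\mathbb{R}^n\to\mathbb{C}$, $$\|f\|_{L^{\vec p}}=\left(\int_{\mathbb R}\cdots\left(\int_{\mathbb R}\left(\int_{\mathbb R}|f(x_1,\dots,x_n)|^{p_1}dx_1\right)^{p_2/p_1}dx_2\right)^{p_3/p_2}\cdots dx_n\right)^{1/p_n}$$ (with the usual modification if some $p_j=\infty$), and $L^{\vec p}(\mathbb R^n)$ is the set of $f$ with $\|f\|_{L^{\vec p}}<\infty$. Generalized mixed Morrey spaces: for $1\le\vec q<\infty$ and a Lebesgue measurable $\varphi:\mathbb R^n\times(0,\infty)\to(0,\infty)$, $M^{\varphi}_{\vec q}(\mathbb R^n)$ is the set of measurable $f$ with $$\|f\|_{M^{\varphi}_{\vec q}}=\sup_{x\in\mathbb R^n,\,r>0}\varphi(x,r)^{-1}\|\chi_{B(x,r)}\|_{L^{\vec q}}^{-1}\|f\chi_{B(x,r)}\|_{L^{\vec q}}<\infty,$$ where $B(x,r)$ is the open ball with center $x$ and radius $r$. (The theorem itself writes no lower bound on the target exponent $\vec q$; $M^\varphi_{\vec q}$ in it denotes the space given by this formula.) ${\rm BMO}$ is the set of locally integrable $b$ on $\mathbb R^n$ with $\|b\|_{\rm BMO}=\sup_{B}\frac1{|B|}\int_B|b(y)-b_B|\,dy<\infty$, the supremum over all balls $B$, $b_B=\frac1{|B|}\int_B b$. Multi-sublinear means sublinear in each of the $m$ arguments when the others are fixed. Size condition (S$_b$): for any $\vec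 f=(f_1,\dots,f_m)\in L^1(\mathbb R^n)\times\cdots\times L^1(\mathbb R^n)$ with compact support and any $x\notin\bigcap_{j=1}^m\operatorname{supp}f_j$, $$|T^b_{m,i}(\vec f)(x)|\le C\int_{(\mathbb R^n)^m}\frac{|b(x)-b(y_i)|}{|(x-y_1,\dots,x-y_m)|^{mn}}|f_1(y_1)\cdots f_m(y_m)|\,dy_1\cdots dy_m,$$ where $C$ is independent of $\vec f$ and $x$. Boundedness of an operator $S$ from $X_1\times\cdots\times X_m$ to $Y$ means $\|S(\vec f)\|_Y\le C\prod_{k=1}^m\|f_k\|_{X_k}$ with $C$ independent of $\vec f$.
   Formalization: The domain of T is left open, and the claim fails for T given arbitrarily on Morrey tuples; here T acts on tuples from L^{q_k}+L^1_c, and boundedness is proved for its extension S with |Sf| = lim |T(f χ_{B(0,N)})| a.e., equal to T on Morrey tuples in its domain. *)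

theory Defs
  imports "HOL-Analysis.Analysis"
begin

text \<open>
  \<open>\<real>\<^sup>n\<close> is \<open>real ^ 'n\<close>, where the finite index type \<open>'n\<close> is linearly ordered because the mixed
  norm integrates the coordinates one after the other. An \<open>m\<close>-tuple of functions is a map from
  a finite type \<open>'m\<close> with \<open>m = CARD('m)\<close>, and \<open>(\<real>\<^sup>n)\<^sup>m\<close> is \<open>real ^ 'n ^ 'm\<close> with its Euclidean norm.
\<close>

section \<open>Mixed Lebesgue spaces\<close>

text \<open>Powers with a positive exponent on \<open>[0,\<infinity>]\<close>; note that \<open>0 powr p = 0\<close>.\<close>

definition epowr :: "ennreal \<Rightarrow> real \<Rightarrow> ennreal" where
  "epowr a p = (if a = \<infinity> then \<infinity> else ennreal (enn2real a powr p))"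

definition Lp_norm :: "real \<Rightarrow> (real \<Rightarrow> ennreal) \<Rightarrow> ennreal" where
  "Lp_norm p g = epowr (\<integral>\<^sup>+ t. epowr (g t) p \<partial>lebesgue) (1 / p)"

definition upd_coord :: "real ^ 'n \<Rightarrow> 'n \<Rightarrow> real \<Rightarrow> real ^ 'n" where
  "upd_coord x j t = (\<chi> l. if l = j then t else x $ l)"

text \<open>
  The \<open>L\<^bsup>p j\<^esup>\<close> norms in the single coordinates are taken successively in increasing order of \<open>j\<close>,
  the smallest index innermost. After all steps the function is constant, so its value at \<open>0\<close> is
  the norm. (The exponents \<open>p\<^sub>2/p\<^sub>1, p\<^sub>3/p\<^sub>2, \<dots>\<close> of the usual formula arise from the outer
  exponent \<open>1/p\<^sub>1\<close> of one step and the inner exponent \<open>p\<^sub>2\<close> of the next.)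
  Only finite exponents are needed.
\<close>

definition mixed_norm :: "('n \<Rightarrow> real) \<Rightarrow> (real ^ 'n::{finite,linorder} \<Rightarrow> complex) \<Rightarrow> ennreal" where
  "mixed_norm p f =
     fold (\<lambda>j g x. Lp_norm (p j) (\<lambda>t. g (upd_coord x j t)))
       (sorted_list_of_set (UNIV :: 'n set)) (\<lambda>x. ennreal (norm (f x))) 0"

definition mixed_Lebesgue :: "('n \<Rightarrow> real) \<Rightarrow> (real ^ 'n::{finite,linorder} \<Rightarrow> complex) set" where
  "mixed_Lebesgue p = {f. f \<in> borel_measurable lebesgue \<and> mixed_norm p f < \<infinity>}"

section \<open>Generalized mixed Morrey spaces\<close>

definition morrey_weight :: "(real ^ 'n \<Rightarrow> real \<Rightarrow> real) \<Rightarrow> bool" where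
  "morrey_weight \<phi> \<longleftrightarrow>
     (\<forall>x. \<forall>r>0. \<phi> x r > 0) \<and>
     (\<lambda>(x, r). \<phi> x r) \<in> borel_measurable (lebesgue_on (UNIV \<times> {0<..}))"

definition morrey_norm ::
  "('n \<Rightarrow> real) \<Rightarrow> (real ^ 'n::{finite,linorder} \<Rightarrow> real \<Rightarrow> real) \<Rightarrow> (real ^ 'n::{finite,linorder} \<Rightarrow> complex) \<Rightarrow> ennreal" where
  "morrey_norm q \<phi> f =
     (SUP (x, r) \<in> UNIV \<times> {0<..}.
        inverse (ennreal (\<phi> x r)) * inverse (mixed_norm q (indicator (ball x r)))
          * mixed_norm q (\<lambda>y. f y * indicator (ball x r) y))"

definition mixed_Morrey ::
  "('n \<Rightarrow> real) \<Rightarrow> (real ^ 'n::{finite,linorder} \<Rightarrow> real \<Rightarrow> real) \<Rightarrow> (real ^ 'n::{finite,linorder} \<Rightarrow> complex) set" where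
  "mixed_Morrey q \<phi> = {f. f \<in> borel_measurable lebesgue \<and> morrey_norm q \<phi> f < \<infinity>}"

section \<open>Functions of bounded mean oscillation\<close>

definition locally_integrable :: "(real ^ 'n \<Rightarrow> complex) \<Rightarrow> bool" where
  "locally_integrable b \<longleftrightarrow> (\<forall>K. compact K \<longrightarrow> set_integrable lebesgue K b)"

definition ball_avg :: "(real ^ 'n \<Rightarrow> complex) \<Rightarrow> real ^ 'n \<Rightarrow> real \<Rightarrow> complex" where
  "ball_avg b x r = (LINT y:ball x r|lebesgue. b y) /\<^sub>R measure lebesgue (ball x r)"

definition BMO_norm :: "(real ^ 'n \<Rightarrow> complex) \<Rightarrow> ennreal" where
  "BMO_norm b =
     (SUP (x, r) \<in> UNIV \<times> {0<..}.
        inverse (emeasure lebesgue (ball x r))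
          * (\<integral>\<^sup>+ y\<in>ball x r. ennreal (norm (b y - ball_avg b x r)) \<partial>lebesgue))"

definition BMO :: "(real ^ 'n \<Rightarrow> complex) set" where
  "BMO = {b. locally_integrable b \<and> BMO_norm b < \<infinity>}"

section \<open>Multi-sublinear operators\<close>

text \<open>
  The values of an operator are functions modulo null sets, so pointwise conditions on them are
  required almost everywhere.
\<close>

definition multi_sublinear_on ::
  "('m \<Rightarrow> (real ^ 'n \<Rightarrow> complex) set) \<Rightarrow> (('m \<Rightarrow> real ^ 'n \<Rightarrow> complex) \<Rightarrow> real ^ 'n \<Rightarrow> complex) \<Rightarrow> bool" where
  "multi_sublinear_on D T \<longleftrightarrow>
     (\<forall>f k g. (\<forall>j. f j \<in> D j) \<longrightarrow> g \<in> D k \<longrightarrow>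
        (AE x in lebesgue. norm (T (f(k := (\<lambda>y. f k y + g y))) x)
                             \<le> norm (T f x) + norm (T (f(k := g)) x))) \<and>
     (\<forall>f k c. (\<forall>j. f j \<in> D j) \<longrightarrow>
        (AE x in lebesgue. norm (T (f(k := (\<lambda>y. c * f k y))) x) = norm c * norm (T f x)))"

definition multi_bounded ::
  "('m::finite \<Rightarrow> (real ^ 'n \<Rightarrow> complex) set) \<Rightarrow> ('m \<Rightarrow> (real ^ 'n \<Rightarrow> complex) \<Rightarrow> ennreal) \<Rightarrow>
   ((real ^ 'n \<Rightarrow> complex) \<Rightarrow> ennreal) \<Rightarrow>
   (('m \<Rightarrow> real ^ 'n \<Rightarrow> complex) \<Rightarrow> real ^ 'n \<Rightarrow> complex) \<Rightarrow> bool" where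
  "multi_bounded X NX NY T \<longleftrightarrow>
     (\<exists>C::real. \<forall>f. (\<forall>k. f k \<in> X k) \<longrightarrow>
        T f \<in> borel_measurable lebesgue \<and> NY (T f) \<le> ennreal C * (\<Prod>k\<in>UNIV. NX k (f k)))"

definition fun_support :: "(real ^ 'n \<Rightarrow> complex) \<Rightarrow> (real ^ 'n) set" where
  "fun_support f = closure {y. f y \<noteq> 0}"

definition L1_compact :: "(real ^ 'n \<Rightarrow> complex) set" where
  "L1_compact = {f. integrable lebesgue f \<and> compact (fun_support f)}"

definition size_condition ::
  "(real ^ 'n \<Rightarrow> complex) \<Rightarrow> 'm::finite \<Rightarrow>
   (('m \<Rightarrow> real ^ 'n \<Rightarrow> complex) \<Rightarrow> real ^ 'n \<Rightarrow> complex) \<Rightarrow> bool" where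
  "size_condition b i T \<longleftrightarrow>
     (\<exists>C::real. \<forall>f. (\<forall>k. f k \<in> L1_compact) \<longrightarrow>
        (AE x in lebesgue. x \<notin> (\<Inter>k. fun_support (f k)) \<longrightarrow>
           ennreal (norm (T f x)) \<le> ennreal C *
             (\<integral>\<^sup>+ y. ennreal (norm (b x - b (y $ i))
                        / norm (\<chi> k. x - y $ k) ^ (CARD('m) * CARD('n))
                        * norm (\<Prod>k\<in>UNIV. f k (y $ k)))
               \<partial>(lebesgue :: (real ^ 'n ^ 'm) measure))))"

text \<open>
  The hypotheses on the operator involve tuples from \<open>\<Prod>\<^sub>k L\<^bsup>q k\<^esup>\<close> and compactly supported \<open>L\<^sup>1\<close>
  tuples, so the operator acts on tuples from the linear spaces spanned by the two.
\<close>

definition op_domain :: "('n \<Rightarrow> real) \<Rightarrow> (real ^ 'n::{finite,linorder} \<Rightarrow> complex) set" where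
  "op_domain p = {(\<lambda>x. g x + h x) | g h. g \<in> mixed_Lebesgue p \<and> h \<in> L1_compact}"

text \<open>
  Morrey functions need not belong to the domain of \<open>T\<close>. As usual, the action of \<open>T\<close> on Morrey
  tuples \<open>f\<close> is the limit of its action on the truncations \<open>f\<^sub>k \<chi>\<^bsub>B(0,N)\<^esub>\<close>, which lie in
  the domain. A sublinear operator determines the size \<open>|T f|\<close> consistently but not the phase of
  \<open>T f\<close>, so the limit is that of the sizes. It determines \<open>|S f|\<close> almost everywhere,
  hence also every norm of \<open>S f\<close>. On tuples in the domain of \<open>T\<close>, \<open>S\<close> is \<open>T\<close>.
\<close>

definition truncation :: "nat \<Rightarrow> ('m \<Rightarrow> real ^ 'n \<Rightarrow> complex) \<Rightarrow> 'm \<Rightarrow> real ^ 'n \<Rightarrow> complex" where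
  "truncation N f = (\<lambda>k y. f k y * indicator (ball 0 (real N)) y)"

definition extends_by_truncation ::
  "('m \<Rightarrow> (real ^ 'n \<Rightarrow> complex) set) \<Rightarrow> ('m \<Rightarrow> (real ^ 'n \<Rightarrow> complex) set) \<Rightarrow>
   (('m \<Rightarrow> real ^ 'n \<Rightarrow> complex) \<Rightarrow> real ^ 'n \<Rightarrow> complex) \<Rightarrow>
   (('m \<Rightarrow> real ^ 'n \<Rightarrow> complex) \<Rightarrow> real ^ 'n \<Rightarrow> complex) \<Rightarrow> bool" where
  "extends_by_truncation D X T S \<longleftrightarrow>
     (\<forall>f. (\<forall>k. f k \<in> D k \<inter> X k) \<longrightarrow> S f = T f) \<and>
     (\<forall>f. (\<forall>k. f k \<in> X k) \<longrightarrow>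
        (AE x in lebesgue. (\<lambda>N. norm (T (truncation N f) x)) \<longlonglongrightarrow> norm (S f x)))"

end

theory Submission
  imports Defs
begin

text \<open>
  Fix a ball \<open>B = B(x, r)\<close> and put \<open>B\<^sub>j = B(x, 2\<^sup>j r)\<close>. For a tuple of which some \<open>f\<^sub>k\<close> vanishes
  on \<open>B\<^sub>1\<close>, splitting \<open>(\<real>\<^sup>n)\<^sup>m\<close> according to the first \<open>B\<^sub>j\<close> that contains all \<open>y\<^sub>k\<close> turns the
  size condition into a series over \<open>j\<close> of products of integrals over \<open>B\<^sub>j\<close>. By the mixed Hoelder
  inequality the \<open>j\<close>-th product is at most a multiple of \<open>(|b - b\<^sub>B| + 1) (1 + j)\<close> times the product
  of the averaged norms of the \<open>f\<^sub>k\<close> on \<open>B\<^sub>j\<close>; the factor \<open>1 + j\<close> is the drift of the averages of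
  \<open>b\<close> from \<open>B\<close> to \<open>B\<^sub>j\<close>. The series over \<open>j\<close> is dominated by the left-hand side of the condition
  on the weights, and the mixed norm of \<open>|b - b\<^sub>B| + 1\<close> on \<open>B\<close> is controlled by the John--Nirenberg
  inequality. The part of the tuple inside \<open>B\<^sub>1\<close> is covered by the boundedness of \<open>T\<close> on mixed
  Lebesgue spaces.

  The tails of the same series show that \<open>|T f\<^sup>N|\<close> is almost everywhere a Cauchy sequence for the
  truncations \<open>f\<^sup>N\<close> of a Morrey tuple \<open>f\<close>. If \<open>f\<close> lies in the domain of \<open>T\<close>, the mixed norm of
  \<open>|T f| - |T f\<^sup>N|\<close> tends to \<open>0\<close>, which identifies the limit as \<open>|T f|\<close>.
\<close>

text \<open>Three obstacles shape the proof. The target exponents \<open>q j\<close> may lie below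
  1, so the target norm is only a quasi-norm: Hoelder's inequality is proved for all positive
  exponents, the triangle inequality carries a constant, and limits are identified through infima of
  errors. Next, T is sublinear in each argument but not linear, so tuples are exchanged one
  component at a time. The change of |T| is then bounded by one term per component, each the size of
  T at a tuple with one component that is a difference vanishing near the ball. That is the
  situation of the size condition, and it replaces the usual expansion into all mixtures of local
  and distant parts. Finally, slices of Lebesgue measurable functions need not be measurable, so
  norm inequalities are proved for Borel functions and transferred across null sets, which almost
  every coordinate line meets in a null set. The 1 in |b - b_B| + 1 turns sums of oscillations into
  products: the drift of averages becomes a factor, and one Hoelder estimate serves the component
  that carries b and those that do not.\<close>

section \<open>Powers and one-dimensional norms\<close>

lemma epowr_ennreal: "0 \<le> a \<Longrightarrow> epowr (ennreal a) p = ennreal (a powr p)"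
  by (simp add: epowr_def)

lemma epowr_0 [simp]: "epowr 0 p = 0"
  by (simp add: epowr_def)

lemma epowr_top [simp]: "epowr top p = top"
  by (simp add: epowr_def)

lemma epowr_1 [simp]: "epowr a 1 = a"
  by (cases a) (auto simp: epowr_ennreal)

lemma epowr_one_left [simp]: "epowr 1 p = 1"
  by (simp add: epowr_def)

lemma epowr_mono:
  assumes "a \<le> b" "0 < p"
  shows "epowr a p \<le> epowr b p"
  using assms by (cases a; cases b) (auto simp: epowr_ennreal powr_mono2 top_unique)

lemma epowr_mult:
  assumes "0 < p"
  shows "epowr (a * b) p = epowr a p * epowr b p"
  using assms
  by (cases a; cases b) (auto simp: epowr_ennreal powr_mult ennreal_mult_top ennreal_top_mult
      simp flip: ennreal_mult)

lemma epowr_epowr: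
  assumes "0 < p" "0 < q"
  shows "epowr (epowr a p) q = epowr a (p * q)"
  using assms by (cases a) (auto simp: epowr_ennreal powr_powr)

lemma epowr_eq_0_iff [simp]: "epowr a p = 0 \<longleftrightarrow> a = 0"
  by (cases a) (auto simp: epowr_ennreal)

lemma epowr_eq_top_iff [simp]: "epowr a p = top \<longleftrightarrow> a = top"
  by (cases a) (auto simp: epowr_ennreal)

lemma epowr_less_top_iff [simp]: "epowr a p < top \<longleftrightarrow> a < top"
  by (simp add: less_top[symmetric])

lemma borel_measurable_epowr [measurable (raw)]:
  "f \<in> borel_measurable M \<Longrightarrow> (\<lambda>x. epowr (f x) p) \<in> borel_measurable M"
  unfolding epowr_def
  by (intro measurable_If measurable_compose[OF _ measurable_ennreal] powr_real_measurable
      measurable_compose[OF _ borel_measurable_enn2real] borel_measurable_const) auto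

text \<open>Comparing a + b with 2 * max a b treats every exponent p > 0 at once, including p < 1,
  where convexity fails.\<close>

lemma epowr_add_le:
  assumes "0 < p"
  shows "epowr (a + b) p \<le> epowr 2 p * (epowr a p + epowr b p)"
proof -
  have "a + b \<le> 2 * max a b"
    by (metis add_mono max.cobounded1 max.cobounded2 mult_2)
  then have "epowr (a + b) p \<le> epowr (2 * max a b) p"
    using assms by (rule epowr_mono)
  also have "\<dots> = epowr 2 p * epowr (max a b) p"
    using assms by (rule epowr_mult)
  also have "\<dots> \<le> epowr 2 p * (epowr a p + epowr b p)"
    by (intro mult_left_mono) (auto simp: max_def add_increasing add_increasing2)
  finally show ?thesis .
qed

lemma tendsto_epowr_0:
  assumes "0 < p" "(X \<longlongrightarrow> 0) F"
  shows "((\<lambda>n. epowr (X n) p) \<longlongrightarrow> 0) F"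
proof (rule order_tendstoI)
  fix a :: ennreal assume "0 < a"
  have ev: "eventually (\<lambda>n. X n < epowr a (1 / p)) F"
    using assms(2) \<open>0 < a\<close> by (intro order_tendstoD) (auto simp: zero_less_iff_neq_zero)
  have "epowr x p < a" if "x < epowr a (1 / p)" for x
  proof (rule ccontr)
    assume "\<not> epowr x p < a"
    then have "epowr a (1 / p) \<le> epowr (epowr x p) (1 / p)"
      using \<open>0 < p\<close> by (intro epowr_mono) auto
    also have "\<dots> = x"
      using \<open>0 < p\<close> by (simp add: epowr_epowr)
    finally show False
      using that by simp
  qed
  with ev show "eventually (\<lambda>n. epowr (X n) p < a) F"
    by (auto elim: eventually_mono)
qed auto

text \<open>Completing a measure leaves \<open>nn_integral\<close> unchanged even for integrands
  that are not measurable, so every slice may be integrated against \<open>lborel\<close>.\<close>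

lemma Lp_norm_lborel: "Lp_norm p g = epowr (\<integral>\<^sup>+ t. epowr (g t) p \<partial>lborel) (1 / p)"
  unfolding Lp_norm_def by (simp add: nn_integral_completion)

lemma Lp_norm_mono_AE:
  assumes "0 < p" "AE t in lborel. g t \<le> h t"
  shows "Lp_norm p g \<le> Lp_norm p h"
  unfolding Lp_norm_lborel using assms
  by (intro epowr_mono nn_integral_mono_AE) (auto elim: eventually_mono intro: epowr_mono)

lemma Lp_norm_cmult:
  assumes "0 < p" "g \<in> borel_measurable borel"
  shows "Lp_norm p (\<lambda>t. c * g t) = c * Lp_norm p g"
  unfolding Lp_norm_lborel using assms
  by (simp add: epowr_mult nn_integral_cmult epowr_epowr)

text \<open>The constant comes from two uses of \<open>epowr_add_le\<close>: the inner power p gives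
  2 after the root, the outer power 1 / p gives \<open>epowr 2 (1 / p)\<close>.\<close>

lemma Lp_norm_add_le:
  assumes "0 < p" and [measurable]: "g \<in> borel_measurable borel" "h \<in> borel_measurable borel"
  shows "Lp_norm p (\<lambda>t. g t + h t) \<le> 2 * epowr 2 (1 / p) * (Lp_norm p g + Lp_norm p h)"
proof -
  have "(\<integral>\<^sup>+ t. epowr (g t + h t) p \<partial>lborel) \<le> (\<integral>\<^sup>+ t. epowr 2 p * (epowr (g t) p + epowr (h t) p) \<partial>lborel)"
    using assms by (intro nn_integral_mono epowr_add_le)
  also have "\<dots> = epowr 2 p * ((\<integral>\<^sup>+ t. epowr (g t) p \<partial>lborel) + (\<integral>\<^sup>+ t. epowr (h t) p \<partial>lborel))"
    by (simp add: nn_integral_cmult nn_integral_add)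
  finally have "Lp_norm p (\<lambda>t. g t + h t)
      \<le> epowr (epowr 2 p * ((\<integral>\<^sup>+ t. epowr (g t) p \<partial>lborel) + (\<integral>\<^sup>+ t. epowr (h t) p \<partial>lborel))) (1 / p)"
    unfolding Lp_norm_lborel using assms by (intro epowr_mono) auto
  also have "\<dots> = 2 * epowr ((\<integral>\<^sup>+ t. epowr (g t) p \<partial>lborel) + (\<integral>\<^sup>+ t. epowr (h t) p \<partial>lborel)) (1 / p)"
    using assms by (simp add: epowr_mult epowr_epowr)
  also have "\<dots> \<le> 2 * (epowr 2 (1 / p) * (Lp_norm p g + Lp_norm p h))"
    unfolding Lp_norm_lborel using assms by (intro mult_left_mono epowr_add_le) auto
  finally show ?thesis
    by (simp add: mult.assoc)
qed

lemma Lp_norm_eq_0D: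
  assumes [measurable]: "g \<in> borel_measurable borel" and "Lp_norm p g = 0"
  shows "AE t in lborel. g t = 0"
  using assms(2) by (simp add: Lp_norm_lborel nn_integral_0_iff_AE)

lemma Lp_norm_const_0 [simp]: "Lp_norm p (\<lambda>t. 0) = 0"
  by (simp add: Lp_norm_lborel)

lemma Lp_norm_finite_AE:
  assumes [measurable]: "g \<in> borel_measurable borel" and "Lp_norm p g < top"
  shows "AE t in lborel. g t < top"
proof -
  have "AE t in lborel. epowr (g t) p \<noteq> \<infinity>"
    using assms(2) by (intro nn_integral_noteq_infinite) (auto simp: Lp_norm_lborel less_top[symmetric])
  then show ?thesis
    by (auto simp: less_top[symmetric])
qed

lemma Lp_norm_tendsto_0:
  assumes "0 < p" and [measurable]: "\<And>n. g n \<in> borel_measurable borel"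
    and "\<And>n t. g n t \<le> g 0 t" and "Lp_norm p (g 0) < top"
    and "AE t in lborel. (\<lambda>n. g n t) \<longlonglongrightarrow> 0"
  shows "(\<lambda>n. Lp_norm p (g n)) \<longlonglongrightarrow> 0"
proof -
  have "(\<lambda>n. \<integral>\<^sup>+ t. epowr (g n t) p \<partial>lborel) \<longlonglongrightarrow> (\<integral>\<^sup>+ (t::real). 0 \<partial>lborel)"
  proof (rule nn_integral_dominated_convergence[where w = "\<lambda>t. epowr (g 0 t) p"])
    show "AE x in lborel. (\<lambda>i. epowr (g i x) p) \<longlonglongrightarrow> 0"
      using assms(5) \<open>0 < p\<close> by (auto elim!: eventually_mono intro: tendsto_epowr_0)
    show "(\<integral>\<^sup>+ t. epowr (g 0 t) p \<partial>lborel) < \<infinity>"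
      using assms(4) by (simp add: Lp_norm_lborel)
  qed (use assms in \<open>auto intro: epowr_mono\<close>)
  then show ?thesis
    unfolding Lp_norm_lborel using \<open>0 < p\<close> by (intro tendsto_epowr_0) auto
qed

text \<open>Weighted Young inequality for a^P and b^s with the weights p / P and p / s, which add up
  to 1; p itself may be any positive number.\<close>

lemma ennreal_Young:
  assumes "0 < p" "0 < P" "0 < s" "1 / p = 1 / P + 1 / s"
  shows "epowr (a * b) p \<le> ennreal (p / P) * epowr a P + ennreal (p / s) * epowr b s"
proof (cases "a = 0 \<or> b = 0 \<or> a = top \<or> b = top")
  case True
  have "0 < p / P" "0 < p / s"
    using assms by auto
  then show ?thesis
    using True by (auto simp: ennreal_mult_top)
next
  case False
  then obtain u v where uv: "a = ennreal u" "b = ennreal v" "0 < u" "0 < v"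
    by (cases a; cases b) (auto simp: less_le)
  have "p * (1 / P + 1 / s) = 1"
    using assms(1,4) by (simp flip: assms(4))
  then have 1: "p / P + p / s = 1"
    by (simp add: ring_distribs)
  have "(u powr P) powr (p / P) * (v powr s) powr (p / s) \<le> p / P * u powr P + p / s * v powr s"
    using assms uv 1 by (intro Youngs_inequality_0) auto
  then have "(u * v) powr p \<le> p / P * u powr P + p / s * v powr s"
    using assms uv by (simp add: powr_powr powr_mult)
  then show ?thesis
    using assms uv
    by (simp add: epowr_ennreal flip: ennreal_mult' ennreal_plus)
qed

lemma Lp_norm_Holder:
  assumes p: "0 < p" "0 < P" "0 < s" "1 / p = 1 / P + 1 / s"
    and [measurable]: "u \<in> borel_measurable borel" "v \<in> borel_measurable borel"
  shows "Lp_norm p (\<lambda>t. u t * v t) \<le> Lp_norm P u * Lp_norm s v"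
proof -
  define A where "A = Lp_norm P u"
  define B where "B = Lp_norm s v"
  \<comment> \<open>A factor of norm 0 vanishes almost everywhere, so the bound survives even if the
    other norm is infinite, where the right-hand side reads 0 * \<infinity> = 0.\<close>
  have zero: "Lp_norm p (\<lambda>t. u t * v t) = 0" if "A = 0 \<or> B = 0"
  proof -
    have "AE t in lborel. u t * v t = 0"
      using that Lp_norm_eq_0D[of u P] Lp_norm_eq_0D[of v s] unfolding A_def B_def
      by (auto elim: eventually_mono)
    then have "Lp_norm p (\<lambda>t. u t * v t) \<le> Lp_norm p (\<lambda>t. 0)"
      by (intro Lp_norm_mono_AE p) auto
    then show ?thesis by simp
  qed
  consider "A = 0 \<or> B = 0" | "A \<noteq> 0" "B \<noteq> 0" "A = top \<or> B = top" | "0 < A" "0 < B" "A < top" "B < top"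
    by (auto simp: less_top[symmetric] zero_less_iff_neq_zero)
  then show ?thesis
  proof cases
    case 1
    then show ?thesis using zero by simp
  next
    case 2
    then have "A * B = top" by (auto simp: ennreal_mult_eq_top_iff)
    then show ?thesis by (simp add: A_def B_def)
  next
    case 3
    have inv: "A * inverse A = 1" "B * inverse B = 1"
      using 3 by (auto simp: ennreal_divide_self divide_ennreal_def[symmetric])
    have norm1: "(\<integral>\<^sup>+ t. epowr (inverse A * u t) P \<partial>lborel) = 1" "(\<integral>\<^sup>+ t. epowr (inverse B * v t) s \<partial>lborel) = 1"
    proof -
      have "(\<integral>\<^sup>+ t. epowr (u t) P \<partial>lborel) = epowr A P" "(\<integral>\<^sup>+ t. epowr (v t) s \<partial>lborel) = epowr B s"
        using p by (simp_all add: A_def B_def Lp_norm_lborel epowr_epowr)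
      then show "(\<integral>\<^sup>+ t. epowr (inverse A * u t) P \<partial>lborel) = 1" "(\<integral>\<^sup>+ t. epowr (inverse B * v t) s \<partial>lborel) = 1"
        using p inv by (simp_all add: epowr_mult nn_integral_cmult) (simp_all add: epowr_mult[symmetric] mult.commute)
    qed
    have "(\<integral>\<^sup>+ t. epowr ((inverse A * u t) * (inverse B * v t)) p \<partial>lborel)
        \<le> (\<integral>\<^sup>+ t. ennreal (p / P) * epowr (inverse A * u t) P + ennreal (p / s) * epowr (inverse B * v t) s \<partial>lborel)"
      by (intro nn_integral_mono ennreal_Young p)
    also have "\<dots> = ennreal (p / P) + ennreal (p / s)"
      using norm1 by (simp add: nn_integral_add nn_integral_cmult)
    also have "\<dots> = 1"
      using p by (subst ennreal_plus[symmetric]) (auto simp: field_simps)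
    finally have *: "Lp_norm p (\<lambda>t. (inverse A * u t) * (inverse B * v t)) \<le> 1"
      unfolding Lp_norm_lborel using epowr_mono[of _ 1 "1 / p"] p(1) by (auto simp del: p(4))
    have "(\<lambda>t. u t * v t) = (\<lambda>t. (A * B) * ((inverse A * u t) * (inverse B * v t)))"
    proof
      fix t
      have "(A * B) * ((inverse A * u t) * (inverse B * v t)) = (A * inverse A) * (B * inverse B) * (u t * v t)"
        by (simp add: mult_ac)
      then show "u t * v t = (A * B) * ((inverse A * u t) * (inverse B * v t))"
        by (simp add: inv)
    qed
    then have "Lp_norm p (\<lambda>t. u t * v t) = (A * B) * Lp_norm p (\<lambda>t. (inverse A * u t) * (inverse B * v t))"
      using Lp_norm_cmult[OF p(1), of "\<lambda>t. (inverse A * u t) * (inverse B * v t)" "A * B"] by simp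
    also have "\<dots> \<le> (A * B) * 1"
      by (intro mult_left_mono *) auto
    finally show ?thesis by (simp add: A_def B_def)
  qed
qed

lemma Lp_norm_interval:
  assumes "0 < p" "0 < s"
  shows "Lp_norm p (indicator {a - s<..<a + s}) = ennreal ((2 * s) powr (1 / p))"
proof -
  have "epowr (indicator {a - s<..<a + s} t) p = indicator {a - s<..<a + s} t" for t
    by (auto simp: indicator_def)
  then show ?thesis
    using assms by (simp add: Lp_norm_lborel epowr_ennreal)
qed

section \<open>Mixed norms\<close>

lemma upd_coord_eq: "upd_coord x j t = x + (t - x $ j) *\<^sub>R axis j 1"
  by (auto simp: upd_coord_def vec_eq_iff axis_def)

lemma upd_coord_nth: "upd_coord x j t $ l = (if l = j then t else x $ l)"
  by (simp add: upd_coord_def)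

lemma upd_coord_upd_coord [simp]: "upd_coord (upd_coord x j s) j t = upd_coord x j t"
  by (auto simp: upd_coord_def vec_eq_iff)

lemma upd_coord_commute: "j \<noteq> k \<Longrightarrow> upd_coord (upd_coord x j s) k t = upd_coord (upd_coord x k t) j s"
  by (auto simp: upd_coord_def vec_eq_iff)

lemma measurable_upd_coord [measurable]:
  "(\<lambda>(x, t). upd_coord x j t) \<in> borel_measurable (borel \<Otimes>\<^sub>M borel :: ((real ^ 'n) \<times> real) measure)"
  unfolding borel_prod upd_coord_eq case_prod_beta
  by (intro borel_measurable_continuous_onI continuous_intros)

lemma measurable_upd_coord' [measurable (raw)]:
  assumes "f \<in> borel_measurable M" "g \<in> borel_measurable M"
  shows "(\<lambda>z. upd_coord (f z :: real ^ 'n) j (g z)) \<in> borel_measurable M"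
  using measurable_compose[OF measurable_Pair[OF assms] measurable_upd_coord] by simp

lemma nn_integral_upd_coord:
  fixes h :: "real ^ 'n \<Rightarrow> ennreal"
  assumes [measurable]: "h \<in> borel_measurable borel"
  shows "(\<integral>\<^sup>+ t. h (upd_coord x j t) \<partial>lborel) = (\<integral>\<^sup>+ t. h (x + t *\<^sub>R axis j 1) \<partial>lborel)"
  using nn_integral_real_affine[of "\<lambda>t. h (upd_coord x j t)" 1 "x $ j"]
  by (simp add: upd_coord_eq)

text \<open>
  Integrating first along all lines in one coordinate direction and then over the whole space
  gives, by translation invariance, the integral over the space times \<open>\<infinity>\<close>. This replaces a
  decomposition of \<open>\<real>\<^sup>n\<close> as a product when only null sets matter.
\<close>

lemma nn_integral_coord_lines:
  fixes h :: "real ^ 'n \<Rightarrow> ennreal"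
  assumes [measurable]: "h \<in> borel_measurable borel"
  shows "(\<integral>\<^sup>+ x. (\<integral>\<^sup>+ t. h (upd_coord x j t) \<partial>lborel) \<partial>lborel) = (\<integral>\<^sup>+ x. h x \<partial>lborel) * \<infinity>"
proof -
  have "(\<integral>\<^sup>+ x. (\<integral>\<^sup>+ t. h (upd_coord x j t) \<partial>lborel) \<partial>lborel)
      = (\<integral>\<^sup>+ x. (\<integral>\<^sup>+ t. h (t *\<^sub>R axis j 1 + x) \<partial>lborel) \<partial>lborel)"
    by (simp add: nn_integral_upd_coord add.commute)
  also have "\<dots> = (\<integral>\<^sup>+ t. (\<integral>\<^sup>+ x. h (t *\<^sub>R axis j 1 + x) \<partial>lborel) \<partial>(lborel :: real measure))"
    by (rule lborel_pair.Fubini') measurable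
  also have "\<dots> = (\<integral>\<^sup>+ t. (\<integral>\<^sup>+ x. h x \<partial>lborel) \<partial>(lborel :: real measure))"
  proof (rule nn_integral_cong)
    fix t :: real
    have "(\<integral>\<^sup>+ x. h x \<partial>lborel) = (\<integral>\<^sup>+ x. h x \<partial>distr lborel borel ((+) (t *\<^sub>R axis j 1)))"
      by (simp add: lborel_distr_plus)
    also have "\<dots> = (\<integral>\<^sup>+ x. h (t *\<^sub>R axis j 1 + x) \<partial>lborel)"
      by (subst nn_integral_distr) auto
    finally show "(\<integral>\<^sup>+ x. h (t *\<^sub>R axis j 1 + x) \<partial>lborel) = (\<integral>\<^sup>+ x. h x \<partial>lborel)" ..
  qed
  also have "\<dots> = (\<integral>\<^sup>+ x. h x \<partial>lborel) * \<infinity>"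
    by simp
  finally show ?thesis .
qed

text \<open>For the indicator of a null set the right-hand side of
  \<open>nn_integral_coord_lines\<close> is 0 * \<infinity> = 0, so almost every line meets the set
  in a null set.\<close>

lemma AE_upd_coord:
  fixes P :: "real ^ 'n \<Rightarrow> bool"
  assumes "AE x in lborel. P x"
  shows "AE x in lborel. AE t in lborel. P (upd_coord x j t)"
proof -
  from assms obtain N where N [measurable]: "N \<in> sets borel" and N0: "emeasure lborel N = 0" and P: "{x. \<not> P x} \<subseteq> N"
    by (auto elim!: AE_E)
  have "(\<integral>\<^sup>+ x. (\<integral>\<^sup>+ t. indicator N (upd_coord x j t) \<partial>lborel) \<partial>lborel) = 0"
    using nn_integral_coord_lines[of "indicator N" j] N0 by simp
  then have "AE x in lborel. (\<integral>\<^sup>+ t. indicator N (upd_coord x j t) \<partial>lborel) = 0"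
    by (subst (asm) nn_integral_0_iff_AE) measurable
  then show ?thesis
  proof eventually_elim
    case (elim x)
    then have "AE t in lborel. indicator N (upd_coord x j t) = (0 :: ennreal)"
      by (subst (asm) nn_integral_0_iff_AE) measurable
    then show ?case
      by eventually_elim (use P in \<open>auto simp: indicator_def split: if_splits\<close>)
  qed
qed

text \<open>The same identity read backwards: if the left-hand side is 0, the factor \<infinity>
  forces the integral over the space to be 0.\<close>

lemma AE_upd_coordD:
  fixes P :: "real ^ 'n \<Rightarrow> bool"
  assumes [measurable]: "Measurable.pred borel P"
    and "AE x in lborel. AE t in lborel. P (upd_coord x j t)"
  shows "AE x in lborel. P x"
proof -
  let ?N = "{x. \<not> P x}"
  have [measurable]: "?N \<in> sets borel"
    by measurable
  have "AE x in lborel. (\<integral>\<^sup>+ t. indicator ?N (upd_coord x j t) \<partial>lborel) = 0"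
    using assms(2)
    by eventually_elim (subst nn_integral_0_iff_AE, auto elim: eventually_mono)
  then have "(\<integral>\<^sup>+ x. (\<integral>\<^sup>+ t. indicator ?N (upd_coord x j t) \<partial>lborel) \<partial>lborel) = 0"
    by (subst nn_integral_0_iff_AE) measurable
  then have "emeasure lborel ?N = 0"
    using nn_integral_coord_lines[of "indicator ?N" j] by (simp add: ennreal_mult_eq_top_iff)
  then show ?thesis
    by (subst AE_iff_measurable[of ?N]) auto
qed

section \<open>Mixed norms as iterated one-dimensional norms\<close>

definition mix_step :: "('n \<Rightarrow> real) \<Rightarrow> 'n \<Rightarrow> (real ^ 'n \<Rightarrow> ennreal) \<Rightarrow> real ^ 'n \<Rightarrow> ennreal" where
  "mix_step p j g x = Lp_norm (p j) (\<lambda>t. g (upd_coord x j t))"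

text \<open>Values in [0,\<infinity>] allow sums, products and infima of functions to enter the norm
  directly, without finiteness conditions.\<close>

definition mnorm :: "('n \<Rightarrow> real) \<Rightarrow> (real ^ 'n::{finite,linorder} \<Rightarrow> ennreal) \<Rightarrow> ennreal" where
  "mnorm p g = fold (mix_step p) (sorted_list_of_set UNIV) g 0"

lemma mixed_norm_eq: "mixed_norm p f = mnorm p (\<lambda>x. ennreal (norm (f x)))"
  unfolding mixed_norm_def mnorm_def mix_step_def[abs_def] by simp

lemma measurable_mix_step [measurable (raw)]:
  fixes g :: "real ^ 'n \<Rightarrow> ennreal"
  assumes [measurable]: "g \<in> borel_measurable borel"
  shows "mix_step p j g \<in> borel_measurable borel"
  unfolding mix_step_def[abs_def] Lp_norm_lborel by measurable

text \<open>A step removes the dependence on its own coordinate, and later steps act on other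
  coordinates and commute with the update, so independence once gained is kept.\<close>

lemma mix_fold_upd_coord:
  assumes "j \<in> set js \<or> (\<forall>x t. g (upd_coord x j t) = g x)"
  shows "fold (mix_step p) js g (upd_coord x j t) = fold (mix_step p) js g x"
  using assms
proof (induction js arbitrary: g)
  case (Cons k js)
  have "mix_step p k g (upd_coord x j t) = mix_step p k g x"
    if "k = j \<or> (\<forall>x t. g (upd_coord x j t) = g x)" for x t
    using that by (cases "j = k") (auto simp: mix_step_def upd_coord_commute[of j k])
  then have "j \<in> set js \<or> (\<forall>x t. mix_step p k g (upd_coord x j t) = mix_step p k g x)"
    using Cons.prems by auto
  from Cons.IH[OF this] show ?case
    by simp
qed simp

text \<open>All coordinates have been integrated out, so those of x can be reset to 0 one at a time.
  Almost-everywhere statements about the folded function thereby become statements about the single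
  number \<open>mnorm p g\<close>.\<close>

lemma mix_fold_eq_mnorm:
  fixes g :: "real ^ 'n::{finite,linorder} \<Rightarrow> ennreal"
  shows "fold (mix_step p) (sorted_list_of_set UNIV) g x = mnorm p g"
proof -
  let ?F = "fold (mix_step p) (sorted_list_of_set UNIV) g"
  have "?F (\<chi> l. if l \<in> A then 0 else x $ l) = ?F x" if "finite A" for A
    using that
  proof (induction A)
    case empty
    then show ?case by simp
  next
    case (insert a A)
    have "(\<chi> l. if l \<in> insert a A then 0 else x $ l) = upd_coord (\<chi> l. if l \<in> A then 0 else x $ l) a 0"
      by (auto simp: vec_eq_iff upd_coord_nth)
    then show ?case
      using insert.IH by (simp add: mix_fold_upd_coord)
  qed
  from this[of UNIV] have "?F (\<chi> l. 0) = ?F x"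
    by simp
  moreover have "(\<chi> l. 0) = (0 :: real ^ 'n::{finite,linorder})"
    by (simp add: vec_eq_iff)
  ultimately show ?thesis
    by (simp add: mnorm_def)
qed

lemma AE_lborel_const [simp]: "(AE x in (lborel :: 'a::euclidean_space measure). P) \<longleftrightarrow> P"
  using ae_filter_eq_bot_iff[of "lborel :: 'a measure"] by (auto dest: eventually_happens')

lemma mix_step_mono_AE:
  assumes "\<And>j. 0 < p j" "AE x in lborel. g x \<le> h x"
  shows "AE x in lborel. mix_step p j g x \<le> mix_step p j h x"
  using AE_upd_coord[OF assms(2), of j]
  by eventually_elim (auto simp: mix_step_def assms intro: Lp_norm_mono_AE)

lemma mix_fold_mono_AE:
  assumes "\<And>j. 0 < p j" "AE x in lborel. g x \<le> h x"
  shows "AE x in lborel. fold (mix_step p) js g x \<le> fold (mix_step p) js h x"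
  using assms(2)
proof (induction js arbitrary: g h)
  case (Cons j js)
  from Cons.IH[OF mix_step_mono_AE[OF assms(1) Cons.prems]] show ?case
    by simp
qed simp

lemma mix_fold_mono:
  assumes "\<And>j. 0 < p j" "\<And>x. g x \<le> h x"
  shows "fold (mix_step p) js g x \<le> fold (mix_step p) js h x"
  using assms(2)
proof (induction js arbitrary: g h)
  case (Cons j js)
  have "mix_step p j g x \<le> mix_step p j h x" for x
    unfolding mix_step_def using Cons.prems by (intro Lp_norm_mono_AE assms(1)) auto
  from Cons.IH[OF this] show ?case
    by simp
qed simp

lemma mnorm_mono_AE:
  assumes "\<And>j. 0 < p j" "AE x in lborel. g x \<le> h x"
  shows "mnorm p g \<le> mnorm p h"
  using mix_fold_mono_AE[OF assms, where js = "sorted_list_of_set UNIV"] by (simp add: mix_fold_eq_mnorm)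

lemma mnorm_mono:
  assumes "\<And>j. 0 < p j" "\<And>x. g x \<le> h x"
  shows "mnorm p g \<le> mnorm p h"
  using assms by (intro mnorm_mono_AE) auto

lemma mnorm_cong_AE:
  assumes "\<And>j. 0 < p j" "AE x in lborel. g x = h x"
  shows "mnorm p g = mnorm p h"
  using assms by (intro antisym mnorm_mono_AE) (auto elim: eventually_mono)

text \<open>The bridge to Borel functions, all of whose slices are measurable: by
  \<open>mnorm_cong_AE\<close> the norm does not see the exceptional null set.\<close>

lemma lebesgue_borel_version:
  fixes g :: "'a::euclidean_space \<Rightarrow> ennreal"
  assumes "g \<in> borel_measurable lebesgue"
  obtains g' where "g' \<in> borel_measurable borel" "AE x in lborel. g x = g' x"
  using completion_ex_borel_measurable[OF assms] by auto

section \<open>Homogeneity, Hoelder inequality and quasi-triangle inequality of mixed norms\<close>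

lemma mix_step_cmult:
  fixes g :: "real ^ 'n \<Rightarrow> ennreal"
  assumes "\<And>j. 0 < p j" and [measurable]: "g \<in> borel_measurable borel"
  shows "mix_step p j (\<lambda>x. c * g x) = (\<lambda>x. c * mix_step p j g x)"
  unfolding mix_step_def by (intro ext Lp_norm_cmult assms(1)) measurable

lemma mix_fold_cmult:
  fixes g :: "real ^ 'n \<Rightarrow> ennreal"
  assumes p: "\<And>j. 0 < p j" and "g \<in> borel_measurable borel"
  shows "fold (mix_step p) js (\<lambda>x. c * g x) = (\<lambda>x. c * fold (mix_step p) js g x)"
  using assms(2) by (induction js arbitrary: g) (auto simp: mix_step_cmult[OF p] measurable_mix_step)

lemma mnorm_cmult:
  assumes p: "\<And>j. 0 < p j" and g: "g \<in> borel_measurable lebesgue"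
  shows "mnorm p (\<lambda>x. c * g x) = c * mnorm p g"
proof -
  obtain g' where g': "g' \<in> borel_measurable borel" "AE x in lborel. g x = g' x"
    using lebesgue_borel_version[OF g] by blast
  have "mnorm p (\<lambda>x. c * g x) = mnorm p (\<lambda>x. c * g' x)"
    using g'(2) by (intro mnorm_cong_AE p) auto
  also have "\<dots> = c * mnorm p g'"
    by (simp add: mnorm_def mix_fold_cmult[OF p g'(1)])
  also have "mnorm p g' = mnorm p g"
    using g'(2) by (intro mnorm_cong_AE p) auto
  finally show ?thesis .
qed

lemma mix_fold_Holder:
  fixes u v :: "real ^ 'n \<Rightarrow> ennreal"
  assumes p: "\<And>j. 0 < p j" "\<And>j. 0 < P j" "\<And>j. 0 < s j" "\<And>j. 1 / p j = 1 / P j + 1 / s j"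
    and "u \<in> borel_measurable borel" "v \<in> borel_measurable borel"
  shows "fold (mix_step p) js (\<lambda>x. u x * v x) x \<le> fold (mix_step P) js u x * fold (mix_step s) js v x"
  using assms(5,6)
proof (induction js arbitrary: u v)
  case (Cons j js)
  note [measurable] = Cons.prems
  have "fold (mix_step p) (j # js) (\<lambda>x. u x * v x) x
      \<le> fold (mix_step p) js (\<lambda>x. mix_step P j u x * mix_step s j v x) x"
    unfolding fold_Cons comp_def
    by (intro mix_fold_mono p) (auto simp: mix_step_def intro!: Lp_norm_Holder p)
  also have "\<dots> \<le> fold (mix_step P) js (mix_step P j u) x * fold (mix_step s) js (mix_step s j v) x"
    by (intro Cons.IH) measurable
  finally show ?case
    by simp
qed simp

lemma mnorm_Holder:
  assumes p: "\<And>j. 0 < p j" "\<And>j. 0 < P j" "\<And>j. 0 < s j" "\<And>j. 1 / p j = 1 / P j + 1 / s j"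
    and u: "u \<in> borel_measurable lebesgue" and v: "v \<in> borel_measurable lebesgue"
  shows "mnorm p (\<lambda>x. u x * v x) \<le> mnorm P u * mnorm s v"
proof -
  obtain u' where u': "u' \<in> borel_measurable borel" "AE x in lborel. u x = u' x"
    using lebesgue_borel_version[OF u] by blast
  obtain v' where v': "v' \<in> borel_measurable borel" "AE x in lborel. v x = v' x"
    using lebesgue_borel_version[OF v] by blast
  have "mnorm p (\<lambda>x. u x * v x) = mnorm p (\<lambda>x. u' x * v' x)"
    using u'(2) v'(2) by (intro mnorm_cong_AE p) auto
  also have "\<dots> \<le> mnorm P u' * mnorm s v'"
    unfolding mnorm_def by (intro mix_fold_Holder p u' v')
  also have "mnorm P u' = mnorm P u"
    using u'(2) by (intro mnorm_cong_AE p) auto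
  also have "mnorm s v' = mnorm s v"
    using v'(2) by (intro mnorm_cong_AE p) auto
  finally show ?thesis .
qed

lemma mix_fold_add_le:
  assumes p: "\<And>j. 0 < p j"
  shows "\<exists>K<\<infinity>. \<forall>g h. g \<in> borel_measurable borel \<longrightarrow> h \<in> borel_measurable borel \<longrightarrow>
    (\<forall>x :: real ^ 'n::finite. fold (mix_step p) js (\<lambda>x. g x + h x) x
      \<le> K * (fold (mix_step p) js g x + fold (mix_step p) js h x))"
proof (induction js)
  case Nil
  show ?case by (intro exI[of _ 1]) auto
next
  case (Cons j js)
  then obtain K where K: "K < \<infinity>" and le: "\<And>g h x. g \<in> borel_measurable borel \<Longrightarrow> h \<in> borel_measurable borel \<Longrightarrow>
    fold (mix_step p) js (\<lambda>x. g x + h x) x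
      \<le> K * (fold (mix_step p) js g (x :: real ^ 'n) + fold (mix_step p) js h x)"
    by blast
  define c where "c = 2 * epowr 2 (1 / p j)"
  show ?case
  proof (intro exI[of _ "c * K"] conjI allI impI)
    have "c < \<infinity>"
      by (simp add: c_def ennreal_mult_less_top)
    then show "c * K < \<infinity>"
      using K by (simp add: ennreal_mult_less_top)
  next
    fix g h :: "real ^ 'n \<Rightarrow> ennreal" and x
    assume [measurable]: "g \<in> borel_measurable borel" "h \<in> borel_measurable borel"
    have "fold (mix_step p) (j # js) (\<lambda>x. g x + h x) x
        \<le> fold (mix_step p) js (\<lambda>x. c * (mix_step p j g x + mix_step p j h x)) x"
      unfolding fold_Cons comp_def
      by (intro mix_fold_mono p) (auto simp: mix_step_def c_def intro!: Lp_norm_add_le p)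
    also have "\<dots> = c * fold (mix_step p) js (\<lambda>x. mix_step p j g x + mix_step p j h x) x"
      by (subst mix_fold_cmult[OF p]) measurable
    also have "\<dots> \<le> c * (K * (fold (mix_step p) js (mix_step p j g) x + fold (mix_step p) js (mix_step p j h) x))"
      by (intro mult_left_mono le) measurable
    finally show "fold (mix_step p) (j # js) (\<lambda>x. g x + h x) x
        \<le> c * K * (fold (mix_step p) (j # js) g x + fold (mix_step p) (j # js) h x)"
      by (simp add: mult.assoc)
  qed
qed

lemma mnorm_add_le:
  fixes p :: "'n::{finite,linorder} \<Rightarrow> real"
  assumes p: "\<And>j. 0 < p j"
  obtains K where "K < \<infinity>" "1 \<le> K"
    "\<And>g h. g \<in> borel_measurable lebesgue \<Longrightarrow> h \<in> borel_measurable lebesgue \<Longrightarrow>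
      mnorm p (\<lambda>x. g x + h x) \<le> K * (mnorm p g + mnorm p h)"
proof -
  obtain K where K: "K < \<infinity>"
    and le0: "\<forall>g h. g \<in> borel_measurable borel \<longrightarrow> h \<in> borel_measurable borel \<longrightarrow>
      (\<forall>x :: real ^ 'n::{finite,linorder}. fold (mix_step p) (sorted_list_of_set UNIV) (\<lambda>x. g x + h x) x
        \<le> K * (fold (mix_step p) (sorted_list_of_set UNIV) g x + fold (mix_step p) (sorted_list_of_set UNIV) h x))"
    using mix_fold_add_le[where p = p, OF p, where js = "sorted_list_of_set UNIV"] by (elim exE conjE) (rule that)
  have le: "mnorm p (\<lambda>x. g x + h x) \<le> K * (mnorm p g + mnorm p h)"
    if "g \<in> borel_measurable borel" "h \<in> borel_measurable borel" for g h
    unfolding mnorm_def by (rule le0[rule_format, OF that])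
  show thesis
  proof
    show "max 1 K < \<infinity>" "1 \<le> max 1 K"
      using K by auto
    fix g h :: "real ^ 'n::{finite,linorder} \<Rightarrow> ennreal"
    assume g: "g \<in> borel_measurable lebesgue" and h: "h \<in> borel_measurable lebesgue"
    obtain g' where g': "g' \<in> borel_measurable borel" "AE x in lborel. g x = g' x"
      using lebesgue_borel_version[OF g] by blast
    obtain h' where h': "h' \<in> borel_measurable borel" "AE x in lborel. h x = h' x"
      using lebesgue_borel_version[OF h] by blast
    have "mnorm p (\<lambda>x. g x + h x) = mnorm p (\<lambda>x. g' x + h' x)"
      using g'(2) h'(2) by (intro mnorm_cong_AE p) auto
    also have "\<dots> \<le> K * (mnorm p g' + mnorm p h')"
      by (intro le g' h')
    also have "mnorm p g' = mnorm p g"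
      using g'(2) by (intro mnorm_cong_AE p) auto
    also have "mnorm p h' = mnorm p h"
      using h'(2) by (intro mnorm_cong_AE p) auto
    also have "K * (mnorm p g + mnorm p h) \<le> max 1 K * (mnorm p g + mnorm p h)"
      by (intro mult_right_mono) auto
    finally show "mnorm p (\<lambda>x. g x + h x) \<le> max 1 K * (mnorm p g + mnorm p h)" .
  qed
qed

text \<open>The fold is undone from the outermost step inwards: a vanishing one-dimensional norm
  makes the slice vanish almost everywhere, and \<open>AE_upd_coordD\<close> glues the slices
  together.\<close>

lemma mix_fold_eq_0D:
  fixes g :: "real ^ 'n \<Rightarrow> ennreal"
  assumes "g \<in> borel_measurable borel" "AE x in lborel. fold (mix_step p) js g x = 0"
  shows "AE x in lborel. g x = 0"
  using assms
proof (induction js arbitrary: g)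
  case (Cons j js)
  note [measurable] = Cons.prems(1)
  have "AE x in lborel. mix_step p j g x = 0"
    by (rule Cons.IH) (use Cons.prems in auto)
  then have "AE x in lborel. AE t in lborel. g (upd_coord x j t) = 0"
  proof eventually_elim
    case (elim x)
    then show ?case
      by (intro Lp_norm_eq_0D[where p = "p j"]) (measurable, simp add: mix_step_def)
  qed
  then show ?case
    by (intro AE_upd_coordD[where P = "\<lambda>x. g x = 0"]) measurable
qed simp

lemma mnorm_eq_0D:
  assumes p: "\<And>j. 0 < p j" and g: "g \<in> borel_measurable lebesgue" and "mnorm p g = 0"
  shows "AE x in lborel. g x = 0"
proof -
  obtain g' where g': "g' \<in> borel_measurable borel" "AE x in lborel. g x = g' x"
    using lebesgue_borel_version[OF g] by blast
  have "mnorm p g' = 0"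
    using mnorm_cong_AE[OF p g'(2)] assms(3) by simp
  then have "AE x in lborel. g' x = 0"
    by - (rule mix_fold_eq_0D[where p = p and js = "sorted_list_of_set UNIV"],
      auto simp: mix_fold_eq_mnorm g'(1))
  with g'(2) show ?thesis
    by eventually_elim simp
qed

text \<open>Dominated convergence with majorant \<open>g 0\<close> in each coordinate. Finiteness is
  a premise inside the almost-everywhere statement because an inner norm of the majorant may be
  infinite on some lines; only a finite norm in the following step shows that these are
  negligible.\<close>

lemma mix_fold_tendsto_0:
  fixes g :: "nat \<Rightarrow> real ^ 'n \<Rightarrow> ennreal"
  assumes p: "\<And>j. 0 < p j"
    and "\<And>N. g N \<in> borel_measurable borel" "\<And>N x. g N x \<le> g 0 x"
    and "AE x in lborel. g 0 x < \<infinity> \<longrightarrow> (\<lambda>N. g N x) \<longlonglongrightarrow> 0"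
  shows "AE x in lborel. fold (mix_step p) js (g 0) x < \<infinity> \<longrightarrow> (\<lambda>N. fold (mix_step p) js (g N) x) \<longlonglongrightarrow> 0"
  using assms(2-)
proof (induction js arbitrary: g)
  case (Cons j js)
  note [measurable] = Cons.prems(1)
  have "AE x in lborel. mix_step p j (g 0) x < \<infinity> \<longrightarrow> (\<lambda>N. mix_step p j (g N) x) \<longlonglongrightarrow> 0"
    using AE_upd_coord[OF Cons.prems(3), of j]
  proof eventually_elim
    case (elim x)
    show ?case
      unfolding mix_step_def
    proof (intro impI Lp_norm_tendsto_0 p)
      assume fin: "Lp_norm (p j) (\<lambda>t. g 0 (upd_coord x j t)) < \<infinity>"
      have "AE t in lborel. g 0 (upd_coord x j t) < top"
        using fin by (intro Lp_norm_finite_AE[of _ "p j"]) auto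
      then show "AE t in lborel. (\<lambda>N. g N (upd_coord x j t)) \<longlonglongrightarrow> 0"
        using elim by eventually_elim auto
    qed (use Cons.prems(2) in auto)
  qed
  then have "AE x in lborel. fold (mix_step p) js (mix_step p j (g 0)) x < \<infinity> \<longrightarrow>
      (\<lambda>N. fold (mix_step p) js (mix_step p j (g N)) x) \<longlonglongrightarrow> 0"
  proof (intro Cons.IH)
    show "mix_step p j (g N) x \<le> mix_step p j (g 0) x" for N x
      unfolding mix_step_def using Cons.prems(2) by (intro Lp_norm_mono_AE p) auto
  qed auto
  then show ?case
    by simp
qed simp

lemma mnorm_tendsto_0:
  fixes g :: "nat \<Rightarrow> real ^ 'n::{finite,linorder} \<Rightarrow> ennreal"
  assumes p: "\<And>j. 0 < p j"
    and "\<And>N. g N \<in> borel_measurable borel" "\<And>N x. g N x \<le> g 0 x" "mnorm p (g 0) < \<infinity>"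
    and "AE x in lborel. g 0 x < \<infinity> \<longrightarrow> (\<lambda>N. g N x) \<longlonglongrightarrow> 0"
  shows "(\<lambda>N. mnorm p (g N)) \<longlonglongrightarrow> 0"
proof -
  have "AE x in lborel. fold (mix_step p) (sorted_list_of_set UNIV) (g 0) x < \<infinity> \<longrightarrow>
      (\<lambda>N. fold (mix_step p) (sorted_list_of_set UNIV) (g N) x) \<longlonglongrightarrow> 0"
    by (rule mix_fold_tendsto_0) (fact p assms(2,3,5))+
  then show ?thesis
    using assms(4) unfolding mix_fold_eq_mnorm AE_lborel_const by simp
qed

lemma mix_fold_prod:
  fixes h :: "'n::finite \<Rightarrow> real \<Rightarrow> ennreal"
  assumes p: "\<And>j. 0 < p j" and h [measurable]: "\<And>l. h l \<in> borel_measurable borel"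
    and "distinct js" "set js \<subseteq> A"
  shows "fold (mix_step p) js (\<lambda>x. c * (\<Prod>l\<in>A. h l (x $ l)))
    = (\<lambda>x. c * (\<Prod>j\<in>set js. Lp_norm (p j) (h j)) * (\<Prod>l\<in>A - set js. h l (x $ l)))"
  using assms(3,4)
proof (induction js arbitrary: c A)
  case (Cons j js)
  have "mix_step p j (\<lambda>x. c * (\<Prod>l\<in>A. h l (x $ l)))
      = (\<lambda>x. c * Lp_norm (p j) (h j) * (\<Prod>l\<in>A - {j}. h l (x $ l)))"
  proof
    fix x
    have "(\<lambda>t. c * (\<Prod>l\<in>A. h l (upd_coord x j t $ l))) = (\<lambda>t. (c * (\<Prod>l\<in>A - {j}. h l (x $ l))) * h j t)"
    proof
      fix t
      have "(\<Prod>l\<in>A. h l (upd_coord x j t $ l)) = h j t * (\<Prod>l\<in>A - {j}. h l (upd_coord x j t $ l))"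
        using Cons.prems by (subst prod.remove[of A j]) (auto simp: upd_coord_nth)
      also have "(\<Prod>l\<in>A - {j}. h l (upd_coord x j t $ l)) = (\<Prod>l\<in>A - {j}. h l (x $ l))"
        by (intro prod.cong) (auto simp: upd_coord_nth)
      finally show "c * (\<Prod>l\<in>A. h l (upd_coord x j t $ l)) = (c * (\<Prod>l\<in>A - {j}. h l (x $ l))) * h j t"
        by (simp add: mult_ac)
    qed
    then have "mix_step p j (\<lambda>x. c * (\<Prod>l\<in>A. h l (x $ l))) x
        = Lp_norm (p j) (\<lambda>t. (c * (\<Prod>l\<in>A - {j}. h l (x $ l))) * h j t)"
      by (simp only: mix_step_def)
    also have "\<dots> = (c * (\<Prod>l\<in>A - {j}. h l (x $ l))) * Lp_norm (p j) (h j)"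
      by (intro Lp_norm_cmult p h)
    finally show "mix_step p j (\<lambda>x. c * (\<Prod>l\<in>A. h l (x $ l))) x
        = c * Lp_norm (p j) (h j) * (\<Prod>l\<in>A - {j}. h l (x $ l))"
      by (simp add: mult_ac)
  qed
  moreover have "A - {j} - set js = A - set (j # js)"
    by auto
  ultimately show ?case
    using Cons.IH[of "A - {j}" "c * Lp_norm (p j) (h j)"] Cons.prems
    by (auto simp: mult.assoc)
qed simp

lemma mnorm_prod:
  fixes h :: "'n::{finite,linorder} \<Rightarrow> real \<Rightarrow> ennreal"
  assumes "\<And>j. 0 < p j" "\<And>l. h l \<in> borel_measurable borel"
  shows "mnorm p (\<lambda>x. \<Prod>l\<in>UNIV. h l (x $ l)) = (\<Prod>j\<in>UNIV. Lp_norm (p j) (h j))"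
  using mix_fold_prod[of p h "sorted_list_of_set UNIV" UNIV 1] assms by (simp add: mnorm_def)

section \<open>Iterated integrals\<close>

lemma Basis_vec_image: "(Basis :: ('a::euclidean_space ^ 'm) set) = (\<lambda>(i, c). axis i c) ` (UNIV \<times> Basis)"
  by (auto simp: Basis_vec_def)

lemma measurable_vec_lambda:
  assumes "\<And>i. f i \<in> borel_measurable M"
  shows "(\<lambda>y. (\<chi> i. f i y) :: 'a::euclidean_space ^ 'm) \<in> borel_measurable M"
proof (subst borel_measurable_euclidean_space, rule ballI)
  fix b :: "'a ^ 'm" assume "b \<in> Basis"
  then obtain i c where "b = axis i c"
    by (auto simp: Basis_vec_image)
  then show "(\<lambda>y. (\<chi> i. f i y) \<bullet> b) \<in> borel_measurable M"
    using assms[of i] by (simp add: inner_axis)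
qed

text \<open>Both measures agree on boxes, since the basis vectors of the vector space are the
  \<open>axis i c\<close>. The lemma is used twice: with real entries for \<real>^n and with entries
  in \<real>^n for the domain of the size condition.\<close>

lemma lborel_vec:
  "distr (Pi\<^sub>M UNIV (\<lambda>_. lborel)) borel (\<lambda>y. \<chi> i. y i) = (lborel :: ('a::euclidean_space ^ 'm) measure)"
proof (rule sym, rule lborel_eqI)
  interpret product_sigma_finite "\<lambda>_ :: 'm. lborel :: 'a measure" ..
  let ?P = "Pi\<^sub>M UNIV (\<lambda>_ :: 'm. lborel :: 'a measure)"
  have meas: "(\<lambda>y. \<chi> i. y i) \<in> borel_measurable ?P"
    by (intro measurable_vec_lambda) simp
  fix l u :: "'a ^ 'm" assume le: "\<And>b. b \<in> Basis \<Longrightarrow> l \<bullet> b \<le> u \<bullet> b"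
  have le': "l $ i \<bullet> c \<le> u $ i \<bullet> c" if "c \<in> Basis" for i c
    using le[of "axis i c"] that by (auto simp: Basis_vec_image inner_axis)
  have "(\<lambda>y. \<chi> i. y i) -` box l u \<inter> space ?P = Pi\<^sub>E UNIV (\<lambda>i. box (l $ i) (u $ i))"
    by (auto simp: box_def Basis_vec_image inner_axis space_PiM PiE_def)
  then have "emeasure (distr ?P borel (\<lambda>y. \<chi> i. y i)) (box l u) = (\<Prod>i\<in>UNIV. emeasure lborel (box (l $ i) (u $ i)))"
    by (simp add: emeasure_distr[OF meas] emeasure_PiM)
  also have "\<dots> = (\<Prod>i\<in>UNIV. ennreal (\<Prod>c\<in>Basis. (u $ i - l $ i) \<bullet> c))"
    by (intro prod.cong refl emeasure_lborel_box le')
  also have "\<dots> = ennreal (\<Prod>i\<in>UNIV. \<Prod>c\<in>Basis. (u $ i - l $ i) \<bullet> c)"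
    by (intro prod_ennreal prod_nonneg) (auto simp: le' inner_diff_left)
  also have "(\<Prod>i\<in>UNIV. \<Prod>c\<in>Basis. (u $ i - l $ i) \<bullet> c) = (\<Prod>b\<in>Basis. (u - l) \<bullet> b)"
  proof -
    have "inj_on (\<lambda>(i, c). axis i c :: 'a ^ 'm) (UNIV \<times> Basis)"
      by (auto simp: inj_on_def axis_eq_axis nonzero_Basis)
    then show ?thesis
      unfolding Basis_vec_image
      by (subst prod.reindex) (auto simp: prod.cartesian_product inner_axis intro!: prod.cong)
  qed
  finally show "emeasure (distr ?P borel (\<lambda>y. \<chi> i. y i)) (box l u) = ennreal (\<Prod>b\<in>Basis. (u - l) \<bullet> b)" .
qed simp

lemma nn_integral_lborel_vec:
  fixes g :: "'a::euclidean_space ^ 'm \<Rightarrow> ennreal"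
  assumes "g \<in> borel_measurable borel"
  shows "(\<integral>\<^sup>+ x. g x \<partial>lborel) = (\<integral>\<^sup>+ y. g (\<chi> i. y i) \<partial>Pi\<^sub>M UNIV (\<lambda>_. lborel))"
  unfolding lborel_vec[symmetric]
  by (intro nn_integral_distr measurable_vec_lambda) (use assms in auto)

lemma nn_integral_lborel_vec_prod:
  fixes f :: "'m::finite \<Rightarrow> 'a::euclidean_space \<Rightarrow> ennreal"
  assumes [measurable]: "\<And>i. f i \<in> borel_measurable borel"
  shows "(\<integral>\<^sup>+ (y :: 'a ^ 'm). (\<Prod>i\<in>UNIV. f i (y $ i)) \<partial>lborel) = (\<Prod>i\<in>UNIV. (\<integral>\<^sup>+ x. f i x \<partial>lborel))"
proof -
  interpret product_sigma_finite "\<lambda>_ :: 'm. lborel :: 'a measure" ..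
  have "(\<lambda>y :: 'a ^ 'm. \<Prod>i\<in>UNIV. f i (y $ i)) \<in> borel_measurable borel"
    by (intro borel_measurable_prod_ennreal measurable_compose[OF _ assms])
      (auto intro!: borel_measurable_continuous_onI continuous_intros)
  then show ?thesis
    by (simp add: nn_integral_lborel_vec product_nn_integral_prod)
qed

text \<open>The preimage of a null set is a product of that set with full spaces and has measure 0
  because 0 * \<infinity> = 0 in \<open>ennreal\<close>. It permits Borel replacements in every
  factor of a product integrand.\<close>

lemma AE_vec_nth:
  assumes "AE x in lborel. P (x :: 'a::euclidean_space)"
  shows "AE y in (lborel :: ('a ^ 'm) measure). P (y $ i)"
proof -
  from assms obtain N where N [measurable]: "N \<in> sets borel" and N0: "emeasure lborel N = 0" and P: "{x. \<not> P x} \<subseteq> N"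
    by (auto elim!: AE_E)
  let ?f = "\<lambda>k. if k = i then indicator N else (\<lambda>_. 1) :: 'a \<Rightarrow> ennreal"
  have prod: "(\<Prod>k\<in>UNIV. ?f k (y $ k)) = indicator N (y $ i)" for y :: "'a ^ 'm"
  proof -
    have "(\<Prod>k\<in>UNIV. ?f k (y $ k)) = (\<Prod>k\<in>UNIV. if k = i then indicator N (y $ i) else 1)"
      by (intro prod.cong) auto
    then show ?thesis by simp
  qed
  have "(\<integral>\<^sup>+ (y :: 'a ^ 'm). indicator N (y $ i) \<partial>lborel) = (\<Prod>k\<in>UNIV. (\<integral>\<^sup>+ x. ?f k x \<partial>lborel))"
    unfolding prod[symmetric] by (intro nn_integral_lborel_vec_prod) auto
  also have "\<dots> = 0"
    using N0 by (intro prod_zero bexI[of _ i]) auto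
  finally have "(\<integral>\<^sup>+ (y :: 'a ^ 'm). indicator N (y $ i) \<partial>lborel) = 0" .
  moreover have "(\<lambda>y :: 'a ^ 'm. indicator N (y $ i) :: ennreal) \<in> borel_measurable lborel"
    by (intro measurable_compose[OF _ borel_measurable_indicator[OF N]])
      (auto intro!: borel_measurable_continuous_onI continuous_intros)
  ultimately have "AE y in (lborel :: ('a ^ 'm) measure). indicator N (y $ i) = (0 :: ennreal)"
    by (subst (asm) nn_integral_0_iff_AE) auto
  then show ?thesis
    by eventually_elim (use P in \<open>auto simp: indicator_def split: if_splits\<close>)
qed

lemma mix_step_1: "mix_step (\<lambda>_. 1) j g x = (\<integral>\<^sup>+ t. g (upd_coord x j t) \<partial>lborel)"
  by (simp add: mix_step_def Lp_norm_lborel)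

lemma mix_fold_1:
  fixes g :: "real ^ 'n \<Rightarrow> ennreal"
  assumes "distinct js" "g \<in> borel_measurable borel"
  shows "fold (mix_step (\<lambda>_. 1)) js g x
    = (\<integral>\<^sup>+ y. g (\<chi> l. if l \<in> set js then y l else x $ l) \<partial>Pi\<^sub>M (set js) (\<lambda>_. lborel))"
  using assms
proof (induction js arbitrary: g)
  case Nil
  interpret product_sigma_finite "\<lambda>_ :: 'n. lborel :: real measure" ..
  show ?case by (simp add: space_PiM)
next
  case (Cons j js)
  interpret product_sigma_finite "\<lambda>_ :: 'n. lborel :: real measure" ..
  note [measurable] = Cons.prems(2)
  let ?f = "\<lambda>y. g (\<chi> l. if l \<in> insert j (set js) then y l else x $ l)"
  have "(\<lambda>y. \<chi> l. if l \<in> insert j (set js) then y l else x $ l)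
      \<in> borel_measurable (Pi\<^sub>M (insert j (set js)) (\<lambda>_. lborel :: real measure))"
  proof (intro measurable_vec_lambda)
    fix l
    have "(\<lambda>y. y l) \<in> borel_measurable (Pi\<^sub>M (insert j (set js)) (\<lambda>_. lborel :: real measure))"
      if "l \<in> insert j (set js)"
      using measurable_component_singleton[OF that, of "\<lambda>_. lborel :: real measure"] by simp
    then show "(\<lambda>y. if l \<in> insert j (set js) then y l else x $ l)
        \<in> borel_measurable (Pi\<^sub>M (insert j (set js)) (\<lambda>_. lborel :: real measure))"
      by (cases "l \<in> insert j (set js)") auto
  qed
  then have f: "?f \<in> borel_measurable (Pi\<^sub>M (insert j (set js)) (\<lambda>_. lborel))"
    by (rule measurable_compose) measurable
  have "fold (mix_step (\<lambda>_. 1)) (j # js) g x = (\<integral>\<^sup>+ y. mix_step (\<lambda>_. 1) j g (\<chi> l. if l \<in> set js then y l else x $ l)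
      \<partial>Pi\<^sub>M (set js) (\<lambda>_. lborel))"
    using Cons.prems by (simp add: Cons.IH measurable_mix_step)
  also have "\<dots> = (\<integral>\<^sup>+ y. (\<integral>\<^sup>+ t. ?f (y(j := t)) \<partial>lborel) \<partial>Pi\<^sub>M (set js) (\<lambda>_. lborel))"
    unfolding mix_step_1 using Cons.prems(1)
    by (intro nn_integral_cong arg_cong[where f = g]) (auto simp: vec_eq_iff upd_coord_nth)
  also have "\<dots> = (\<integral>\<^sup>+ y. ?f y \<partial>Pi\<^sub>M (insert j (set js)) (\<lambda>_. lborel))"
    using Cons.prems(1) by (intro product_nn_integral_insert[symmetric] f) auto
  finally show ?case
    by simp
qed

lemma mnorm_1:
  fixes g :: "real ^ 'n::{finite,linorder} \<Rightarrow> ennreal"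
  assumes g: "g \<in> borel_measurable lebesgue"
  shows "mnorm (\<lambda>_. 1) g = (\<integral>\<^sup>+ x. g x \<partial>lborel)"
proof -
  obtain g' where g': "g' \<in> borel_measurable borel" "AE x in lborel. g x = g' x"
    using lebesgue_borel_version[OF g] by blast
  have "mnorm (\<lambda>_. 1) g = mnorm (\<lambda>_. 1) g'"
    using g'(2) by (intro mnorm_cong_AE) auto
  also have "\<dots> = (\<integral>\<^sup>+ x. g' x \<partial>lborel)"
    by (simp add: mnorm_def mix_fold_1 g'(1) nn_integral_lborel_vec)
  also have "\<dots> = (\<integral>\<^sup>+ x. g x \<partial>lborel)"
    using g'(2) by (intro nn_integral_cong_AE) (auto elim: eventually_mono)
  finally show ?thesis .
qed

text \<open>With equal exponents the root of one step cancels against the power of the next, and a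
  single root remains at the end.\<close>

lemma mix_fold_const:
  assumes "0 < P"
  shows "fold (mix_step (\<lambda>_. P)) js g x = epowr (fold (mix_step (\<lambda>_. 1)) js (\<lambda>x. epowr (g x) P) x) (1 / P)"
proof (induction js arbitrary: g)
  case Nil
  show ?case using assms by (simp add: epowr_epowr)
next
  case (Cons j js)
  have "(\<lambda>x. epowr (mix_step (\<lambda>_. P) j g x) P) = mix_step (\<lambda>_. 1) j (\<lambda>x. epowr (g x) P)"
    using assms by (auto simp: mix_step_def Lp_norm_lborel epowr_epowr)
  then show ?case
    by (simp add: Cons.IH)
qed

lemma mnorm_const:
  fixes g :: "real ^ 'n::{finite,linorder} \<Rightarrow> ennreal"
  assumes "0 < P" and [measurable]: "g \<in> borel_measurable lebesgue"
  shows "mnorm (\<lambda>_. P) g = epowr (\<integral>\<^sup>+ x. epowr (g x) P \<partial>lborel) (1 / P)"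
proof -
  have "mnorm (\<lambda>_. P) g = epowr (mnorm (\<lambda>_. 1) (\<lambda>x. epowr (g x) P)) (1 / P)"
    unfolding mnorm_def by (rule mix_fold_const[OF assms(1)])
  also have "mnorm (\<lambda>_. 1) (\<lambda>x. epowr (g x) P) = (\<integral>\<^sup>+ x. epowr (g x) P \<partial>lborel)"
    by (rule mnorm_1) measurable
  finally show ?thesis .
qed

text \<open>Hoelder with all target exponents equal to 1; \<open>1 / (1 - 1 / p j)\<close> is the
  conjugate exponent, positive because \<open>1 < p j\<close>.\<close>

lemma nn_integral_mult_le_mnorm:
  fixes u v :: "real ^ 'n::{finite,linorder} \<Rightarrow> ennreal"
  assumes "\<And>j. 1 < p j" and [measurable]: "u \<in> borel_measurable lebesgue" "v \<in> borel_measurable lebesgue"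
  shows "(\<integral>\<^sup>+ x. u x * v x \<partial>lborel) \<le> mnorm p u * mnorm (\<lambda>j. 1 / (1 - 1 / p j)) v"
proof -
  have "1 / p j < 1" "0 < p j" for j
    using assms(1)[of j] by (auto simp: field_simps)
  then show ?thesis
    unfolding mnorm_1[OF borel_measurable_times_ennreal[OF assms(2,3)], symmetric]
    by (intro mnorm_Holder) auto
qed

section \<open>Norms of balls\<close>

lemma ball_sets_lebesgue [measurable, simp]: "ball x s \<in> sets lebesgue"
  by (simp add: borel_open sets_completionI_sets)


text \<open>The scaling degree of the mixed norm: the indicator of a ball of radius s has norm
  comparable to \<open>s powr inv_sum p\<close>.\<close>

definition inv_sum :: "('n::finite \<Rightarrow> real) \<Rightarrow> real" where
  "inv_sum p = (\<Sum>j\<in>UNIV. 1 / p j)"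

text \<open>An open cube is a product of intervals, so its mixed norm is explicit. Cubes inside and
  around a ball give the two-sided bounds for balls.\<close>

definition cube :: "real ^ 'n \<Rightarrow> real \<Rightarrow> (real ^ 'n) set" where
  "cube x s = {y. \<forall>l. \<bar>y $ l - x $ l\<bar> < s}"

lemma mnorm_cube:
  assumes p: "\<And>j. 0 < p j" and "0 < s"
  shows "mnorm p (indicator (cube x s)) = ennreal ((2 * s) powr inv_sum p)"
proof -
  have "indicator (cube x s) = (\<lambda>y. \<Prod>l\<in>UNIV. indicator {x $ l - s<..<x $ l + s} (y $ l) :: ennreal)"
  proof
    fix y
    show "indicator (cube x s) y = (\<Prod>l\<in>UNIV. indicator {x $ l - s<..<x $ l + s} (y $ l) :: ennreal)"
    proof (cases "y \<in> cube x s")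
      case True
      then have "(\<Prod>l\<in>UNIV. indicator {x $ l - s<..<x $ l + s} (y $ l) :: ennreal) = 1"
        by (intro prod.neutral ballI) (auto simp: cube_def abs_less_iff algebra_simps indicator_def)
      with True show ?thesis by simp
    next
      case False
      then obtain l where "\<not> \<bar>y $ l - x $ l\<bar> < s"
        by (auto simp: cube_def)
      then have "indicator {x $ l - s<..<x $ l + s} (y $ l) = (0 :: ennreal)"
        by (auto simp: indicator_def)
      then have "(\<Prod>l\<in>UNIV. indicator {x $ l - s<..<x $ l + s} (y $ l) :: ennreal) = 0"
        by (intro prod_zero) auto
      with False show ?thesis by simp
    qed
  qed
  then have "mnorm p (indicator (cube x s)) = (\<Prod>j\<in>UNIV. Lp_norm (p j) (indicator {x $ j - s<..<x $ j + s}))"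
    using mnorm_prod[OF p, where h = "\<lambda>l. indicator {x $ l - s<..<x $ l + s}"] by simp
  also have "\<dots> = (\<Prod>j\<in>UNIV. ennreal ((2 * s) powr (1 / p j)))"
    by (intro prod.cong refl Lp_norm_interval p assms)
  also have "\<dots> = ennreal ((2 * s) powr inv_sum p)"
    using \<open>0 < s\<close> by (simp add: prod_ennreal inv_sum_def powr_sum)
  finally show ?thesis .
qed

lemma ball_subset_cube: "ball x s \<subseteq> cube x s"
proof (clarsimp simp: cube_def dist_norm)
  fix y l assume "norm (x - y) < s"
  then show "\<bar>y $ l - x $ l\<bar> < s"
    using component_le_norm_cart[of "x - y" l] by (simp add: abs_minus_commute)
qed

lemma cube_subset_ball: "cube x (s / real CARD('n)) \<subseteq> ball (x :: real ^ 'n) s"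
proof
  fix y assume y: "y \<in> cube x (s / real CARD('n))"
  have "norm (x - y) \<le> (\<Sum>l\<in>UNIV. \<bar>(x - y) $ l\<bar>)"
    by (rule norm_le_l1_cart)
  also have "\<dots> < (\<Sum>l\<in>(UNIV :: 'n set). s / real CARD('n))"
    using y by (intro sum_strict_mono) (auto simp: cube_def abs_minus_commute)
  finally show "y \<in> ball x s"
    by (simp add: dist_norm)
qed

lemma mnorm_ball_le:
  assumes "\<And>j. 0 < p j" "0 < s"
  shows "mnorm p (indicator (ball x s)) \<le> ennreal ((2 * s) powr inv_sum p)"
  unfolding mnorm_cube[OF assms, where x = x, symmetric]
  using ball_subset_cube[of x s] by (intro mnorm_mono assms) (auto simp: indicator_def)

lemma mnorm_ball_ge:
  fixes p :: "'n::{finite,linorder} \<Rightarrow> real"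
  assumes p: "\<And>j. 0 < p j" and "0 < s"
  shows "ennreal ((2 * s / real CARD('n)) powr inv_sum p) \<le> mnorm p (indicator (ball x s))"
proof -
  have "ennreal ((2 * (s / real CARD('n))) powr inv_sum p) = mnorm p (indicator (cube x (s / real CARD('n))))"
    using \<open>0 < s\<close> by (intro mnorm_cube[symmetric] p) auto
  also have "\<dots> \<le> mnorm p (indicator (ball x s))"
    using cube_subset_ball[of x s] by (intro mnorm_mono p) (auto simp: indicator_def)
  finally show ?thesis
    by simp
qed

text \<open>Hoelder against the indicator of the ball trades the mixed exponents for one exponent P
  above all of them. What remains is an ordinary integral, which the John--Nirenberg inequality can
  bound for oscillations.\<close>

lemma mnorm_le_Lp:
  fixes g :: "real ^ 'n::{finite,linorder} \<Rightarrow> ennreal"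
  assumes p: "\<And>j. 0 < p j" "\<And>j. p j < P" and "0 < s"
    and g [measurable]: "g \<in> borel_measurable lebesgue" and g0: "\<And>y. y \<notin> ball x s \<Longrightarrow> g y = 0"
  shows "mnorm p g \<le> epowr (\<integral>\<^sup>+ y. epowr (g y) P \<partial>lborel) (1 / P)
    * ennreal ((2 * s) powr (inv_sum p - real CARD('n) / P))"
proof -
  define q where "q = (\<lambda>j. 1 / (1 / p j - 1 / P))"
  have "0 < P"
    using p[of undefined] by linarith
  have q: "0 < q j" "1 / p j = 1 / P + 1 / q j" for j
    using p[of j] by (auto simp: q_def frac_less2)
  have "mnorm p g = mnorm p (\<lambda>y. g y * indicator (ball x s) y)"
    using g0 by (intro arg_cong[where f = "mnorm p"]) (auto simp: indicator_def fun_eq_iff)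
  also have "\<dots> \<le> mnorm (\<lambda>_. P) g * mnorm q (indicator (ball x s))"
    using \<open>0 < P\<close> by (intro mnorm_Holder p q g) auto
  also have "\<dots> \<le> mnorm (\<lambda>_. P) g * ennreal ((2 * s) powr inv_sum q)"
    by (intro mult_left_mono mnorm_ball_le q assms) auto
  also have "inv_sum q = inv_sum p - real CARD('n) / P"
    by (simp add: inv_sum_def q_def sum_subtractf)
  also have "mnorm (\<lambda>_. P) g = epowr (\<integral>\<^sup>+ y. epowr (g y) P \<partial>lborel) (1 / P)"
    by (rule mnorm_const[OF \<open>0 < P\<close> g])
  finally show ?thesis .
qed

section \<open>The John--Nirenberg inequality\<close>

lemma emeasure_lebesgue_ball:
  fixes x :: "'a::euclidean_space"
  shows "emeasure lebesgue (ball x r) = ennreal (measure lborel (ball (0 :: 'a) r))"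
proof (cases "0 \<le> r")
  case True
  have "emeasure lebesgue (ball x r) = emeasure lborel (ball x r)"
    by (simp add: borel_open)
  also have "\<dots> = ennreal (measure lborel (ball (0 :: 'a) r))"
    using True by (simp add: emeasure_ball content_ball)
  finally show ?thesis .
qed (simp add: ball_empty)

lemma measure_ball_scale:
  fixes r :: real
  assumes "0 < a" "0 < r"
  shows "measure lborel (ball (0 :: real ^ 'n) (a * r)) = a ^ CARD('n) * measure lborel (ball (0 :: real ^ 'n) r)"
  using assms by (simp add: content_ball power_mult_distrib)

lemma measure_lebesgue_ball:
  "measure lebesgue (ball (x :: 'a::euclidean_space) r) = measure lborel (ball (0 :: 'a) r)"
  by (simp add: measure_def[of _ "ball x r"] emeasure_lebesgue_ball)

lemma locally_integrable_measurable:
  fixes b :: "real ^ 'n \<Rightarrow> complex"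
  assumes "locally_integrable b"
  shows "b \<in> borel_measurable lebesgue"
proof (rule borel_measurable_LIMSEQ_metric)
  fix N :: nat
  have "set_integrable lebesgue (cball 0 (real N)) b"
    using assms by (simp add: locally_integrable_def)
  then show "(\<lambda>x. indicator (cball 0 (real N)) x *\<^sub>R b x) \<in> borel_measurable lebesgue"
    unfolding set_integrable_def by auto
next
  fix x :: "real ^ 'n"
  obtain N0 :: nat where "norm x \<le> real N0"
    using real_arch_simple by blast
  then have "eventually (\<lambda>N. indicator (cball 0 (real N)) x *\<^sub>R b x = b x) sequentially"
    by (intro eventually_sequentiallyI[of N0]) (auto simp: indicator_def)
  then show "(\<lambda>N. indicator (cball 0 (real N)) x *\<^sub>R b x) \<longlonglongrightarrow> b x"
    by (rule tendsto_eventually)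
qed

lemma locally_integrable_ball:
  assumes "locally_integrable b"
  shows "set_integrable lebesgue (ball x r) b"
  using assms by (intro set_integrable_subset[of lebesgue "cball x r" b "ball x r"])
    (auto simp: locally_integrable_def)

text \<open>The average of b - c is at most the average of |b - c|; multiplying by the volume avoids
  division in \<open>ennreal\<close>. It is applied with c an average over a larger ball.\<close>

lemma norm_ball_avg_diff_le:
  fixes b :: "real ^ 'n \<Rightarrow> complex"
  assumes "locally_integrable b" "0 < r"
  shows "ennreal (norm (ball_avg b x r - c)) * emeasure lebesgue (ball x r)
    \<le> (\<integral>\<^sup>+ y\<in>ball x r. ennreal (norm (b y - c)) \<partial>lebesgue)"
proof -
  let ?V = "measure lebesgue (ball x r)"
  have V: "0 < ?V" "emeasure lebesgue (ball x r) = ennreal ?V"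
    using assms(2) unfolding measure_lebesgue_ball emeasure_lebesgue_ball by auto
  have ib: "set_integrable lebesgue (ball x r) b"
    by (rule locally_integrable_ball[OF assms(1)])
  have ic: "set_integrable lebesgue (ball x r) (\<lambda>_. c)"
    unfolding set_integrable_def
    using V(2) by (intro integrable_scaleR_left integrable_real_indicator) auto
  have "(LINT y:ball x r|lebesgue. b y - c) = (LINT y:ball x r|lebesgue. b y) - (LINT y:ball x r|lebesgue. c)"
    by (rule set_integral_diff(2)[OF ib ic])
  also have "(LINT y:ball x r|lebesgue. c) = ?V *\<^sub>R c"
    unfolding set_lebesgue_integral_def using V by (subst integral_scaleR_left) auto
  also have "(LINT y:ball x r|lebesgue. b y) = ?V *\<^sub>R ball_avg b x r"
    using V(1) by (simp add: ball_avg_def)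
  finally have eq: "(LINT y:ball x r|lebesgue. b y - c) = ?V *\<^sub>R (ball_avg b x r - c)"
    by (simp add: scaleR_diff_right)
  have "ennreal (norm (ball_avg b x r - c)) * emeasure lebesgue (ball x r)
      = ennreal (norm (LINT y:ball x r|lebesgue. b y - c))"
    using V by (simp add: eq ennreal_mult mult.commute)
  also have "\<dots> \<le> (\<integral>\<^sup>+ y. norm (indicator (ball x r) y *\<^sub>R (b y - c)) \<partial>lebesgue)"
    unfolding set_lebesgue_integral_def
    by (rule integral_norm_bound_ennreal)
      (use set_integral_diff(1)[OF ib ic] in \<open>simp add: set_integrable_def\<close>)
  also have "\<dots> = (\<integral>\<^sup>+ y\<in>ball x r. ennreal (norm (b y - c)) \<partial>lebesgue)"
    by (intro nn_integral_cong) (auto simp: indicator_def)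
  finally show ?thesis .
qed

lemma nn_integral_subset_mono:
  assumes "A \<subseteq> B"
  shows "(\<integral>\<^sup>+ y\<in>A. f y \<partial>M) \<le> (\<integral>\<^sup>+ y\<in>B. f y \<partial>M)"
  using assms by (intro nn_integral_mono) (auto simp: indicator_def)

text \<open>
  A form of the Lebesgue differentiation theorem: Vitali coverings of \<open>Z\<close> inside an open set
  that is only slightly larger than \<open>Z\<close> compare \<open>\<integral>\<^sub>Z G\<close> with \<open>\<lambda> |Z|\<close>.
\<close>

lemma null_sets_averages_le:
  fixes G :: "'a::euclidean_space \<Rightarrow> ennreal"
  assumes G [measurable]: "G \<in> borel_measurable lebesgue" and "0 \<le> l" "0 < \<rho>"
    and Z [measurable]: "Z \<in> sets lebesgue" and Z_fin: "emeasure lebesgue Z < \<infinity>"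
    and gt: "\<And>y. y \<in> Z \<Longrightarrow> ennreal l < G y"
    and avg: "\<And>y s. y \<in> Z \<Longrightarrow> 0 < s \<Longrightarrow> s \<le> \<rho> \<Longrightarrow>
      (\<integral>\<^sup>+ z\<in>ball y s. G z \<partial>lebesgue) \<le> ennreal l * emeasure lebesgue (ball y s)"
  shows "Z \<in> null_sets lebesgue"
proof -
  have le_\<delta>: "(\<integral>\<^sup>+ z\<in>Z. G z \<partial>lebesgue) \<le> ennreal l * emeasure lebesgue Z + ennreal l * ennreal \<delta>" if "0 < \<delta>" for \<delta>
  proof -
    obtain U where U: "open U" "Z \<subseteq> U" "U - Z \<in> lmeasurable" "emeasure lebesgue (U - Z) < ennreal \<delta>"
      using sets_lebesgue_outer_open[OF Z \<open>0 < \<delta>\<close>] by blast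
    have U_meas [measurable]: "U \<in> sets lebesgue"
      using U(1) by (simp add: borel_open)
    define K where "K = {(y, s). y \<in> Z \<and> 0 < s \<and> s \<le> \<rho> \<and> ball y s \<subseteq> U}"
    have fine: "\<exists>i\<in>K. x \<in> ball (fst i) (snd i) \<and> snd i < d" if "x \<in> Z" "0 < d" for x d
    proof -
      obtain e where "0 < e" "ball x e \<subseteq> U"
        using U(1,2) \<open>x \<in> Z\<close> by (meson open_contains_ball subsetD)
      moreover define s where "s = min (min e (d / 2)) \<rho>"
      ultimately have "(x, s) \<in> K" "s < d" "x \<in> ball x s"
        using that \<open>0 < \<rho>\<close> by (auto simp: K_def)
      then show ?thesis by force
    qed
    obtain C where C: "countable C" "C \<subseteq> K"
      and disj: "pairwise (\<lambda>i j. disjnt (ball (fst i) (snd i)) (ball (fst j) (snd j))) C"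
      and neg: "negligible (Z - (\<Union>i\<in>C. ball (fst i) (snd i)))"
      by (rule Vitali_covering_theorem_balls[of Z K fst snd]) (use fine in blast)+
    have disj': "disjoint_family_on (\<lambda>i. ball (fst i) (snd i)) C"
      using disj by (auto simp: disjoint_family_on_def pairwise_def disjnt_def)
    let ?W = "\<Union>i\<in>C. ball (fst i) (snd i)"
    have W [measurable]: "?W \<in> sets lebesgue"
      using C(1) by (intro sets.countable_UN') auto
    have W_U: "?W \<subseteq> U"
    proof (rule UN_least)
      fix i assume "i \<in> C"
      then have "i \<in> K"
        using C(2) by blast
      then show "ball (fst i) (snd i) \<subseteq> U"
        by (simp add: K_def case_prod_beta)
    qed
    have "AE z in lebesgue. z \<notin> Z - ?W"
      using neg unfolding negligible_iff_null_sets by (rule AE_not_in)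
    then have "(\<integral>\<^sup>+ z\<in>Z. G z \<partial>lebesgue) \<le> (\<integral>\<^sup>+ z\<in>?W. G z \<partial>lebesgue)"
      by (intro nn_integral_mono_AE) (auto elim!: eventually_mono simp: indicator_def)
    also have "\<dots> = emeasure (density lebesgue G) ?W"
      by (simp add: emeasure_density)
    also have "\<dots> = (\<integral>\<^sup>+ i. emeasure (density lebesgue G) (ball (fst i) (snd i)) \<partial>count_space C)"
      using C(1) disj' by (intro emeasure_UN_countable) auto
    also have "\<dots> = (\<integral>\<^sup>+ i. (\<integral>\<^sup>+ z\<in>ball (fst i) (snd i). G z \<partial>lebesgue) \<partial>count_space C)"
      by (intro nn_integral_cong) (simp add: emeasure_density)
    also have "\<dots> \<le> (\<integral>\<^sup>+ i. ennreal l * emeasure lebesgue (ball (fst i) (snd i)) \<partial>count_space C)"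
      using C(2) by (intro nn_integral_mono avg) (auto simp: K_def)
    also have "\<dots> = ennreal l * (\<integral>\<^sup>+ i. emeasure lebesgue (ball (fst i) (snd i)) \<partial>count_space C)"
      by (simp add: nn_integral_cmult)
    also have "(\<integral>\<^sup>+ i. emeasure lebesgue (ball (fst i) (snd i)) \<partial>count_space C) = emeasure lebesgue ?W"
      using C(1) disj' by (intro emeasure_UN_countable[symmetric]) auto
    also have "\<dots> \<le> emeasure lebesgue U"
      using W_U by (intro emeasure_mono) auto
    also have "\<dots> \<le> emeasure lebesgue Z + emeasure lebesgue (U - Z)"
      using emeasure_subadditive[of Z lebesgue "U - Z"] U(2) by (simp add: Un_absorb1)
    also have "\<dots> \<le> emeasure lebesgue Z + ennreal \<delta>"
      using U(4) by (intro add_left_mono) auto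
    finally show ?thesis
      by (simp add: mult_left_mono flip: distrib_left)
  qed
  have le: "(\<integral>\<^sup>+ z\<in>Z. G z \<partial>lebesgue) \<le> ennreal l * emeasure lebesgue Z"
  proof (rule ennreal_le_epsilon)
    fix e :: real assume "0 < e"
    have "(\<integral>\<^sup>+ z\<in>Z. G z \<partial>lebesgue) \<le> ennreal l * emeasure lebesgue Z + ennreal l * ennreal (e / (l + 1))"
      using \<open>0 < e\<close> \<open>0 \<le> l\<close> by (intro le_\<delta>) auto
    also have "ennreal l * ennreal (e / (l + 1)) \<le> ennreal e"
      using \<open>0 < e\<close> \<open>0 \<le> l\<close> by (simp add: ennreal_mult[symmetric] field_simps)
    finally show "(\<integral>\<^sup>+ z\<in>Z. G z \<partial>lebesgue) \<le> ennreal l * emeasure lebesgue Z + ennreal e"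
      by (simp add: add_left_mono)
  qed
  \<comment> \<open>On Z the function G is l plus the truncated difference G - l. The integral of l
    over Z is finite and cancels, so G - l has integral 0 over Z although it is positive
    there.\<close>
  have "ennreal l * emeasure lebesgue Z + (\<integral>\<^sup>+ z\<in>Z. (G z - ennreal l) \<partial>lebesgue)
      = (\<integral>\<^sup>+ z\<in>Z. ennreal l \<partial>lebesgue) + (\<integral>\<^sup>+ z\<in>Z. (G z - ennreal l) \<partial>lebesgue)"
    by (simp add: nn_integral_cmult_indicator)
  also have "\<dots> = (\<integral>\<^sup>+ z. ennreal l * indicator Z z + (G z - ennreal l) * indicator Z z \<partial>lebesgue)"
    by (rule nn_integral_add[symmetric]) measurable
  also have "\<dots> = (\<integral>\<^sup>+ z\<in>Z. G z \<partial>lebesgue)"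
    using gt by (intro nn_integral_cong) (auto simp: indicator_def less_imp_le)
  also note le
  finally have "(\<integral>\<^sup>+ z\<in>Z. (G z - ennreal l) \<partial>lebesgue) = 0"
    using Z_fin by (simp add: ennreal_add_left_cancel_le[of _ _ 0, simplified] ennreal_mult_less_top ennreal_mult_eq_top_iff less_top[symmetric])
  then have "AE z in lebesgue. (G z - ennreal l) * indicator Z z = 0"
    by (subst (asm) nn_integral_0_iff_AE) measurable
  then have "AE z in lebesgue. z \<notin> Z"
    by eventually_elim (use gt in \<open>force simp: indicator_def dest: ennreal_minus_eq_0 leD split: if_splits\<close>)
  then show ?thesis
    by (simp add: AE_iff_null_sets[OF Z])
qed

lemma borel_measurable_nn_integral_count_space:
  assumes "countable I" "\<And>i. i \<in> I \<Longrightarrow> (\<lambda>x. f x i) \<in> borel_measurable M"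
  shows "(\<lambda>x. \<integral>\<^sup>+ i. f x i \<partial>count_space I) \<in> borel_measurable M"
proof -
  interpret sigma_finite_measure "count_space I"
    by (rule sigma_finite_measure_count_space_countable) fact
  have "(\<lambda>(i, x). f x i) \<in> borel_measurable (count_space I \<Otimes>\<^sub>M M)"
    by (intro measurable_pair_measure_countable1) (use assms in auto)
  then have "(\<lambda>(x, i). f x i) \<in> borel_measurable (M \<Otimes>\<^sub>M count_space I)"
    by (subst (asm) measurable_pair_swap_iff) (simp add: case_prod_beta)
  then show ?thesis
    by (rule borel_measurable_nn_integral)
qed

context
  fixes b :: "real ^ 'n \<Rightarrow> complex" and \<beta> :: real
  assumes loc: "locally_integrable b" and \<beta>: "0 < \<beta>"
    and osc: "\<And>x r. 0 < r \<Longrightarrow> (\<integral>\<^sup>+ y\<in>ball x r. ennreal (norm (b y - ball_avg b x r)) \<partial>lebesgue)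
      \<le> ennreal \<beta> * emeasure lebesgue (ball x r)"
begin

private lemma b_meas [measurable]: "b \<in> borel_measurable lebesgue"
  by (rule locally_integrable_measurable[OF loc])

text \<open>Enlarging the domain of integration from the small ball to the large one costs the ratio
  of their volumes, a^n.\<close>

lemma ball_avg_subset_diff_le:
  assumes "0 < r" "0 < a" "ball x r \<subseteq> ball z (a * r)"
  shows "norm (ball_avg b x r - ball_avg b z (a * r)) \<le> \<beta> * a ^ CARD('n)"
proof -
  let ?V = "\<lambda>r. measure lborel (ball (0 :: real ^ 'n) r)"
  let ?d = "norm (ball_avg b x r - ball_avg b z (a * r))"
  have "ennreal ?d * emeasure lebesgue (ball x r) \<le> (\<integral>\<^sup>+ y\<in>ball x r. ennreal (norm (b y - ball_avg b z (a * r))) \<partial>lebesgue)"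
    by (rule norm_ball_avg_diff_le[OF loc \<open>0 < r\<close>])
  also have "\<dots> \<le> (\<integral>\<^sup>+ y\<in>ball z (a * r). ennreal (norm (b y - ball_avg b z (a * r))) \<partial>lebesgue)"
    by (rule nn_integral_subset_mono[OF assms(3)])
  also have "\<dots> \<le> ennreal \<beta> * emeasure lebesgue (ball z (a * r))"
    using assms by (intro osc) auto
  finally have "ennreal (?d * ?V r) \<le> ennreal (\<beta> * (a ^ CARD('n) * ?V r))"
    using assms \<beta> by (simp add: emeasure_lebesgue_ball measure_ball_scale flip: ennreal_mult)
  then have "?d * ?V r \<le> (\<beta> * a ^ CARD('n)) * ?V r"
    using assms \<beta> by (subst (asm) ennreal_le_iff) auto
  then show ?thesis
    using \<open>0 < r\<close> by simp
qed

text \<open>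
  The stopping balls of radius \<open>R a\<close> are almost maximal among the balls around \<open>a\<close> with average of
  \<open>|b - m|\<close> above \<open>\<lambda>\<close>, so the average over the ball of radius \<open>5 R a\<close> is at most \<open>\<lambda>\<close>.
\<close>

private lemma stopping_balls:
  fixes x\<^sub>0 :: "real ^ 'n" and r\<^sub>0 :: real
  assumes r\<^sub>0: "0 < r\<^sub>0"
  defines "m \<equiv> ball_avg b x\<^sub>0 (2 * r\<^sub>0)" and "l \<equiv> 4 * 10 ^ CARD('n) * \<beta>"
  obtains C R where "countable C" "\<And>a. a \<in> C \<Longrightarrow> 0 < R a"
    "\<And>a. a \<in> C \<Longrightarrow> norm (ball_avg b a (5 * R a) - m) \<le> l"
    "AE y in lebesgue. y \<in> ball x\<^sub>0 r\<^sub>0 \<longrightarrow> norm (b y - m) \<le> l \<or> y \<in> (\<Union>a\<in>C. ball a (5 * R a))"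
    "(\<integral>\<^sup>+ a. emeasure lebesgue (ball a (5 * R a)) \<partial>count_space C)
      \<le> ennreal (1 / 4 * measure lborel (ball (0 :: real ^ 'n) r\<^sub>0))"
proof -
  let ?V = "\<lambda>r. measure lborel (ball (0 :: real ^ 'n) r)"
  define G where "G = (\<lambda>y. ennreal (norm (b y - m)))"
  have G [measurable]: "G \<in> borel_measurable lebesgue"
    unfolding G_def by measurable
  have l: "0 < l"
    using \<beta> by (simp add: l_def)
  have G_total: "(\<integral>\<^sup>+ y\<in>ball x\<^sub>0 (2 * r\<^sub>0). G y \<partial>lebesgue) \<le> ennreal (\<beta> * 2 ^ CARD('n) * ?V r\<^sub>0)"
  proof -
    have "(\<integral>\<^sup>+ y\<in>ball x\<^sub>0 (2 * r\<^sub>0). G y \<partial>lebesgue) \<le> ennreal \<beta> * emeasure lebesgue (ball x\<^sub>0 (2 * r\<^sub>0))"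
      unfolding G_def m_def using r\<^sub>0 by (intro osc) auto
    also have "\<dots> = ennreal (\<beta> * 2 ^ CARD('n) * ?V r\<^sub>0)"
      using r\<^sub>0 \<beta> by (simp add: emeasure_lebesgue_ball measure_ball_scale mult.assoc flip: ennreal_mult)
    finally show ?thesis .
  qed
  define S where "S x = {\<rho>. 0 < \<rho> \<and> 5 * \<rho> \<le> r\<^sub>0 \<and>
    ennreal l * emeasure lebesgue (ball x \<rho>) < (\<integral>\<^sup>+ y\<in>ball x \<rho>. G y \<partial>lebesgue)}" for x
  define E where "E = {x \<in> ball x\<^sub>0 r\<^sub>0. S x \<noteq> {}}"
  have avg_le: "(\<integral>\<^sup>+ y\<in>ball x \<rho>. G y \<partial>lebesgue) \<le> ennreal l * emeasure lebesgue (ball x \<rho>)"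
    if x: "x \<in> ball x\<^sub>0 r\<^sub>0" and \<rho>: "0 < \<rho>" "\<rho> \<le> r\<^sub>0" "\<rho> \<notin> S x" for x \<rho>
  proof (cases "5 * \<rho> \<le> r\<^sub>0")
    case True
    then show ?thesis
      using \<rho> by (simp add: S_def)
  next
    case False
    \<comment> \<open>A ball of radius above \<open>r\<^sub>0 / 5\<close> has at least 10^(-n) times
      the volume of the ball of radius \<open>2 * r\<^sub>0\<close>, so its average is at most 10^n
      * \<beta> and hence below l.\<close>
    have "ball x \<rho> \<subseteq> ball x\<^sub>0 (2 * r\<^sub>0)"
    proof
      fix y assume "y \<in> ball x \<rho>"
      then show "y \<in> ball x\<^sub>0 (2 * r\<^sub>0)"
        using x \<rho>(2) dist_triangle[of x\<^sub>0 y x] by simp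
    qed
    then have "(\<integral>\<^sup>+ y\<in>ball x \<rho>. G y \<partial>lebesgue) \<le> (\<integral>\<^sup>+ y\<in>ball x\<^sub>0 (2 * r\<^sub>0). G y \<partial>lebesgue)"
      by (rule nn_integral_subset_mono)
    also note G_total
    also have "\<beta> * 2 ^ CARD('n) * ?V r\<^sub>0 \<le> \<beta> * 2 ^ CARD('n) * ?V (5 * \<rho>)"
    proof (intro mult_left_mono)
      have "r\<^sub>0 ^ CARD('n) \<le> (5 * \<rho>) ^ CARD('n)"
        using False r\<^sub>0 by (intro power_mono) auto
      then show "?V r\<^sub>0 \<le> ?V (5 * \<rho>)"
        using r\<^sub>0 \<rho>(1) by (simp only: content_ball) (simp add: content_ball mult_left_mono)
    qed (use \<beta> in auto)
    also have "\<dots> = \<beta> * (2 * 5) ^ CARD('n) * ?V \<rho>"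
      unfolding power_mult_distrib using \<rho> by (simp add: measure_ball_scale)
    also have "\<dots> \<le> l * ?V \<rho>"
      unfolding l_def using \<beta> by (intro mult_right_mono) auto
    finally show ?thesis
      using l by (simp add: emeasure_lebesgue_ball ennreal_mult ennreal_leI)
  qed
  \<comment> \<open>The supremum of \<open>S x\<close> need not be attained. Any stopping radius
    above a fifth of it works, and 5 is also the enlargement factor of the Vitali covering used
    next.\<close>
  have "\<exists>\<rho>. \<rho> \<in> S x \<and> 5 * \<rho> \<notin> S x" if "x \<in> E" for x
  proof -
    have bdd: "bdd_above (S x)"
      by (intro bdd_aboveI[of _ r\<^sub>0]) (auto simp: S_def)
    obtain \<rho>\<^sub>0 where \<rho>\<^sub>0: "\<rho>\<^sub>0 \<in> S x"
      using \<open>x \<in> E\<close> by (auto simp: E_def)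
    then have "0 < Sup (S x)"
      using cSup_upper[OF \<rho>\<^sub>0 bdd] by (auto simp: S_def)
    then obtain \<rho> where "\<rho> \<in> S x" "Sup (S x) / 5 < \<rho>"
      using less_cSupE[of "Sup (S x) / 5" "S x"] \<rho>\<^sub>0 by auto
    moreover have "5 * \<rho> \<notin> S x" if "Sup (S x) / 5 < \<rho>" for \<rho>
      using cSup_upper[OF _ bdd, of "5 * \<rho>"] that by auto
    ultimately show ?thesis
      by blast
  qed
  then obtain R where R: "\<And>x. x \<in> E \<Longrightarrow> R x \<in> S x" "\<And>x. x \<in> E \<Longrightarrow> 5 * R x \<notin> S x"
    by metis
  have R_pos: "0 < R x" "5 * R x \<le> r\<^sub>0" if "x \<in> E" for x
    using R(1)[OF that] by (auto simp: S_def)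
  obtain C where C: "countable C" "C \<subseteq> E"
    and disj: "pairwise (\<lambda>i j. disjnt (cball i (R i)) (cball j (R j))) C"
    and cover: "\<And>i. i \<in> E \<Longrightarrow> \<exists>j. j \<in> C \<and> \<not> disjnt (cball i (R i)) (cball j (R j)) \<and> cball i (R i) \<subseteq> ball j (5 * R j)"
  proof (rule Vitali_covering_lemma_cballs_balls[of E R r\<^sub>0 "\<lambda>x. x"])
    show "0 < R i \<and> R i \<le> r\<^sub>0" if "i \<in> E" for i
      using R_pos[OF that] by auto
  qed blast
  let ?D = "\<Union>a\<in>C. ball a (5 * R a)"
  have "open ?D"
    by auto
  then have D [measurable]: "?D \<in> sets lebesgue"
    by (simp add: borel_open)
  have E_D: "E \<subseteq> ?D"
  proof
    fix x assume x: "x \<in> E"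
    then obtain j where "j \<in> C" "cball x (R x) \<subseteq> ball j (5 * R j)"
      using cover by blast
    moreover have "x \<in> cball x (R x)"
      using R_pos[OF x] by simp
    ultimately show "x \<in> ?D"
      by blast
  qed
  show thesis
  proof
    show "countable C" by fact
    show "0 < R a" if "a \<in> C" for a
      using R_pos(1) C(2) that by blast
    show "norm (ball_avg b a (5 * R a) - m) \<le> l" if "a \<in> C" for a
    proof -
      have a: "a \<in> E"
        using C(2) that by blast
      note pos = R_pos[OF a]
      have "ennreal (norm (ball_avg b a (5 * R a) - m)) * emeasure lebesgue (ball a (5 * R a))
          \<le> (\<integral>\<^sup>+ y\<in>ball a (5 * R a). G y \<partial>lebesgue)"
        unfolding G_def using pos by (intro norm_ball_avg_diff_le loc) auto
      also have "\<dots> \<le> ennreal l * emeasure lebesgue (ball a (5 * R a))"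
        using a pos R(2)[OF a] by (intro avg_le) (auto simp: E_def)
      finally have "norm (ball_avg b a (5 * R a) - m) * ?V (5 * R a) \<le> l * ?V (5 * R a)"
        using l by (simp add: emeasure_lebesgue_ball flip: ennreal_mult)
      moreover have "0 < ?V (5 * R a)"
        using pos by auto
      ultimately show ?thesis
        by simp
    qed
    have "{y \<in> space lebesgue. ennreal l < G y} \<in> sets lebesgue"
      by measurable
    then have Z: "{y \<in> ball x\<^sub>0 r\<^sub>0. ennreal l < G y} - ?D \<in> sets lebesgue"
      using sets.Int[OF ball_sets_lebesgue, of "{y. ennreal l < G y}" x\<^sub>0 r\<^sub>0]
      by (intro sets.Diff D) (simp add: ball_def Collect_conj_eq)
    have "{y \<in> ball x\<^sub>0 r\<^sub>0. ennreal l < G y} - ?D \<in> null_sets lebesgue"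
    proof (rule null_sets_averages_le[OF G _ _ Z, of l "r\<^sub>0 / 5"])
      show "emeasure lebesgue ({y \<in> ball x\<^sub>0 r\<^sub>0. ennreal l < G y} - ?D) < \<infinity>"
        by (rule le_less_trans[OF emeasure_mono[of _ "ball x\<^sub>0 r\<^sub>0"]]) (auto simp: emeasure_lebesgue_ball)
      fix y s
      assume "y \<in> {y \<in> ball x\<^sub>0 r\<^sub>0. ennreal l < G y} - ?D" and s: "0 < s" "s \<le> r\<^sub>0 / 5"
      then have "y \<in> ball x\<^sub>0 r\<^sub>0" "y \<notin> E"
        using E_D by auto
      then have "s \<notin> S y"
        by (auto simp: E_def)
      then show "(\<integral>\<^sup>+ z\<in>ball y s. G z \<partial>lebesgue) \<le> ennreal l * emeasure lebesgue (ball y s)"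
        using \<open>y \<in> ball x\<^sub>0 r\<^sub>0\<close> s r\<^sub>0 by (intro avg_le) auto
    qed (use l r\<^sub>0 in auto)
    from AE_not_in[OF this]
    show "AE y in lebesgue. y \<in> ball x\<^sub>0 r\<^sub>0 \<longrightarrow> norm (b y - m) \<le> l \<or> y \<in> ?D"
      by eventually_elim (use l in \<open>auto simp: G_def ennreal_less_iff\<close>)
    have "(\<integral>\<^sup>+ a. emeasure lebesgue (ball a (5 * R a)) \<partial>count_space C)
        \<le> (\<integral>\<^sup>+ a. ennreal (5 ^ CARD('n) / l) * (\<integral>\<^sup>+ y\<in>ball a (R a). G y \<partial>lebesgue) \<partial>count_space C)"
    proof (rule nn_integral_mono)
      fix a assume "a \<in> space (count_space C)"
      then have a: "a \<in> E"
        using C(2) by auto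
      have "emeasure lebesgue (ball a (5 * R a)) = ennreal (5 ^ CARD('n) / l) * (ennreal l * emeasure lebesgue (ball a (R a)))"
        using R_pos[OF a] l by (simp add: emeasure_lebesgue_ball measure_ball_scale flip: ennreal_mult)
      also have "\<dots> \<le> ennreal (5 ^ CARD('n) / l) * (\<integral>\<^sup>+ y\<in>ball a (R a). G y \<partial>lebesgue)"
        using R(1)[OF a] by (intro mult_left_mono) (auto simp: S_def)
      finally show "emeasure lebesgue (ball a (5 * R a))
          \<le> ennreal (5 ^ CARD('n) / l) * (\<integral>\<^sup>+ y\<in>ball a (R a). G y \<partial>lebesgue)" .
    qed
    also have "\<dots> = ennreal (5 ^ CARD('n) / l) * (\<integral>\<^sup>+ a. emeasure (density lebesgue G) (ball a (R a)) \<partial>count_space C)"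
      by (simp add: nn_integral_cmult emeasure_density)
    also have "(\<integral>\<^sup>+ a. emeasure (density lebesgue G) (ball a (R a)) \<partial>count_space C)
        = emeasure (density lebesgue G) (\<Union>a\<in>C. ball a (R a))"
    proof (rule emeasure_UN_countable[symmetric])
      have "ball i (R i) \<inter> ball j (R j) \<subseteq> cball i (R i) \<inter> cball j (R j)" for i j
        using ball_subset_cball by blast
      then show "disjoint_family_on (\<lambda>a. ball a (R a)) C"
        using disj by (fastforce simp: disjoint_family_on_def pairwise_def disjnt_def)
    qed (use C in auto)
    also have "\<dots> \<le> emeasure (density lebesgue G) (ball x\<^sub>0 (2 * r\<^sub>0))"
    proof (rule emeasure_mono)
      show "(\<Union>a\<in>C. ball a (R a)) \<subseteq> ball x\<^sub>0 (2 * r\<^sub>0)"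
      proof (rule UN_least, rule subsetI)
        fix a y assume "a \<in> C" "y \<in> ball a (R a)"
        then have "dist a y < R a" "dist x\<^sub>0 a < r\<^sub>0" "0 < R a" "5 * R a \<le> r\<^sub>0"
          using C(2) R_pos[of a] by (auto simp: E_def)
        then show "y \<in> ball x\<^sub>0 (2 * r\<^sub>0)"
          using dist_triangle[of x\<^sub>0 y a] by simp
      qed
    qed auto
    also have "\<dots> \<le> ennreal (\<beta> * 2 ^ CARD('n) * ?V r\<^sub>0)"
      using G_total by (simp add: emeasure_density)
    also have "ennreal (5 ^ CARD('n) / l) * ennreal (\<beta> * 2 ^ CARD('n) * ?V r\<^sub>0) = ennreal (5 ^ CARD('n) / l * (\<beta> * 2 ^ CARD('n) * ?V r\<^sub>0))"
      using l \<beta> by (intro ennreal_mult[symmetric]) auto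
    \<comment> \<open>The origin of l: 5^n from the enlarged balls and 2^n from the ball of twice
      the radius cancel its factor 10^n, and its factor 4 leaves a quarter of the volume.\<close>
    also have "5 ^ CARD('n) / l * (\<beta> * 2 ^ CARD('n) * ?V r\<^sub>0) = 1 / 4 * ?V r\<^sub>0"
    proof -
      have "(10 :: real) ^ CARD('n) = 5 ^ CARD('n) * 2 ^ CARD('n)"
        by (simp flip: power_mult_distrib)
      then show ?thesis
        using \<beta> by (simp add: l_def field_simps)
    qed
    finally show "(\<integral>\<^sup>+ a. emeasure lebesgue (ball a (5 * R a)) \<partial>count_space C) \<le> ennreal (1 / 4 * ?V r\<^sub>0)"
      by (simp add: mult_left_mono)
  qed
qed

text \<open>John--Nirenberg in integrated form, by absorption. The supremum \<open>M K\<close> of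
  the averages of exponentials cut off at height K satisfies M \<le> exp (c * l) + M / 2. The
  cut-off makes it finite, so M / 2 can be moved to the left; the resulting bound does not depend on
  K, and monotone convergence removes the cut-off.\<close>

lemma exp_integral_bound:
  obtains c A where "0 < c"
    "\<And>x r. 0 < r \<Longrightarrow> (\<integral>\<^sup>+ y\<in>ball x r. ennreal (exp (c * norm (b y - ball_avg b x r))) \<partial>lebesgue)
      \<le> ennreal A * emeasure lebesgue (ball x r)"
proof -
  let ?V = "\<lambda>r. measure lborel (ball (0 :: real ^ 'n) r)"
  define l where "l = 4 * 10 ^ CARD('n) * \<beta>"
  \<comment> \<open>The reference value of a ball and that of one of its stopping balls differ by at
    most l (stopping) plus \<beta> * 2^n (doubling), together A. Since exp (c * A) = 2, exchanging
    them costs a factor 2, which against the volume fraction 1/4 leaves the 1/2 that is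
    absorbed.\<close>
  define A where "A = \<beta> * 2 ^ CARD('n) + l"
  define c where "c = ln 2 / A"
  have l: "0 < l"
    using \<beta> by (simp add: l_def)
  then have A: "0 < A"
    using \<beta> by (simp add: A_def add_pos_pos)
  have c: "0 < c" "exp (c * A) = 2"
    using A by (auto simp: c_def)
  \<comment> \<open>The reference average is taken over the doubled ball, because
    \<open>stopping_balls\<close> compares with that average.\<close>
  define f where "f K x r y = ennreal (exp (c * min K (norm (b y - ball_avg b x (2 * r)))))" for K x r y
  define F where "F K x r = (\<integral>\<^sup>+ y\<in>ball x r. f K x r y \<partial>lebesgue)" for K x r
  define M where "M K = (SUP (x, r)\<in>UNIV \<times> {0<..}. F K x r * ennreal (1 / ?V r))" for K
  have f_meas [measurable]: "f K x r \<in> borel_measurable lebesgue" for K x r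
    unfolding f_def by measurable
  have M_finite: "M K < \<infinity>" for K
  proof -
    have "F K x r * ennreal (1 / ?V r) \<le> ennreal (exp (c * K))" if "0 < r" for x r
    proof -
      have "F K x r \<le> (\<integral>\<^sup>+ y\<in>ball x r. ennreal (exp (c * K)) \<partial>lebesgue)"
        unfolding F_def f_def using c by (intro nn_integral_mono mult_right_mono ennreal_leI) auto
      also have "\<dots> = ennreal (exp (c * K) * ?V r)"
        by (simp add: nn_integral_cmult_indicator emeasure_lebesgue_ball ennreal_mult)
      finally have "F K x r * ennreal (1 / ?V r) \<le> ennreal (exp (c * K) * ?V r) * ennreal (1 / ?V r)"
        by (rule mult_right_mono) auto
      also have "\<dots> = ennreal (exp (c * K))"
        using that by (simp flip: ennreal_mult)
      finally show ?thesis .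
    qed
    then have "M K \<le> ennreal (exp (c * K))"
      unfolding M_def by (intro SUP_least) auto
    then show ?thesis
      by (rule le_less_trans) simp
  qed
  have F_le: "F K x r \<le> M K * emeasure lebesgue (ball x r)" if "0 < r" for K x r
  proof -
    have "F K x r = F K x r * ennreal (1 / ?V r) * emeasure lebesgue (ball x r)"
      using that
      by (simp add: emeasure_lebesgue_ball mult.assoc flip: ennreal_mult)
    also have "\<dots> \<le> M K * emeasure lebesgue (ball x r)"
      unfolding M_def using that by (intro mult_right_mono SUP_upper2[of "(x, r)"]) auto
    finally show ?thesis .
  qed
  have step: "F K x r \<le> (ennreal (exp (c * l)) + ennreal (1 / 2) * M K) * ennreal (?V r)" if r: "0 < r" for K x r
  proof -
    obtain C R where C: "countable C" and R: "\<And>a. a \<in> C \<Longrightarrow> 0 < R a"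
      and avg: "\<And>a. a \<in> C \<Longrightarrow> norm (ball_avg b a (5 * R a) - ball_avg b x (2 * r)) \<le> l"
      and AE: "AE y in lebesgue. y \<in> ball x r \<longrightarrow> norm (b y - ball_avg b x (2 * r)) \<le> l \<or> y \<in> (\<Union>a\<in>C. ball a (5 * R a))"
      and small: "(\<integral>\<^sup>+ a. emeasure lebesgue (ball a (5 * R a)) \<partial>count_space C) \<le> ennreal (1 / 4 * ?V r)"
      using stopping_balls[OF r, where x\<^sub>0 = x] unfolding l_def by blast
    have bound: "f K x r y \<le> 2 * f K a (5 * R a) y" if a: "a \<in> C" for a y
    proof -
      have "norm (ball_avg b a (5 * R a) - ball_avg b a (2 * (5 * R a))) \<le> \<beta> * 2 ^ CARD('n)"
        using R[OF a] by (intro ball_avg_subset_diff_le) auto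
      then have "norm (ball_avg b a (2 * (5 * R a)) - ball_avg b x (2 * r)) \<le> A"
        using norm_diff_triangle_le[of "ball_avg b a (2 * (5 * R a))" "ball_avg b a (5 * R a)" "\<beta> * 2 ^ CARD('n)"
            "ball_avg b x (2 * r)" l] avg[OF a] by (simp add: A_def norm_minus_commute)
      then have "norm (b y - ball_avg b x (2 * r)) \<le> norm (b y - ball_avg b a (2 * (5 * R a))) + A"
        using norm_diff_triangle_le[of "b y" "ball_avg b a (2 * (5 * R a))" _ "ball_avg b x (2 * r)" A] by simp
      then have "min K (norm (b y - ball_avg b x (2 * r))) \<le> A + min K (norm (b y - ball_avg b a (2 * (5 * R a))))"
        using A by auto
      then have "exp (c * min K (norm (b y - ball_avg b x (2 * r))))
          \<le> exp (c * (A + min K (norm (b y - ball_avg b a (2 * (5 * R a))))))"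
        using c by simp
      also have "\<dots> = 2 * exp (c * min K (norm (b y - ball_avg b a (2 * (5 * R a)))))"
        using c by (simp add: distrib_left exp_add)
      finally show ?thesis
        unfolding f_def by (simp add: ennreal_leI flip: ennreal_mult ennreal_numeral)
    qed
    have "F K x r \<le> (\<integral>\<^sup>+ y. ennreal (exp (c * l)) * indicator (ball x r) y
        + (\<integral>\<^sup>+ a. 2 * f K a (5 * R a) y * indicator (ball a (5 * R a)) y \<partial>count_space C) \<partial>lebesgue)"
      unfolding F_def
    proof (intro nn_integral_mono_AE, use AE in eventually_elim)
      case (elim y)
      show ?case
      proof (cases "y \<in> ball x r")
        case y: True
        consider "norm (b y - ball_avg b x (2 * r)) \<le> l" | a where "a \<in> C" "y \<in> ball a (5 * R a)"
          using elim y by blast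
        then show ?thesis
        proof cases
          case 1
          then have "f K x r y \<le> ennreal (exp (c * l))"
            unfolding f_def using c by (intro ennreal_leI) auto
          with y show ?thesis
            by (auto intro: add_increasing2)
        next
          case 2
          have "f K x r y \<le> 2 * f K a (5 * R a) y * indicator (ball a (5 * R a)) y"
            using bound[OF 2(1), of y] 2(2) by simp
          also have "\<dots> \<le> (\<integral>\<^sup>+ a. 2 * f K a (5 * R a) y * indicator (ball a (5 * R a)) y \<partial>count_space C)"
            using 2(1) by (rule nn_integral_ge_point)
          finally show ?thesis
            using y by (auto intro: add_increasing)
        qed
      qed simp
    qed
    also have "\<dots> = ennreal (exp (c * l)) * ennreal (?V r)
        + (\<integral>\<^sup>+ y. (\<integral>\<^sup>+ a. 2 * f K a (5 * R a) y * indicator (ball a (5 * R a)) y \<partial>count_space C) \<partial>lebesgue)"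
    proof (subst nn_integral_add)
      show "(\<lambda>y. \<integral>\<^sup>+ a. 2 * f K a (5 * R a) y * indicator (ball a (5 * R a)) y \<partial>count_space C) \<in> borel_measurable lebesgue"
        using C by (intro borel_measurable_nn_integral_count_space) measurable
    qed (auto simp: nn_integral_cmult_indicator emeasure_lebesgue_ball)
    also have "(\<integral>\<^sup>+ y. (\<integral>\<^sup>+ a. 2 * f K a (5 * R a) y * indicator (ball a (5 * R a)) y \<partial>count_space C) \<partial>lebesgue)
        = (\<integral>\<^sup>+ a. (\<integral>\<^sup>+ y. 2 * f K a (5 * R a) y * indicator (ball a (5 * R a)) y \<partial>lebesgue) \<partial>count_space C)"
      using C by (intro nn_integral_count_space_nn_integral) measurable
    also have "\<dots> = (\<integral>\<^sup>+ a. 2 * F K a (5 * R a) \<partial>count_space C)"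
      unfolding F_def by (intro nn_integral_cong) (simp add: mult.assoc nn_integral_cmult)
    also have "\<dots> \<le> (\<integral>\<^sup>+ a. 2 * M K * emeasure lebesgue (ball a (5 * R a)) \<partial>count_space C)"
      unfolding mult.assoc using R by (intro nn_integral_mono mult_left_mono F_le) auto
    also have "\<dots> = 2 * M K * (\<integral>\<^sup>+ a. emeasure lebesgue (ball a (5 * R a)) \<partial>count_space C)"
      by (rule nn_integral_cmult) simp
    also have "\<dots> \<le> 2 * M K * ennreal (1 / 4 * ?V r)"
      by (intro mult_left_mono small) auto
    also have "\<dots> = ennreal (1 / 2) * M K * ennreal (?V r)"
    proof -
      have "2 * M K * ennreal (1 / 4 * ?V r) = M K * (ennreal 2 * ennreal (1 / 4 * ?V r))"
        by (simp add: mult_ac)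
      also have "ennreal 2 * ennreal (1 / 4 * ?V r) = ennreal (1 / 2) * ennreal (?V r)"
        by (subst (1 2) ennreal_mult[symmetric]) auto
      finally show ?thesis
        by (simp add: mult_ac)
    qed
    finally show ?thesis
      by (simp add: distrib_right add_left_mono)
  qed
  have M_le: "M K \<le> ennreal (2 * exp (c * l))" for K
  proof -
    have "F K x r * ennreal (1 / ?V r) \<le> ennreal (exp (c * l)) + ennreal (1 / 2) * M K" if "0 < r" for x r
    proof -
      have "F K x r * ennreal (1 / ?V r) \<le> (ennreal (exp (c * l)) + ennreal (1 / 2) * M K) * ennreal (?V r) * ennreal (1 / ?V r)"
        by (intro mult_right_mono step that) auto
      also have "\<dots> = ennreal (exp (c * l)) + ennreal (1 / 2) * M K"
        using that by (simp add: mult.assoc flip: ennreal_mult)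
      finally show ?thesis .
    qed
    \<comment> \<open>Absorption: \<open>M K\<close> is finite, so the inequality can be solved as
      one between real numbers.\<close>
    then have le: "M K \<le> ennreal (exp (c * l)) + ennreal (1 / 2) * M K"
      by (subst M_def) (intro SUP_least, auto)
    obtain m where m: "M K = ennreal m" "0 \<le> m"
      using M_finite[of K] by (cases "M K") auto
    have "ennreal (exp (c * l)) + ennreal (1 / 2) * M K = ennreal (exp (c * l) + 1 / 2 * m)"
      using m(2) by (subst m(1), subst ennreal_mult[symmetric]) (auto intro!: ennreal_plus[symmetric])
    then have "ennreal m \<le> ennreal (exp (c * l) + 1 / 2 * m)"
      using le m(1) by simp
    then have "m \<le> exp (c * l) + 1 / 2 * m"
      using m(2) by (subst (asm) ennreal_le_iff) auto
    then show ?thesis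
      using m by (simp add: ennreal_leI)
  qed
  have double: "(\<integral>\<^sup>+ y\<in>ball x r. ennreal (exp (c * norm (b y - ball_avg b x (2 * r)))) \<partial>lebesgue)
      \<le> ennreal (2 * exp (c * l)) * emeasure lebesgue (ball x r)" if r: "0 < r" for x r
  proof -
    let ?g = "\<lambda>y. norm (b y - ball_avg b x (2 * r))"
    have sup: "(SUP k :: nat. f (real k) x r y) = ennreal (exp (c * ?g y))" for y
    proof (rule antisym)
      show "(SUP k :: nat. f (real k) x r y) \<le> ennreal (exp (c * ?g y))"
        unfolding f_def using c by (intro SUP_least ennreal_leI) auto
      obtain k :: nat where "?g y \<le> real k"
        using real_arch_simple by blast
      then show "ennreal (exp (c * ?g y)) \<le> (SUP k :: nat. f (real k) x r y)"
        by (intro SUP_upper2[of k]) (auto simp: f_def min_absorb2)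
    qed
    have "(\<integral>\<^sup>+ y\<in>ball x r. ennreal (exp (c * ?g y)) \<partial>lebesgue)
        = (\<integral>\<^sup>+ y. (SUP k :: nat. f (real k) x r y * indicator (ball x r) y) \<partial>lebesgue)"
      by (intro nn_integral_cong) (auto simp: SUP_mult_right_ennreal[symmetric] sup)
    also have "\<dots> = (SUP k :: nat. F (real k) x r)"
      unfolding F_def
    proof (rule nn_integral_monotone_convergence_SUP)
      show "incseq (\<lambda>k y. f (real k) x r y * indicator (ball x r) y)"
        unfolding f_def using c
        by (intro monoI le_funI mult_right_mono ennreal_leI) (auto simp: min_def)
    qed measurable
    also have "\<dots> \<le> ennreal (2 * exp (c * l)) * emeasure lebesgue (ball x r)"
      by (intro SUP_least order_trans[OF F_le[OF r]] mult_right_mono M_le) auto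
    finally show ?thesis .
  qed
  show thesis
  proof (rule that[OF c(1)])
    fix x :: "real ^ 'n" and r :: real assume r: "0 < r"
    \<comment> \<open>Returning from the average over the doubled ball to that over the ball itself
      costs one more factor exp (c * A) = 2.\<close>
    have "norm (ball_avg b x r - ball_avg b x (2 * r)) \<le> \<beta> * 2 ^ CARD('n)"
      using r by (intro ball_avg_subset_diff_le) auto
    then have "norm (b y - ball_avg b x r) \<le> norm (b y - ball_avg b x (2 * r)) + A" for y
      using norm_diff_triangle_le[of "b y" "ball_avg b x (2 * r)" _ "ball_avg b x r" A] l
      by (simp add: A_def norm_minus_commute)
    then have "exp (c * norm (b y - ball_avg b x r)) \<le> exp (c * (norm (b y - ball_avg b x (2 * r)) + A))" for y
      using c by simp
    also have "exp (c * (norm (b y - ball_avg b x (2 * r)) + A)) = 2 * exp (c * norm (b y - ball_avg b x (2 * r)))" for y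
      using c by (simp add: distrib_left exp_add)
    finally have "(\<integral>\<^sup>+ y\<in>ball x r. ennreal (exp (c * norm (b y - ball_avg b x r))) \<partial>lebesgue)
        \<le> (\<integral>\<^sup>+ y. 2 * (ennreal (exp (c * norm (b y - ball_avg b x (2 * r)))) * indicator (ball x r) y) \<partial>lebesgue)"
      by (intro nn_integral_mono) (auto simp: indicator_def ennreal_leI simp flip: ennreal_mult ennreal_numeral)
    also have "\<dots> = 2 * (\<integral>\<^sup>+ y\<in>ball x r. ennreal (exp (c * norm (b y - ball_avg b x (2 * r)))) \<partial>lebesgue)"
      by (rule nn_integral_cmult) measurable
    also have "\<dots> \<le> 2 * (ennreal (2 * exp (c * l)) * emeasure lebesgue (ball x r))"
      by (intro mult_left_mono double r) auto
    also have "\<dots> = ennreal (2 * (2 * exp (c * l))) * emeasure lebesgue (ball x r)"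
      by (subst ennreal_mult) (auto simp: mult.assoc)
    finally show "(\<integral>\<^sup>+ y\<in>ball x r. ennreal (exp (c * norm (b y - ball_avg b x r))) \<partial>lebesgue)
        \<le> ennreal (2 * (2 * exp (c * l))) * emeasure lebesgue (ball x r)" .
  qed
qed

end

section \<open>Oscillation, drift of averages and mixed norms of BMO functions\<close>

lemma BMO_oscillation:
  fixes b :: "real ^ 'n \<Rightarrow> complex"
  assumes "b \<in> BMO"
  obtains \<beta> where "0 < \<beta>" "\<And>x r. 0 < r \<Longrightarrow>
    (\<integral>\<^sup>+ y\<in>ball x r. ennreal (norm (b y - ball_avg b x r)) \<partial>lebesgue) \<le> ennreal \<beta> * emeasure lebesgue (ball x r)"
proof
  \<comment> \<open>The added 1 keeps the constant positive when the BMO seminorm is 0.\<close>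
  let ?\<beta> = "enn2real (BMO_norm b) + 1"
  show "0 < ?\<beta>"
    by (simp add: add_nonneg_pos)
  fix x :: "real ^ 'n" and r :: real assume r: "0 < r"
  let ?m = "emeasure lebesgue (ball x r)"
  let ?I = "\<integral>\<^sup>+ y\<in>ball x r. ennreal (norm (b y - ball_avg b x r)) \<partial>lebesgue"
  have m: "?m \<noteq> 0" "?m \<noteq> top"
    using r by (simp_all add: emeasure_lebesgue_ball)
  have "?m * inverse ?m = 1"
    using m by (simp add: ennreal_divide_self less_top flip: divide_ennreal_def)
  then have "?I = ?m * inverse ?m * ?I"
    by (simp only: mult_1_left)
  also have "\<dots> = inverse ?m * ?I * ?m"
    by (simp only: mult_ac)
  also have "\<dots> \<le> BMO_norm b * ?m"
  proof (rule mult_right_mono)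
    show "inverse ?m * ?I \<le> BMO_norm b"
      unfolding BMO_norm_def by (rule SUP_upper2[of "(x, r)"]) (use r in simp_all)
  qed simp
  also have "\<dots> \<le> ennreal ?\<beta> * ?m"
  proof (intro mult_right_mono)
    have "BMO_norm b < \<infinity>"
      using assms by (simp add: BMO_def)
    then have "BMO_norm b = ennreal (enn2real (BMO_norm b))"
      by (simp only: ennreal_enn2real infinity_ennreal_def)
    also have "\<dots> \<le> ennreal ?\<beta>"
      by (intro ennreal_leI) auto
    finally show "BMO_norm b \<le> ennreal ?\<beta>" .
  qed auto
  finally show "?I \<le> ennreal ?\<beta> * ?m" .
qed

text \<open>Each doubling of the radius moves the average by at most \<beta> * 2^n, so j doublings
  move it by at most j times that. The 1 added on both sides turns this additive drift into the
  factor 1 + j of the dyadic series.\<close>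

lemma BMO_dyadic_avg:
  fixes b :: "real ^ 'n \<Rightarrow> complex"
  assumes "b \<in> BMO"
  obtains \<kappa> where "1 \<le> \<kappa>" "\<And>x r j y. 0 < r \<Longrightarrow>
    norm (b y - ball_avg b x r) + 1 \<le> \<kappa> * (1 + real j) * (norm (b y - ball_avg b x (2 ^ j * r)) + 1)"
proof -
  obtain \<beta> where \<beta>: "0 < \<beta>" and osc: "\<And>x r. 0 < r \<Longrightarrow>
    (\<integral>\<^sup>+ y\<in>ball x r. ennreal (norm (b y - ball_avg b x r)) \<partial>lebesgue) \<le> ennreal \<beta> * emeasure lebesgue (ball x r)"
    using BMO_oscillation[OF assms] by blast
  have loc: "locally_integrable b"
    using assms by (simp add: BMO_def)
  define d where "d = \<beta> * 2 ^ CARD('n)"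
  have "0 < d"
    using \<beta> by (simp add: d_def)
  have chain: "norm (ball_avg b x r - ball_avg b x (2 ^ j * r)) \<le> real j * d" if r: "0 < r" for x r j
  proof (induction j)
    case (Suc j)
    have "norm (ball_avg b x (2 ^ j * r) - ball_avg b x (2 * (2 ^ j * r))) \<le> d"
      unfolding d_def using r by (intro ball_avg_subset_diff_le[OF loc \<beta> osc] subset_ball) auto
    then show ?case
      using norm_diff_triangle_le[OF Suc, of "ball_avg b x (2 * (2 ^ j * r))" d]
      by (simp add: distrib_right mult.assoc add.commute)
  qed simp
  show thesis
  proof
    show "1 \<le> 1 + d"
      using \<open>0 < d\<close> by simp
    fix x y :: "real ^ 'n" and r :: real and j :: nat assume r: "0 < r"
    let ?u = "norm (b y - ball_avg b x (2 ^ j * r))"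
    have "norm (b y - ball_avg b x r) \<le> ?u + real j * d"
      using norm_diff_triangle_le[of "b y" "ball_avg b x (2 ^ j * r)" ?u "ball_avg b x r" "real j * d"]
        chain[OF r, of x j] by (simp add: norm_minus_commute)
    also have "?u + real j * d + 1 \<le> (1 + d) * (1 + real j) * (?u + 1)"
      using \<open>0 < d\<close> by (simp add: algebra_simps add_increasing)
    finally show "norm (b y - ball_avg b x r) + 1 \<le> (1 + d) * (1 + real j) * (?u + 1)"
      by simp
  qed
qed

text \<open>The inequality z \<le> exp z at z = c * (u + 1) / P, raised to the power P.\<close>

lemma powr_le_exp:
  fixes P c u :: real
  assumes "0 < P" "0 < c" "0 \<le> u"
  shows "(u + 1) powr P \<le> (P / c) powr P * exp c * exp (c * u)"
proof -
  have "c * (u + 1) / P \<le> exp (c * (u + 1) / P)"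
    using exp_ge_add_one_self[of "c * (u + 1) / P"] by linarith
  then have "u + 1 \<le> P / c * exp (c * (u + 1) / P)"
    using assms by (simp add: field_simps)
  then have "(u + 1) powr P \<le> (P / c * exp (c * (u + 1) / P)) powr P"
    using assms by (intro powr_mono2) auto
  also have "\<dots> = (P / c) powr P * exp (c * (u + 1))"
    using assms by (subst powr_mult) (auto simp: exp_powr_real)
  finally show ?thesis
    by (simp add: distrib_left exp_add mult_ac)
qed

text \<open>The lemma is used with conjugate exponents in the dyadic series and with the exponents
  q, possibly below 1, on the target side. The exponential integral contributes r^(n / P) and the
  passage to the exponent P contributes \<open>r powr (inv_sum p - n / P)\<close>, so P disappears
  from the power of r.\<close>

lemma mnorm_BMO:
  fixes b :: "real ^ 'n::{finite,linorder} \<Rightarrow> complex"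
  assumes b: "b \<in> BMO" and p: "\<And>j. 0 < p j"
  obtains C where "0 \<le> C" "\<And>x r. 0 < r \<Longrightarrow>
    mnorm p (\<lambda>y. ennreal (norm (b y - ball_avg b x r) + 1) * indicator (ball x r) y)
      \<le> ennreal (C * r powr inv_sum p)"
proof -
  obtain \<beta> where \<beta>: "0 < \<beta>" and osc: "\<And>x r. 0 < r \<Longrightarrow>
    (\<integral>\<^sup>+ y\<in>ball x r. ennreal (norm (b y - ball_avg b x r)) \<partial>lebesgue) \<le> ennreal \<beta> * emeasure lebesgue (ball x r)"
    using BMO_oscillation[OF b] by blast
  have loc: "locally_integrable b"
    using b by (simp add: BMO_def)
  have [measurable]: "b \<in> borel_measurable lebesgue"
    by (rule locally_integrable_measurable[OF loc])
  obtain c A0 where c: "0 < c" and JN0: "\<And>x r. 0 < r \<Longrightarrow>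
      (\<integral>\<^sup>+ y\<in>ball x r. ennreal (exp (c * norm (b y - ball_avg b x r))) \<partial>lebesgue) \<le> ennreal A0 * emeasure lebesgue (ball x r)"
    using exp_integral_bound[OF loc \<beta> osc] by blast
  define A where "A = max A0 0"
  have JN: "(\<integral>\<^sup>+ y\<in>ball x r. ennreal (exp (c * norm (b y - ball_avg b x r))) \<partial>lebesgue) \<le> ennreal A * emeasure lebesgue (ball x r)"
    if "0 < r" for x r
    proof -
    have "ennreal A = ennreal A0"
      by (cases "0 \<le> A0") (auto simp: A_def max_def ennreal_neg)
    then show ?thesis
      using JN0[OF that, of x] by simp
  qed
  \<comment> \<open>Any exponent above all \<open>p j\<close> would do for
    \<open>mnorm_le_Lp\<close>.\<close>
  define P where "P = 1 + (\<Sum>j\<in>UNIV. p j)"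
  have P: "p j < P" for j
    using member_le_sum[of j UNIV p] p by (simp add: P_def less_imp_le add.commute less_add_one le_less_trans)
  have "0 < P"
    using p[of undefined] P[of undefined] by linarith
  define D where "D = (P / c) powr P * exp c"
  define n where "n = real CARD('n)"
  define w where "w = unit_ball_vol n"
  have nonneg: "0 \<le> D" "0 \<le> A" "0 \<le> w"
    by (simp_all add: D_def A_def w_def n_def)
  show thesis
  proof
    show "0 \<le> (D * A * w) powr (1 / P) * 2 powr (inv_sum p - n / P)"
      by simp
    fix x :: "real ^ 'n::{finite,linorder}" and r :: real assume r: "0 < r"
    let ?u = "\<lambda>y. norm (b y - ball_avg b x r)"
    let ?g = "\<lambda>y. ennreal (?u y + 1) * indicator (ball x r) y"
    have "(\<integral>\<^sup>+ y. epowr (?g y) P \<partial>lborel) \<le> (\<integral>\<^sup>+ y. ennreal D * (ennreal (exp (c * ?u y)) * indicator (ball x r) y) \<partial>lebesgue)"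
      unfolding nn_integral_completion
    proof (rule nn_integral_mono)
      fix y
      have "(?u y + 1) powr P \<le> D * exp (c * ?u y)"
        unfolding D_def using \<open>0 < P\<close> c by (intro powr_le_exp) auto
      then show "epowr (?g y) P \<le> ennreal D * (ennreal (exp (c * ?u y)) * indicator (ball x r) y)"
        using nonneg by (cases "y \<in> ball x r")
          (simp_all add: epowr_ennreal ennreal_leI del: ennreal_plus mem_ball flip: ennreal_mult)
    qed
    also have "\<dots> = ennreal D * (\<integral>\<^sup>+ y\<in>ball x r. ennreal (exp (c * ?u y)) \<partial>lebesgue)"
      by (rule nn_integral_cmult) measurable
    also have "\<dots> \<le> ennreal D * (ennreal A * emeasure lebesgue (ball x r))"
      by (intro mult_left_mono JN r) auto
    also have "emeasure lebesgue (ball x r) = ennreal (w * r powr n)"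
      using r by (simp add: emeasure_lebesgue_ball content_ball w_def n_def powr_realpow)
    also have "ennreal D * (ennreal A * ennreal (w * r powr n)) = ennreal (D * A * w * r powr n)"
      using nonneg by (simp add: mult.assoc flip: ennreal_mult)
    finally have I: "epowr (\<integral>\<^sup>+ y. epowr (?g y) P \<partial>lborel) (1 / P) \<le> epowr (ennreal (D * A * w * r powr n)) (1 / P)"
      using \<open>0 < P\<close> by (intro epowr_mono) auto
    have "mnorm p ?g \<le> epowr (\<integral>\<^sup>+ y. epowr (?g y) P \<partial>lborel) (1 / P) * ennreal ((2 * r) powr (inv_sum p - n / P))"
      unfolding n_def using r by (intro mnorm_le_Lp[where x = x] p P) auto
    also have "\<dots> \<le> epowr (ennreal (D * A * w * r powr n)) (1 / P) * ennreal ((2 * r) powr (inv_sum p - n / P))"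
      by (intro mult_right_mono I) auto
    also have "\<dots> = ennreal ((D * A * w * r powr n) powr (1 / P) * (2 * r) powr (inv_sum p - n / P))"
      using nonneg by (simp add: epowr_ennreal flip: ennreal_mult)
    also have "(D * A * w * r powr n) powr (1 / P) = (D * A * w) powr (1 / P) * r powr (n / P)"
      using nonneg by (simp add: powr_mult powr_powr)
    also have "(2 * r) powr (inv_sum p - n / P) = 2 powr (inv_sum p - n / P) * r powr (inv_sum p - n / P)"
      using r by (simp add: powr_mult)
    also have "(D * A * w) powr (1 / P) * r powr (n / P) * (2 powr (inv_sum p - n / P) * r powr (inv_sum p - n / P))
        = (D * A * w) powr (1 / P) * 2 powr (inv_sum p - n / P) * r powr inv_sum p"
      by (simp add: mult_ac flip: powr_add)
    finally show "mnorm p ?g \<le> ennreal ((D * A * w) powr (1 / P) * 2 powr (inv_sum p - n / P) * r powr inv_sum p)" .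
  qed
qed

text \<open>Conjugate exponents satisfy \<open>inv_sum p' = n - inv_sum p\<close>, so the norm of
  the oscillation factor supplies r^n, the order of the volume, and
  \<open>r powr - inv_sum p\<close>, which normalises the norm of u.\<close>

lemma nn_integral_ball_BMO_le:
  fixes b :: "real ^ 'n::{finite,linorder} \<Rightarrow> complex"
  assumes b: "b \<in> BMO" and p: "\<And>j. 1 < p j"
  obtains C where "0 \<le> C" "\<And>x r u. 0 < r \<Longrightarrow> u \<in> borel_measurable lebesgue \<Longrightarrow>
    (\<integral>\<^sup>+ y\<in>ball x r. ennreal (norm (b y - ball_avg b x r) + 1) * u y \<partial>lebesgue)
      \<le> ennreal (C * r ^ CARD('n)) * (ennreal (r powr - inv_sum p) * mnorm p (\<lambda>y. u y * indicator (ball x r) y))"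
proof -
  define p' where "p' = (\<lambda>j. 1 / (1 - 1 / p j))"
  have p': "0 < p' j" for j
    using p[of j] by (simp add: p'_def)
  have sum: "inv_sum p' = real CARD('n) - inv_sum p"
    by (simp add: inv_sum_def p'_def sum_subtractf)
  have b_meas [measurable]: "b \<in> borel_measurable lebesgue"
    using b by (simp add: BMO_def locally_integrable_measurable)
  obtain C where C: "0 \<le> C" "\<And>x r. 0 < r \<Longrightarrow>
    mnorm p' (\<lambda>y. ennreal (norm (b y - ball_avg b x r) + 1) * indicator (ball x r) y) \<le> ennreal (C * r powr inv_sum p')"
    using mnorm_BMO[where p = p', OF b p'] by blast
  show thesis
  proof (rule that[OF C(1)])
    fix x :: "real ^ 'n::{finite,linorder}" and r :: real and u :: "real ^ 'n::{finite,linorder} \<Rightarrow> ennreal"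
    assume r: "0 < r" and [measurable]: "u \<in> borel_measurable lebesgue"
    let ?v = "\<lambda>y. ennreal (norm (b y - ball_avg b x r) + 1) * indicator (ball x r) y"
    let ?N = "mnorm p (\<lambda>y. u y * indicator (ball x r) y)"
    have "(\<integral>\<^sup>+ y\<in>ball x r. ennreal (norm (b y - ball_avg b x r) + 1) * u y \<partial>lebesgue)
        = (\<integral>\<^sup>+ y. (u y * indicator (ball x r) y) * ?v y \<partial>lborel)"
      unfolding nn_integral_completion by (intro nn_integral_cong) (auto simp: indicator_def mult.commute)
    also have "\<dots> \<le> ?N * mnorm p' ?v"
      unfolding p'_def by (intro nn_integral_mult_le_mnorm p) measurable
    also have "\<dots> \<le> ?N * ennreal (C * r powr inv_sum p')"
      by (intro mult_left_mono C(2) r) auto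
    also have "C * r powr inv_sum p' = C * r ^ CARD('n) * r powr - inv_sum p"
      using r by (simp add: sum powr_diff powr_minus powr_realpow divide_inverse)
    also have "ennreal (C * r ^ CARD('n) * r powr - inv_sum p) = ennreal (C * r ^ CARD('n)) * ennreal (r powr - inv_sum p)"
      using C(1) r by (intro ennreal_mult) auto
    finally show "(\<integral>\<^sup>+ y\<in>ball x r. ennreal (norm (b y - ball_avg b x r) + 1) * u y \<partial>lebesgue)
        \<le> ennreal (C * r ^ CARD('n)) * (ennreal (r powr - inv_sum p) * ?N)"
      by (simp add: mult_ac)
  qed
qed

section \<open>The dyadic estimate of the size condition\<close>

lemma prod_mono_ennreal:
  fixes f g :: "'a \<Rightarrow> ennreal"
  shows "(\<And>k. k \<in> A \<Longrightarrow> f k \<le> g k) \<Longrightarrow> prod f A \<le> prod g A"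
  by (induction A rule: infinite_finite_induct) (auto intro!: mult_mono)

text \<open>The factors are only Lebesgue measurable. There are countably many of them, so Borel
  versions agree with all of them at almost every y, and Tonelli applies to these.\<close>

lemma nn_integral_lebesgue_vec_suminf:
  fixes f :: "nat \<Rightarrow> 'm::finite \<Rightarrow> 'a::euclidean_space \<Rightarrow> ennreal"
  assumes "\<And>j k. f j k \<in> borel_measurable lebesgue"
  shows "(\<integral>\<^sup>+ (y :: 'a ^ 'm). (\<Sum>j. a j * (\<Prod>k\<in>UNIV. f j k (y $ k))) \<partial>lebesgue)
    = (\<Sum>j. a j * (\<Prod>k\<in>UNIV. (\<integral>\<^sup>+ x. f j k x \<partial>lebesgue)))"
proof -
  have "\<exists>g. g \<in> borel_measurable borel \<and> (AE x in lborel. f j k x = g x)" for j k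
    by (rule lebesgue_borel_version[OF assms[of j k]]) blast
  then have g_ex: "\<forall>j k. \<exists>g. g \<in> borel_measurable borel \<and> (AE x in lborel. f j k x = g x)"
    by blast
  obtain g where "\<forall>j k. g j k \<in> borel_measurable borel \<and> (AE x in lborel. f j k x = g j k x)"
    using g_ex[unfolded choice_iff] by blast
  then have g [measurable]: "\<And>j k. g j k \<in> borel_measurable borel"
    and fg: "\<And>j k. AE x in lborel. f j k x = g j k x"
    by auto
  have "AE y in (lborel :: ('a ^ 'm) measure). \<forall>j. \<forall>k\<in>UNIV. f j k (y $ k) = g j k (y $ k)"
    unfolding AE_all_countable by (intro allI AE_finite_allI AE_vec_nth fg) auto
  then have "(\<integral>\<^sup>+ (y :: 'a ^ 'm). (\<Sum>j. a j * (\<Prod>k\<in>UNIV. f j k (y $ k))) \<partial>lebesgue)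
      = (\<integral>\<^sup>+ (y :: 'a ^ 'm). (\<Sum>j. a j * (\<Prod>k\<in>UNIV. g j k (y $ k))) \<partial>lborel)"
    unfolding nn_integral_completion by (intro nn_integral_cong_AE) (auto elim!: eventually_mono)
  also have "\<dots> = (\<Sum>j. a j * (\<integral>\<^sup>+ (y :: 'a ^ 'm). (\<Prod>k\<in>UNIV. g j k (y $ k)) \<partial>lborel))"
  proof -
    have nth: "(\<lambda>y :: 'a ^ 'm. y $ k) \<in> borel_measurable borel" for k
      by (intro borel_measurable_continuous_onI continuous_intros)
    have [measurable]: "(\<lambda>y :: 'a ^ 'm. \<Prod>k\<in>UNIV. g j k (y $ k)) \<in> borel_measurable borel" for j
      by (intro borel_measurable_prod_ennreal measurable_compose[OF nth g])
    show ?thesis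
      by (simp add: nn_integral_suminf nn_integral_cmult)
  qed
  also have "\<dots> = (\<Sum>j. a j * (\<Prod>k\<in>UNIV. (\<integral>\<^sup>+ x. f j k x \<partial>lebesgue)))"
  proof -
    have "(\<integral>\<^sup>+ x. g j k x \<partial>lborel) = (\<integral>\<^sup>+ x. f j k x \<partial>lebesgue)" for j k
      unfolding nn_integral_completion using fg[of j k] by (intro nn_integral_cong_AE) (auto elim: eventually_mono)
    then show ?thesis
      by (simp add: nn_integral_lborel_vec_prod)
  qed
  finally show ?thesis .
qed

text \<open>Up to constants, the norm of u on the ball divided by the norm of the ball's indicator;
  the power of s stands in for the latter.\<close>

definition ball_coeff :: "('n \<Rightarrow> real) \<Rightarrow> (real ^ 'n::{finite,linorder} \<Rightarrow> ennreal) \<Rightarrow> real ^ 'n::{finite,linorder} \<Rightarrow> real \<Rightarrow> ennreal" where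
  "ball_coeff p u x s = ennreal (s powr - inv_sum p) * mnorm p (\<lambda>y. u y * indicator (ball x s) y)"

text \<open>The factor 1 + j is due to one component only, the one whose variable occurs in b; the
  others contribute just their averaged norms.\<close>

definition dyadic_term :: "('m::finite \<Rightarrow> 'n \<Rightarrow> real) \<Rightarrow> ('m \<Rightarrow> real ^ 'n::{finite,linorder} \<Rightarrow> ennreal) \<Rightarrow>
    real ^ 'n::{finite,linorder} \<Rightarrow> real \<Rightarrow> nat \<Rightarrow> ennreal" where
  "dyadic_term p u x r j = ennreal (1 + real j) * (\<Prod>k\<in>UNIV. ball_coeff (p k) (u k) x (2 ^ j * r))"

text \<open>
  The point \<open>y\<close> is assigned to the first dyadic ball around \<open>x\<close> that contains all its components;
  the component outside the previous ball bounds the kernel.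
\<close>

lemma kernel_le_dyadic_sum:
  fixes x x' :: "real ^ 'n" and y :: "real ^ 'n ^ 'm" and u :: "'m \<Rightarrow> real ^ 'n \<Rightarrow> ennreal"
  assumes r: "0 < r" and x': "x' \<in> ball x r" and J: "1 \<le> J"
    and u0: "\<And>z. z \<in> ball x (2 ^ J * r) \<Longrightarrow> u k\<^sub>0 z = 0" and "0 \<le> w"
  shows "ennreal (w / norm (\<chi> k. x' - y $ k) ^ N) * (\<Prod>k\<in>UNIV. u k (y $ k))
    \<le> (\<Sum>j. ennreal (1 / (2 ^ (j + J) * r / 4) ^ N)
        * (ennreal w * (\<Prod>k\<in>UNIV. u k (y $ k) * indicator (ball x (2 ^ (j + J) * r)) (y $ k))))"
    (is "?lhs \<le> (\<Sum>j. ?f j)")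
proof (cases "(\<Prod>k\<in>UNIV. u k (y $ k)) = 0")
  case False
  define Q where "Q j \<longleftrightarrow> (\<forall>k. dist x (y $ k) < 2 ^ (j + J) * r)" for j
  have "u k\<^sub>0 (y $ k\<^sub>0) \<noteq> 0"
    using False by auto
  \<comment> \<open>If all components lay in the first ball, the distinguished factor would vanish.
    So the first ball containing all of them has a predecessor.\<close>
  then have "\<not> Q 0"
    using u0[of "y $ k\<^sub>0"] by (auto simp: Q_def)
  moreover have "\<exists>j. Q j"
  proof -
    define S where "S = (\<Sum>k\<in>UNIV. dist x (y $ k))"
    obtain j where j: "S / r < 2 ^ j"
      using real_arch_pow[of 2 "S / r"] by auto
    have "(2 :: real) ^ j \<le> 2 ^ (j + J)"
      by (intro power_increasing) auto
    then have "S / r < 2 ^ (j + J)"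
      using j by (rule less_le_trans[rotated])
    then have "S < 2 ^ (j + J) * r"
      using r by (simp add: field_simps)
    moreover have "dist x (y $ k) \<le> S" for k
      unfolding S_def by (rule member_le_sum) auto
    ultimately show ?thesis
      unfolding Q_def by (meson le_less_trans)
  qed
  ultimately obtain j where j: "\<not> Q j" "Q (Suc j)"
    using ex_least_nat_less[of Q] by blast
  then obtain k where k: "2 ^ (j + J) * r \<le> dist x (y $ k)"
    by (auto simp: Q_def not_less)
  \<comment> \<open>Since J \<ge> 1, the ball that misses a component has radius at least 2 * r.
    Moving from x to x' costs less than r, at most half of that radius, which is a quarter of the
    radius of the next ball.\<close>
  have pow: "(2 :: real) ^ 1 \<le> 2 ^ (j + J)"
    using J by (intro power_increasing) auto
  have "2 ^ (Suc j + J) * r / 4 \<le> 2 ^ (j + J) * r - r"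
    using mult_right_mono[OF pow, of r] r by simp
  also have "\<dots> \<le> dist x (y $ k) - dist x x'"
    using k x' by simp
  also have "\<dots> \<le> norm (x' - y $ k)"
    using dist_triangle[of x "y $ k" x'] by (simp add: dist_norm)
  also have "\<dots> \<le> norm (\<chi> k. x' - y $ k)"
    using Finite_Cartesian_Product.norm_nth_le[of "\<chi> k. x' - y $ k" k] by simp
  finally have le: "2 ^ (Suc j + J) * r / 4 \<le> norm (\<chi> k. x' - y $ k)" .
  moreover have "0 < 2 ^ (Suc j + J) * r / 4"
    using r by simp
  ultimately have pos: "0 < norm (\<chi> k. x' - y $ k)"
    by linarith
  have ind: "u k (y $ k) * indicator (ball x (2 ^ (Suc j + J) * r)) (y $ k) = u k (y $ k)" for k
    using j(2) by (simp add: Q_def)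
  have "?lhs \<le> ennreal (1 / (2 ^ (Suc j + J) * r / 4) ^ N * w) * (\<Prod>k\<in>UNIV. u k (y $ k))"
  proof (intro mult_right_mono ennreal_leI)
    have "w / norm (\<chi> k. x' - y $ k) ^ N \<le> w / (2 ^ (Suc j + J) * r / 4) ^ N"
      using le pos \<open>0 < 2 ^ (Suc j + J) * r / 4\<close> \<open>0 \<le> w\<close> by (intro divide_left_mono power_mono mult_pos_pos zero_less_power) auto
    then show "w / norm (\<chi> k. x' - y $ k) ^ N \<le> 1 / (2 ^ (Suc j + J) * r / 4) ^ N * w"
      by simp
  qed simp
  also have "\<dots> = ?f (Suc j)"
    unfolding ind using r \<open>0 \<le> w\<close> by (subst ennreal_mult) (auto simp: mult.assoc)
  also have "\<dots> \<le> (\<Sum>j. ?f j)"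
    using sum_le_suminf[of ?f "{Suc j}"] by simp
  finally show ?thesis .
next
  case True
  then have "?lhs = 0"
    by (simp only: mult_zero_right)
  then show ?thesis
    by (simp only: zero_le)
qed

text \<open>The right-hand side depends on x' only through the oscillation factor; the series
  belongs to the centre x. On a ball the estimate is therefore a constant times a function whose
  mixed norm \<open>mnorm_BMO\<close> controls.\<close>

lemma kernel_integral_le:
  fixes b :: "real ^ 'n::{finite,linorder} \<Rightarrow> complex" and p :: "'m::finite \<Rightarrow> 'n \<Rightarrow> real" and i :: 'm
  assumes b: "b \<in> BMO" and p: "\<And>k j. 1 < p k j"
  obtains C where "0 \<le> C" "\<And>x r x' u k\<^sub>0 J. 0 < r \<Longrightarrow> x' \<in> ball x r \<Longrightarrow>
    (\<And>k. u k \<in> borel_measurable lebesgue) \<Longrightarrow> 1 \<le> J \<Longrightarrow> (\<And>z. z \<in> ball x (2 ^ J * r) \<Longrightarrow> u k\<^sub>0 z = 0) \<Longrightarrow>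
    (\<integral>\<^sup>+ y. ennreal (norm (b x' - b (y $ i)) / norm (\<chi> k. x' - y $ k) ^ (CARD('m) * CARD('n)))
        * (\<Prod>k\<in>UNIV. u k (y $ k)) \<partial>lebesgue)
      \<le> ennreal (C * (norm (b x' - ball_avg b x r) + 1)) * (\<Sum>j. dyadic_term p u x r (j + J))"
proof -
  have b_meas [measurable]: "b \<in> borel_measurable lebesgue"
    using b by (simp add: BMO_def locally_integrable_measurable)
  obtain \<kappa> where \<kappa>: "1 \<le> \<kappa>" and chain: "\<And>x r j y. 0 < r \<Longrightarrow>
      norm (b y - ball_avg b x r) + 1 \<le> \<kappa> * (1 + real j) * (norm (b y - ball_avg b x (2 ^ j * r)) + 1)"
    using BMO_dyadic_avg[OF b] by blast
  let ?B = "\<lambda>k C. 0 \<le> C \<and> (\<forall>x r u. 0 < r \<longrightarrow> u \<in> borel_measurable lebesgue \<longrightarrow>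
    (\<integral>\<^sup>+ y\<in>ball x r. ennreal (norm (b y - ball_avg b x r) + 1) * u y \<partial>lebesgue)
      \<le> ennreal (C * r ^ CARD('n)) * ball_coeff (p k) u x r)"
  have "\<exists>C. ?B k C" for k
    unfolding ball_coeff_def by (rule nn_integral_ball_BMO_le[where p = "p k", OF b p]) blast
  then have "\<forall>k. \<exists>C. ?B k C"
    by (rule allI)
  then have "\<exists>C. \<forall>k. ?B k (C k)"
    by (rule choice)
  then obtain C where "\<forall>k. ?B k (C k)"
    by (rule exE)
  then have C: "\<And>k. 0 \<le> C k" and holder: "\<And>k x r u. 0 < r \<Longrightarrow> u \<in> borel_measurable lebesgue \<Longrightarrow>
    (\<integral>\<^sup>+ y\<in>ball x r. ennreal (norm (b y - ball_avg b x r) + 1) * u y \<partial>lebesgue)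
      \<le> ennreal (C k * r ^ CARD('n)) * ball_coeff (p k) u x r"
    by (blast+)
  define N where "N = CARD('m) * CARD('n)"
  show thesis
  proof
    show "0 \<le> 4 ^ N * (\<Prod>k\<in>UNIV. C k) * \<kappa>"
      using C \<kappa> by (auto intro!: mult_nonneg_nonneg prod_nonneg)
    fix x x' :: "real ^ 'n::{finite,linorder}" and r :: real and u :: "'m \<Rightarrow> real ^ 'n::{finite,linorder} \<Rightarrow> ennreal" and k\<^sub>0 J
    assume r: "0 < r" and x': "x' \<in> ball x r" and u [measurable]: "\<And>k. u k \<in> borel_measurable lebesgue"
      and J: "1 \<le> J" and u0: "\<And>z. z \<in> ball x (2 ^ J * r) \<Longrightarrow> u k\<^sub>0 z = 0"
    define E where "E = norm (b x' - ball_avg b x r) + 1"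
    have "1 \<le> E"
      by (simp add: E_def)
    \<comment> \<open>The oscillation is assigned to the i-th factor, so that the integrand over all
      variables becomes a product of functions of one component each.\<close>
    define H where "H j k z = (if k = i then ennreal (norm (b x' - b z)) else 1)
      * (u k z * indicator (ball x (2 ^ (j + J) * r)) z)" for j k z
    have H_meas: "H j k \<in> borel_measurable lebesgue" for j k
      unfolding H_def by measurable
    have H_prod: "(\<Prod>k\<in>UNIV. H j k (y $ k)) = ennreal (norm (b x' - b (y $ i)))
        * (\<Prod>k\<in>UNIV. u k (y $ k) * indicator (ball x (2 ^ (j + J) * r)) (y $ k))" for j y
    proof -
      have "(\<Prod>k\<in>UNIV. if k = i then ennreal (norm (b x' - b (y $ k))) else 1) = ennreal (norm (b x' - b (y $ i)))"
        by simp
      then show ?thesis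
        unfolding H_def by (simp only: prod.distrib)
    qed
    have H_int: "(\<integral>\<^sup>+ z. H j k z \<partial>lebesgue) \<le> (if k = i then ennreal (E * \<kappa> * (1 + real (j + J))) else 1)
        * (ennreal (C k * (2 ^ (j + J) * r) ^ CARD('n)) * ball_coeff (p k) (u k) x (2 ^ (j + J) * r))" for j k
    proof -
      define s where "s = 2 ^ (j + J) * r"
      have s: "0 < s"
        using r by (simp add: s_def)
      define c where "c = (if k = i then ennreal (E * \<kappa> * (1 + real (j + J))) else 1)"
      let ?v = "\<lambda>z. norm (b z - ball_avg b x s) + 1"
      have "(\<integral>\<^sup>+ z. H j k z \<partial>lebesgue) \<le> (\<integral>\<^sup>+ z. c * (ennreal (?v z) * u k z * indicator (ball x s) z) \<partial>lebesgue)"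
      proof (rule nn_integral_mono)
        fix z
        have "(if k = i then ennreal (norm (b x' - b z)) else 1) \<le> c * ennreal (?v z)"
        proof (cases "k = i")
          case True
          \<comment> \<open>With u and v the distances of b(x') and b(z) from the average, u + v
            \<le> (u + 1) * (v + 1). This separates x' from z, and E can leave the integral.\<close>
          have "norm (b x' - b z) \<le> norm (b x' - ball_avg b x r) + norm (b z - ball_avg b x r)"
            using norm_triangle_ineq4[of "b x' - ball_avg b x r" "b z - ball_avg b x r"] by simp
          also have "\<dots> \<le> E * (norm (b z - ball_avg b x r) + 1)"
            by (simp add: E_def algebra_simps)
          also have "\<dots> \<le> E * (\<kappa> * (1 + real (j + J)) * ?v z)"
            unfolding s_def using \<open>1 \<le> E\<close> by (intro mult_left_mono chain r) auto
          finally have "norm (b x' - b z) \<le> E * \<kappa> * (1 + real (j + J)) * ?v z"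
            by (simp only: mult.assoc)
          then have "ennreal (norm (b x' - b z)) \<le> ennreal (E * \<kappa> * (1 + real (j + J)) * ?v z)"
            by (rule ennreal_leI)
          also have "\<dots> = ennreal (E * \<kappa> * (1 + real (j + J))) * ennreal (?v z)"
            using \<open>1 \<le> E\<close> \<kappa> by (intro ennreal_mult) auto
          also have "\<dots> = c * ennreal (?v z)"
            using True by (simp only: c_def refl if_True)
          finally show ?thesis
            using True by simp
        next
          case False
          have "ennreal 1 \<le> ennreal (?v z)"
            by (intro ennreal_leI) auto
          then show ?thesis
            using False by (simp add: c_def)
        qed
        then show "H j k z \<le> c * (ennreal (?v z) * u k z * indicator (ball x s) z)"
          unfolding H_def s_def[symmetric] mult.assoc[symmetric]
          by (intro mult_right_mono) auto
      qed
      also have "\<dots> = c * (\<integral>\<^sup>+ z\<in>ball x s. ennreal (?v z) * u k z \<partial>lebesgue)"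
        by (rule nn_integral_cmult) measurable
      also have "\<dots> \<le> c * (ennreal (C k * s ^ CARD('n)) * ball_coeff (p k) (u k) x s)"
        by (intro mult_left_mono holder s u) auto
      finally show ?thesis
        by (simp only: c_def s_def)
    qed
    have term_le: "ennreal (1 / (2 ^ (j + J) * r / 4) ^ N) * (\<Prod>k\<in>UNIV. (\<integral>\<^sup>+ z. H j k z \<partial>lebesgue))
        \<le> ennreal (4 ^ N * (\<Prod>k\<in>UNIV. C k) * \<kappa> * E) * dyadic_term p u x r (j + J)" for j
    proof -
      define s where "s = 2 ^ (j + J) * r"
      have s: "0 < s"
        using r by (simp add: s_def)
      let ?P = "\<Prod>k\<in>UNIV. ball_coeff (p k) (u k) x s"
      have "(\<Prod>k\<in>UNIV. (\<integral>\<^sup>+ z. H j k z \<partial>lebesgue))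
          \<le> (\<Prod>k\<in>UNIV. (if k = i then ennreal (E * \<kappa> * (1 + real (j + J))) else 1)
            * (ennreal (C k * s ^ CARD('n)) * ball_coeff (p k) (u k) x s))"
        unfolding s_def by (rule prod_mono_ennreal) (rule H_int)
      also have "\<dots> = ennreal (E * \<kappa> * (1 + real (j + J))) * (ennreal ((\<Prod>k\<in>UNIV. C k) * s ^ N) * ?P)"
      proof -
        have "(\<Prod>k\<in>UNIV. ennreal (C k * s ^ CARD('n))) = ennreal ((\<Prod>k\<in>UNIV. C k) * s ^ N)"
          using C s by (subst prod_ennreal) (auto simp: prod.distrib N_def power_mult mult.commute[of "CARD('m)"])
        then show ?thesis
          by (simp add: prod.distrib)
      qed
      finally have "ennreal (1 / (s / 4) ^ N) * (\<Prod>k\<in>UNIV. (\<integral>\<^sup>+ z. H j k z \<partial>lebesgue))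
          \<le> ennreal (1 / (s / 4) ^ N) * (ennreal (E * \<kappa> * (1 + real (j + J))) * (ennreal ((\<Prod>k\<in>UNIV. C k) * s ^ N) * ?P))"
        by (intro mult_left_mono) auto
      also have "\<dots> = ennreal (1 / (s / 4) ^ N * ((\<Prod>k\<in>UNIV. C k) * s ^ N) * (E * \<kappa> * (1 + real (j + J)))) * ?P"
      proof -
        have nonneg: "0 \<le> 1 / (s / 4) ^ N" "0 \<le> (\<Prod>k\<in>UNIV. C k) * s ^ N" "0 \<le> E * \<kappa> * (1 + real (j + J))"
          using s C \<open>1 \<le> E\<close> \<kappa> by (auto intro!: mult_nonneg_nonneg prod_nonneg)
        show ?thesis
          unfolding ennreal_mult[OF mult_nonneg_nonneg[OF nonneg(1,2)] nonneg(3)] ennreal_mult[OF nonneg(1,2)]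
          by (simp only: mult_ac)
      qed
      \<comment> \<open>The kernel contributes s^(-N) with N = m * n, and the m integrals contribute
        s^n each: the powers of s cancel, which leaves the 4^N.\<close>
      also have "1 / (s / 4) ^ N * ((\<Prod>k\<in>UNIV. C k) * s ^ N) * (E * \<kappa> * (1 + real (j + J)))
          = 4 ^ N * (\<Prod>k\<in>UNIV. C k) * \<kappa> * E * (1 + real (j + J))"
        using s by (simp add: power_divide field_simps)
      also have "ennreal \<dots> * ?P = ennreal (4 ^ N * (\<Prod>k\<in>UNIV. C k) * \<kappa> * E) * dyadic_term p u x r (j + J)"
        unfolding dyadic_term_def s_def using C \<open>1 \<le> E\<close> \<kappa>
        by (subst ennreal_mult) (auto simp: mult.assoc intro!: mult_nonneg_nonneg prod_nonneg)
      finally show ?thesis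
        by (simp only: s_def)
    qed
    have "(\<integral>\<^sup>+ y. ennreal (norm (b x' - b (y $ i)) / norm (\<chi> k. x' - y $ k) ^ N)
        * (\<Prod>k\<in>UNIV. u k (y $ k)) \<partial>lebesgue)
      \<le> (\<integral>\<^sup>+ y. (\<Sum>j. ennreal (1 / (2 ^ (j + J) * r / 4) ^ N) * (\<Prod>k\<in>UNIV. H j k (y $ k))) \<partial>lebesgue)"
      unfolding H_prod using r x' J u0 by (intro nn_integral_mono kernel_le_dyadic_sum) auto
    also have "\<dots> = (\<Sum>j. ennreal (1 / (2 ^ (j + J) * r / 4) ^ N) * (\<Prod>k\<in>UNIV. (\<integral>\<^sup>+ z. H j k z \<partial>lebesgue)))"
      by (rule nn_integral_lebesgue_vec_suminf[OF H_meas])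
    also have "\<dots> \<le> (\<Sum>j. ennreal (4 ^ N * (\<Prod>k\<in>UNIV. C k) * \<kappa> * E) * dyadic_term p u x r (j + J))"
      by (intro suminf_le term_le) auto
    also have "\<dots> = ennreal (4 ^ N * (\<Prod>k\<in>UNIV. C k) * \<kappa> * E) * (\<Sum>j. dyadic_term p u x r (j + J))"
      by simp
    finally show "(\<integral>\<^sup>+ y. ennreal (norm (b x' - b (y $ i)) / norm (\<chi> k. x' - y $ k) ^ (CARD('m) * CARD('n)))
        * (\<Prod>k\<in>UNIV. u k (y $ k)) \<partial>lebesgue)
      \<le> ennreal (4 ^ N * (\<Prod>k\<in>UNIV. C k) * \<kappa> * (norm (b x' - ball_avg b x r) + 1)) * (\<Sum>j. dyadic_term p u x r (j + J))"
      by (simp only: N_def E_def)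
  qed
qed

text \<open>
  The slices of a weight need not be measurable, so \<open>\<Psi>\<close>, whose integral is a lower integral, is
  compared with a measurable step function and not split over the dyadic intervals.
\<close>

lemma suminf_le_dyadic_integral:
  fixes c :: "nat \<Rightarrow> ennreal" and \<Psi> :: "real \<Rightarrow> ennreal"
  assumes r: "0 < r" and K: "K < \<infinity>"
    and le: "\<And>j t. 2 ^ j * r < t \<Longrightarrow> t < 2 * (2 ^ j * r) \<Longrightarrow> c j * ennreal (1 / t) \<le> K * \<Psi> t"
  shows "(\<Sum>j. c j) \<le> 2 * K * (\<integral>\<^sup>+ t\<in>{r<..}. \<Psi> t \<partial>lebesgue)"
proof (cases "K = 0")
  case True
  \<comment> \<open>The general argument divides by K. For K = 0 the hypothesis at the midpoint of
    the interval already forces every coefficient to vanish.\<close>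
  have "c j = 0" for j
  proof -
    have "0 < 2 ^ j * r"
      using r by simp
    then have "c j * ennreal (1 / (3 / 2 * (2 ^ j * r))) = 0"
      using le[of j "3 / 2 * (2 ^ j * r)"] True r by simp
    moreover have "0 < 1 / (3 / 2 * (2 ^ j * r))"
      using r by simp
    ultimately show ?thesis
      using r by auto
  qed
  then show ?thesis
    by simp
next
  case False
  \<comment> \<open>On \<open>I j\<close> the value 1 / t is at least half of 1 / (2^j * r), and the
    interval has length 2^j * r. Each step of the comparison function thus integrates to half of c j
    / K, the origin of the factor 2.\<close>
  define I where "I j = {2 ^ j * r<..<2 * (2 ^ j * r)}" for j
  have inv: "K * inverse K = 1"
    using False K by (simp add: ennreal_divide_self flip: divide_ennreal_def)
  have disj: "j = k" if "t \<in> I j" "t \<in> I k" for j k t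
  proof (rule ccontr)
    have *: False if "j < k" "t \<in> I j" "t \<in> I k" for j k
    proof -
      have "(2 :: real) ^ Suc j \<le> 2 ^ k"
        using that by (intro power_increasing) auto
      then have "2 ^ Suc j * r \<le> 2 ^ k * r"
        using r by (intro mult_right_mono) auto
      then show False
        using that by (auto simp: I_def)
    qed
    assume "j \<noteq> k"
    then show False
      using * that by (metis linorder_neqE_nat)
  qed
  have pointwise: "(\<Sum>j. inverse K * c j * ennreal (1 / (2 * (2 ^ j * r))) * indicator (I j) t) \<le> \<Psi> t * indicator {r<..} t" for t
  proof (cases "\<exists>j. t \<in> I j")
    case True
    then obtain j where j: "t \<in> I j"
      by blast
    have t: "2 ^ j * r < t" "t < 2 * (2 ^ j * r)" "r < t" "0 < t"
    proof -
      show "2 ^ j * r < t" "t < 2 * (2 ^ j * r)"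
        using j by (auto simp: I_def)
      moreover have "1 * r \<le> 2 ^ j * r"
        using r by (intro mult_right_mono) auto
      ultimately show "r < t" "0 < t"
        using r by linarith+
    qed
    have "(\<Sum>k. inverse K * c k * ennreal (1 / (2 * (2 ^ k * r))) * indicator (I k) t)
        = (\<Sum>k\<in>{j}. inverse K * c k * ennreal (1 / (2 * (2 ^ k * r))) * indicator (I k) t)"
      using j disj by (intro suminf_finite) (auto simp: indicator_def)
    also have "\<dots> = inverse K * (c j * ennreal (1 / (2 * (2 ^ j * r))))"
      using j by (simp add: mult.assoc)
    also have "\<dots> \<le> inverse K * (c j * ennreal (1 / t))"
      using t r by (intro mult_left_mono ennreal_leI divide_left_mono) auto
    also have "\<dots> \<le> inverse K * (K * \<Psi> t)"
      using t by (intro mult_left_mono le) auto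
    also have "\<dots> = K * inverse K * \<Psi> t"
      by (simp only: mult_ac)
    also have "\<dots> = \<Psi> t * indicator {r<..} t"
      using t by (simp add: inv)
    finally show ?thesis .
  next
    case False
    then have "inverse K * c j * ennreal (1 / (2 * (2 ^ j * r))) * indicator (I j) t = 0" for j
      by (simp add: indicator_def)
    then show ?thesis
      by (simp only: suminf_zero zero_le)
  qed
  have "(\<Sum>j. inverse K * c j * ennreal (1 / 2)) = (\<Sum>j. (\<integral>\<^sup>+ t. inverse K * c j * ennreal (1 / (2 * (2 ^ j * r))) * indicator (I j) t \<partial>lborel))"
  proof (rule suminf_cong)
    fix j
    have "(\<integral>\<^sup>+ t. inverse K * c j * ennreal (1 / (2 * (2 ^ j * r))) * indicator (I j) t \<partial>lborel)
        = inverse K * c j * (ennreal (1 / (2 * (2 ^ j * r))) * ennreal (2 ^ j * r))"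
      using r by (subst nn_integral_cmult_indicator) (auto simp: I_def mult.assoc mult.commute[of r])
    also have "ennreal (1 / (2 * (2 ^ j * r))) * ennreal (2 ^ j * r) = ennreal (1 / 2)"
      using r by (subst ennreal_mult[symmetric]) auto
    finally show "inverse K * c j * ennreal (1 / 2)
        = (\<integral>\<^sup>+ t. inverse K * c j * ennreal (1 / (2 * (2 ^ j * r))) * indicator (I j) t \<partial>lborel)" ..
  qed
  also have "\<dots> = (\<integral>\<^sup>+ t. (\<Sum>j. inverse K * c j * ennreal (1 / (2 * (2 ^ j * r))) * indicator (I j) t) \<partial>lborel)"
    by (rule nn_integral_suminf[symmetric]) (simp add: I_def)
  also have "\<dots> \<le> (\<integral>\<^sup>+ t\<in>{r<..}. \<Psi> t \<partial>lebesgue)"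
    unfolding nn_integral_completion by (intro nn_integral_mono pointwise)
  finally have "2 * K * (\<Sum>j. inverse K * c j * ennreal (1 / 2)) \<le> 2 * K * (\<integral>\<^sup>+ t\<in>{r<..}. \<Psi> t \<partial>lebesgue)"
    by (rule mult_left_mono) simp
  also have "2 * K * (\<Sum>j. inverse K * c j * ennreal (1 / 2)) = (\<Sum>j. c j)"
  proof -
    have "2 * K * (inverse K * c j * ennreal (1 / 2)) = c j" for j
    proof -
      have "2 * K * (inverse K * c j * ennreal (1 / 2)) = K * inverse K * (ennreal 2 * ennreal (1 / 2)) * c j"
        by (simp only: mult_ac ennreal_numeral)
      also have "ennreal 2 * ennreal (1 / 2) = 1"
        by (subst ennreal_mult[symmetric]) auto
      finally show ?thesis
        by (simp add: inv)
    qed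
    then show ?thesis
      by (simp only: ennreal_suminf_cmult[symmetric])
  qed
  finally show ?thesis .
qed

text \<open>Each term \<open>e k j\<close> is at most its own series. This crude bound turns the
  series of products into the product of separate integrals that the condition on the weights
  contains.\<close>

lemma suminf_mult_prod_le:
  fixes a :: "nat \<Rightarrow> ennreal" and e :: "'m \<Rightarrow> nat \<Rightarrow> ennreal"
  shows "(\<Sum>j. a j * (\<Prod>k\<in>A. e k j)) \<le> (\<Sum>j. a j) * (\<Prod>k\<in>A. (\<Sum>j. e k j))"
proof -
  have "e k j \<le> (\<Sum>j. e k j)" for k j
    using sum_le_suminf[of "e k" "{j}"] by simp
  then have "(\<Sum>j. a j * (\<Prod>k\<in>A. e k j)) \<le> (\<Sum>j. a j * (\<Prod>k\<in>A. (\<Sum>j. e k j)))"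
    by (intro suminf_le mult_left_mono prod_mono_ennreal) auto
  then show ?thesis
    by simp
qed

section \<open>From Morrey norms to the condition on the weights\<close>

lemma norm_indicator_mult:
  "(\<lambda>y. ennreal (norm (f y * indicator A y :: complex))) = (\<lambda>y. ennreal (norm (f y)) * indicator A y)"
  by (auto simp: fun_eq_iff indicator_def)

lemma mixed_norm_indicator: "mixed_norm p (indicator A) = mnorm p (indicator A)"
  unfolding mixed_norm_eq by (intro arg_cong[where f = "mnorm p"]) (auto simp: fun_eq_iff indicator_def)

text \<open>Undoing the normalisation in the Morrey norm. The lower and upper bounds for the norm of
  the ball show that it is neither 0 nor \<infinity>, so its inverse cancels.\<close>

lemma mnorm_ball_le_morrey:
  fixes p :: "'n::{finite,linorder} \<Rightarrow> real"
  assumes p: "\<And>j. 0 < p j" and t: "0 < t" and \<phi>: "0 < \<phi> x t"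
  shows "mnorm p (\<lambda>y. ennreal (norm (f y)) * indicator (ball x t) y)
    \<le> morrey_norm p \<phi> f * ennreal (\<phi> x t * (2 * t) powr inv_sum p)"
proof -
  let ?N = "mnorm p (indicator (ball x t))"
  let ?u = "mnorm p (\<lambda>y. ennreal (norm (f y)) * indicator (ball x t) y)"
  have "0 < (2 * t / real CARD('n)) powr inv_sum p"
    using t by simp
  then have "0 < ennreal ((2 * t / real CARD('n)) powr inv_sum p)"
    by (rule ennreal_less_zero_iff[THEN iffD2])
  also have "\<dots> \<le> ?N"
    by (rule mnorm_ball_ge[OF p t])
  finally have "?N \<noteq> 0"
    by simp
  moreover have N_le: "?N \<le> ennreal ((2 * t) powr inv_sum p)"
    by (rule mnorm_ball_le[OF p t])
  then have "?N < top"
    by (rule le_less_trans) simp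
  ultimately have invN: "?N * inverse ?N = 1"
    by (simp add: ennreal_divide_self flip: divide_ennreal_def)
  have inv\<phi>: "ennreal (\<phi> x t) * inverse (ennreal (\<phi> x t)) = 1"
    using \<phi> by (simp add: ennreal_divide_self flip: divide_ennreal_def)
  have "?u = (ennreal (\<phi> x t) * inverse (ennreal (\<phi> x t))) * (?N * inverse ?N) * ?u"
    by (simp only: invN inv\<phi> mult_1_left)
  also have "\<dots> = inverse (ennreal (\<phi> x t)) * inverse ?N * ?u * (ennreal (\<phi> x t) * ?N)"
    by (simp only: mult_ac)
  also have "\<dots> \<le> morrey_norm p \<phi> f * (ennreal (\<phi> x t) * ennreal ((2 * t) powr inv_sum p))"
  proof (intro mult_mono N_le)
    have "mixed_norm p (\<lambda>y. f y * indicator (ball x t) y) = ?u"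
      by (simp only: mixed_norm_eq norm_indicator_mult)
    then show "inverse (ennreal (\<phi> x t)) * inverse ?N * ?u \<le> morrey_norm p \<phi> f"
      unfolding morrey_norm_def
      by - (rule SUP_upper2[of "(x, t)"], use t in \<open>simp_all add: mixed_norm_indicator\<close>)
  qed auto
  also have "ennreal (\<phi> x t) * ennreal ((2 * t) powr inv_sum p) = ennreal (\<phi> x t * (2 * t) powr inv_sum p)"
    using \<phi> by (intro ennreal_mult[symmetric]) auto
  finally show ?thesis .
qed

text \<open>No monotonicity of \<phi> in the radius is assumed, so the coefficient at s is compared
  with the weight at every t between s and 2 * s; this is the form in which it can be integrated.
  From 2 * t < 4 * s comes the constant.\<close>

lemma ball_coeff_le_morrey:
  fixes p :: "'n::{finite,linorder} \<Rightarrow> real"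
  assumes p: "\<And>j. 0 < p j" and s: "0 < s" "s < t" "t < 2 * s" and \<phi>: "0 < \<phi> x t"
  shows "ball_coeff p (\<lambda>y. ennreal (norm (f y))) x s
    \<le> ennreal (4 powr inv_sum p) * morrey_norm p \<phi> f * ennreal (\<phi> x t)"
proof -
  have "0 \<le> inv_sum p"
    unfolding inv_sum_def using p by (intro sum_nonneg) (simp add: less_imp_le)
  have "s powr - inv_sum p * (\<phi> x t * (2 * t) powr inv_sum p) \<le> s powr - inv_sum p * (\<phi> x t * (4 * s) powr inv_sum p)"
    using s \<phi> \<open>0 \<le> inv_sum p\<close> by (intro mult_left_mono powr_mono2) auto
  also have "\<dots> = 4 powr inv_sum p * \<phi> x t"
    using s by (simp add: powr_mult powr_minus field_simps)
  finally have real_le: "s powr - inv_sum p * (\<phi> x t * (2 * t) powr inv_sum p) \<le> 4 powr inv_sum p * \<phi> x t" .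
  have "ball_coeff p (\<lambda>y. ennreal (norm (f y))) x s
      \<le> ennreal (s powr - inv_sum p) * mnorm p (\<lambda>y. ennreal (norm (f y)) * indicator (ball x t) y)"
    unfolding ball_coeff_def using s by (intro mult_left_mono mnorm_mono p) (auto simp: indicator_def)
  also have "\<dots> \<le> ennreal (s powr - inv_sum p) * (morrey_norm p \<phi> f * ennreal (\<phi> x t * (2 * t) powr inv_sum p))"
    using s by (intro mult_left_mono mnorm_ball_le_morrey p \<phi>) auto
  also have "\<dots> = morrey_norm p \<phi> f * (ennreal (s powr - inv_sum p) * ennreal (\<phi> x t * (2 * t) powr inv_sum p))"
    by (simp only: mult_ac)
  also have "ennreal (s powr - inv_sum p) * ennreal (\<phi> x t * (2 * t) powr inv_sum p)
      = ennreal (s powr - inv_sum p * (\<phi> x t * (2 * t) powr inv_sum p))"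
    using \<phi> by (intro ennreal_mult[symmetric]) auto
  also have "morrey_norm p \<phi> f * \<dots> \<le> morrey_norm p \<phi> f * ennreal (4 powr inv_sum p * \<phi> x t)"
    by (intro mult_left_mono ennreal_leI real_le) auto
  also have "ennreal (4 powr inv_sum p * \<phi> x t) = ennreal (4 powr inv_sum p) * ennreal (\<phi> x t)"
    using \<phi> by (intro ennreal_mult) auto
  finally show ?thesis
    by (simp only: mult_ac)
qed

lemma suminf_dyadic_term_le:
  fixes p :: "'m::finite \<Rightarrow> 'n::{finite,linorder} \<Rightarrow> real" and i :: 'm
  assumes p: "\<And>k j. 0 < p k j" and \<phi>: "\<And>k. morrey_weight (\<phi>s k)" and r: "0 < r"
    and f: "\<And>k. morrey_norm (p k) (\<phi>s k) (f k) < \<infinity>"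
  shows "(\<Sum>j. dyadic_term p (\<lambda>k y. ennreal (norm (f k y))) x r j)
    \<le> ennreal (2 * (\<Prod>k\<in>UNIV. 2 * 4 powr inv_sum (p k))) * (\<Prod>k\<in>UNIV. morrey_norm (p k) (\<phi>s k) (f k))
      * ((\<integral>\<^sup>+ t\<in>{r<..}. ennreal ((1 + ln (t / r)) * (\<phi>s i x t / t)) \<partial>lebesgue)
        * (\<Prod>k\<in>UNIV - {i}. \<integral>\<^sup>+ t\<in>{r<..}. ennreal (\<phi>s k x t / t) \<partial>lebesgue))"
proof -
  define u where "u k y = ennreal (norm (f k y))" for k y
  define e where "e k j = ball_coeff (p k) (u k) x (2 ^ j * r)" for k j
  define D where "D k = ennreal (4 powr inv_sum (p k)) * morrey_norm (p k) (\<phi>s k) (f k)" for k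
  have D: "D k < \<infinity>" for k
    using f[of k] by (simp add: D_def ennreal_mult_less_top)
  have \<phi>_pos: "0 < \<phi>s k x t" if "0 < t" for k t
    using \<phi>[of k] that by (auto simp: morrey_weight_def)
  have e_le: "e k j \<le> D k * ennreal (\<phi>s k x t)" and t_pos: "0 < t"
    if "2 ^ j * r < t" "t < 2 * (2 ^ j * r)" for k j t
  proof -
    have s: "0 < 2 ^ j * r"
      using r by simp
    with that show "0 < t"
      by linarith
    then show "e k j \<le> D k * ennreal (\<phi>s k x t)"
      unfolding e_def D_def u_def using that s by (intro ball_coeff_le_morrey p \<phi>_pos)
  qed
  have sum_e: "(\<Sum>j. e k j) \<le> 2 * D k * (\<integral>\<^sup>+ t\<in>{r<..}. ennreal (\<phi>s k x t / t) \<partial>lebesgue)" for k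
  proof (rule suminf_le_dyadic_integral[OF r D])
    fix j t assume t: "2 ^ j * r < t" "t < 2 * (2 ^ j * r)"
    note pos = t_pos[OF t] \<phi>_pos[OF t_pos[OF t], of k]
    have "e k j * ennreal (1 / t) \<le> D k * ennreal (\<phi>s k x t) * ennreal (1 / t)"
      by (intro mult_right_mono e_le t) auto
    also have "\<dots> = D k * ennreal (\<phi>s k x t / t)"
      using pos by (simp add: mult.assoc flip: ennreal_mult)
    finally show "e k j * ennreal (1 / t) \<le> D k * ennreal (\<phi>s k x t / t)" .
  qed
  have sum_i: "(\<Sum>j. ennreal (1 + real j) * e i j)
      \<le> 2 * (2 * D i) * (\<integral>\<^sup>+ t\<in>{r<..}. ennreal ((1 + ln (t / r)) * (\<phi>s i x t / t)) \<partial>lebesgue)"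
  proof (rule suminf_le_dyadic_integral[OF r])
    show "2 * D i < \<infinity>"
      using D[of i] by (simp add: ennreal_mult_less_top)
    fix j t assume t: "2 ^ j * r < t" "t < 2 * (2 ^ j * r)"
    note pos = t_pos[OF t] \<phi>_pos[OF t_pos[OF t], of i]
    \<comment> \<open>On the j-th interval t / r > 2^j, hence ln (t / r) \<ge> j * ln 2 \<ge> j / 2.
      So 1 + j is at most 2 * (1 + ln (t / r)), and the drift of the averages becomes the logarithm
      in the condition on the weights.\<close>
    have "real j * ln 2 = ln (2 ^ j)"
      by (simp add: ln_realpow)
    also have "\<dots> \<le> ln (t / r)"
      using t r pos by (subst ln_le_cancel_iff) (auto simp: field_simps)
    finally have "real j * ln 2 \<le> ln (t / r)" .
    moreover have "1 / 2 \<le> ln (2 :: real)"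
      using exp_half_le2 by (subst ln_ge_iff) auto
    then have "real j * (1 / 2) \<le> real j * ln 2"
      by (rule mult_left_mono) simp
    ultimately have ln: "real j / 2 \<le> ln (t / r)"
      by linarith
    have "ennreal (1 + real j) * e i j * ennreal (1 / t)
        \<le> ennreal (2 * (1 + ln (t / r))) * (D i * ennreal (\<phi>s i x t)) * ennreal (1 / t)"
      using ln by (intro mult_right_mono mult_mono ennreal_leI e_le t) auto
    also have "\<dots> = D i * (ennreal (2 * (1 + ln (t / r))) * ennreal (\<phi>s i x t) * ennreal (1 / t))"
      by (simp only: mult_ac)
    also have "ennreal (2 * (1 + ln (t / r))) * ennreal (\<phi>s i x t) * ennreal (1 / t)
        = ennreal (2 * ((1 + ln (t / r)) * (\<phi>s i x t / t)))"
    proof -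
      have "0 \<le> ln (t / r)"
        using ln by (rule order_trans[rotated]) simp
      then show ?thesis
        using pos by (simp add: ennreal_mult[symmetric] del: ennreal_plus)
    qed
    also have "\<dots> = 2 * ennreal ((1 + ln (t / r)) * (\<phi>s i x t / t))"
      using pos ln by (subst ennreal_mult) (auto intro!: mult_nonneg_nonneg divide_nonneg_nonneg)
    finally show "ennreal (1 + real j) * e i j * ennreal (1 / t)
        \<le> 2 * D i * ennreal ((1 + ln (t / r)) * (\<phi>s i x t / t))"
      by (simp only: mult_ac)
  qed
  have "(\<Sum>j. dyadic_term p u x r j) = (\<Sum>j. ennreal (1 + real j) * e i j * (\<Prod>k\<in>UNIV - {i}. e k j))"
    unfolding dyadic_term_def e_def[symmetric] by (intro suminf_cong) (simp add: prod.remove[of UNIV i] mult.assoc)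
  also have "\<dots> \<le> (\<Sum>j. ennreal (1 + real j) * e i j) * (\<Prod>k\<in>UNIV - {i}. (\<Sum>j. e k j))"
    by (rule suminf_mult_prod_le)
  also have "\<dots> \<le> (2 * (2 * D i) * (\<integral>\<^sup>+ t\<in>{r<..}. ennreal ((1 + ln (t / r)) * (\<phi>s i x t / t)) \<partial>lebesgue))
      * (\<Prod>k\<in>UNIV - {i}. 2 * D k * (\<integral>\<^sup>+ t\<in>{r<..}. ennreal (\<phi>s k x t / t) \<partial>lebesgue))"
    by (intro mult_mono sum_i prod_mono_ennreal sum_e) auto
  also have "\<dots> = 2 * (2 * D i * (\<Prod>k\<in>UNIV - {i}. 2 * D k))
      * ((\<integral>\<^sup>+ t\<in>{r<..}. ennreal ((1 + ln (t / r)) * (\<phi>s i x t / t)) \<partial>lebesgue)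
        * (\<Prod>k\<in>UNIV - {i}. \<integral>\<^sup>+ t\<in>{r<..}. ennreal (\<phi>s k x t / t) \<partial>lebesgue))"
    by (simp only: prod.distrib mult_ac)
  also have "2 * D i * (\<Prod>k\<in>UNIV - {i}. 2 * D k) = (\<Prod>k\<in>UNIV. 2 * D k)"
    by (simp add: prod.remove[of UNIV i])
  also have "2 * (\<Prod>k\<in>UNIV. 2 * D k) = ennreal (2 * (\<Prod>k\<in>UNIV. 2 * 4 powr inv_sum (p k))) * (\<Prod>k\<in>UNIV. morrey_norm (p k) (\<phi>s k) (f k))"
  proof -
    have "2 * D k = ennreal (2 * 4 powr inv_sum (p k)) * morrey_norm (p k) (\<phi>s k) (f k)" for k
      unfolding D_def by (subst ennreal_mult) (auto simp: mult.assoc)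
    then have "(\<Prod>k\<in>UNIV. 2 * D k) = (\<Prod>k\<in>UNIV. ennreal (2 * 4 powr inv_sum (p k))) * (\<Prod>k\<in>UNIV. morrey_norm (p k) (\<phi>s k) (f k))"
      by (simp only: prod.distrib)
    also have "(\<Prod>k\<in>UNIV. ennreal (2 * 4 powr inv_sum (p k))) = ennreal (\<Prod>k\<in>UNIV. 2 * 4 powr inv_sum (p k))"
      by (intro prod_ennreal) auto
    finally show ?thesis
      by (subst ennreal_mult) (auto simp: mult.assoc intro!: prod_nonneg)
  qed
  finally show ?thesis
    by (simp only: u_def[abs_def])
qed

section \<open>Sublinear operators on truncations\<close>

lemma mixed_Lebesgue_mono:
  assumes p: "\<And>j. 0 < p j" and "g \<in> mixed_Lebesgue p" "f \<in> borel_measurable lebesgue"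
    and "\<And>y. norm (f y) \<le> norm (g y)"
  shows "f \<in> mixed_Lebesgue p"
proof -
  have "mixed_norm p f \<le> mixed_norm p g"
    unfolding mixed_norm_eq using assms(4) by (intro mnorm_mono p ennreal_leI)
  then show ?thesis
    using assms(2,3) by (auto simp: mixed_Lebesgue_def)
qed

lemma mixed_Lebesgue_of_le_add:
  fixes p :: "'n::{finite,linorder} \<Rightarrow> real"
  assumes p: "\<And>j. 0 < p j" and g: "g \<in> mixed_Lebesgue p" and h: "h \<in> mixed_Lebesgue p"
    and f: "f \<in> borel_measurable lebesgue" and le: "\<And>y. norm (f y) \<le> norm (g y) + norm (h y)"
  shows "f \<in> mixed_Lebesgue p"
proof -
  obtain K where K: "K < \<infinity>" and add: "\<And>g h. g \<in> borel_measurable lebesgue \<Longrightarrow> h \<in> borel_measurable lebesgue \<Longrightarrow>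
      mnorm p (\<lambda>x. g x + h x) \<le> K * (mnorm p g + mnorm p h)"
    by (rule mnorm_add_le[where p = p, OF p]) blast
  have [measurable]: "g \<in> borel_measurable lebesgue" "h \<in> borel_measurable lebesgue"
    using g h by (auto simp: mixed_Lebesgue_def)
  have "mixed_norm p f \<le> mnorm p (\<lambda>y. ennreal (norm (g y)) + ennreal (norm (h y)))"
    unfolding mixed_norm_eq
  proof (rule mnorm_mono[OF p])
    show "ennreal (norm (f y)) \<le> ennreal (norm (g y)) + ennreal (norm (h y))" for y
      using ennreal_leI[OF le[of y]] by simp
  qed
  also have "\<dots> \<le> K * (mixed_norm p g + mixed_norm p h)"
    unfolding mixed_norm_eq by (intro add) measurable
  also have "\<dots> < \<infinity>"
    using K g h by (auto simp: mixed_Lebesgue_def ennreal_mult_less_top)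
  finally show ?thesis
    using f by (simp add: mixed_Lebesgue_def)
qed

lemma zero_in_L1_compact: "(\<lambda>_. 0) \<in> L1_compact"
  by (simp add: L1_compact_def fun_support_def)

lemma mixed_Lebesgue_subset_op_domain: "mixed_Lebesgue p \<subseteq> op_domain p"
proof
  fix g assume "g \<in> mixed_Lebesgue p"
  then show "g \<in> op_domain p"
    unfolding op_domain_def using zero_in_L1_compact by (intro CollectI exI[of _ g] exI[of _ "\<lambda>_. 0"]) auto
qed

lemma Morrey_ball_in_mixed_Lebesgue:
  fixes p :: "'n::{finite,linorder} \<Rightarrow> real"
  assumes p: "\<And>j. 0 < p j" and \<phi>: "morrey_weight \<phi>" and f: "f \<in> mixed_Morrey p \<phi>"
  shows "(\<lambda>y. f y * indicator (ball x r) y) \<in> mixed_Lebesgue p"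
proof -
  have [measurable]: "f \<in> borel_measurable lebesgue" and fin: "morrey_norm p \<phi> f < \<infinity>"
    using f by (auto simp: mixed_Morrey_def)
  \<comment> \<open>The radius r may be nonpositive, while the weight is only controlled at positive
    radii.\<close>
  define t where "t = max r 1"
  have t: "0 < t"
    by (simp add: t_def)
  have "mixed_norm p (\<lambda>y. f y * indicator (ball x r) y) \<le> mnorm p (\<lambda>y. ennreal (norm (f y)) * indicator (ball x t) y)"
    unfolding mixed_norm_eq norm_indicator_mult by (intro mnorm_mono p) (auto simp: indicator_def t_def)
  also have "\<dots> \<le> morrey_norm p \<phi> f * ennreal (\<phi> x t * (2 * t) powr inv_sum p)"
    using \<phi> t by (intro mnorm_ball_le_morrey p) (auto simp: morrey_weight_def)
  also have "\<dots> < \<infinity>"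
    using fin by (simp add: ennreal_mult_less_top)
  finally show ?thesis
    unfolding mixed_Lebesgue_def by (auto intro!: borel_measurable_times)
qed

text \<open>The properties shared by truncations, restrictions to balls and suitable differences of
  these. For Morrey functions they place a function in the mixed Lebesgue space and among the
  compactly supported integrable functions, so both hypotheses on T apply.\<close>

definition cut :: "(real ^ 'n \<Rightarrow> complex) \<Rightarrow> (real ^ 'n \<Rightarrow> complex) \<Rightarrow> bool" where
  "cut f g \<longleftrightarrow> g \<in> borel_measurable lebesgue \<and> (\<forall>y. norm (g y) \<le> norm (f y)) \<and> (\<exists>R>0. \<forall>y. R \<le> norm y \<longrightarrow> g y = 0)"

lemma cut_ball:
  assumes "f \<in> borel_measurable lebesgue"
  shows "cut f (\<lambda>y. f y * indicator (ball x r) y)"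
  unfolding cut_def
proof (intro conjI allI exI[of _ "norm x + \<bar>r\<bar> + 1"] impI)
  show "(\<lambda>y. f y * indicator (ball x r) y) \<in> borel_measurable lebesgue"
    using assms by (intro borel_measurable_times) auto
  show "f y * indicator (ball x r) y = 0" if "norm x + \<bar>r\<bar> + 1 \<le> norm y" for y
  proof -
    have "norm y \<le> norm x + dist x y"
      using norm_triangle_sub[of y x] by (simp add: dist_norm norm_minus_commute)
    then have "y \<notin> ball x r"
      using that by auto
    then show ?thesis
      by simp
  qed
  show "0 < norm x + \<bar>r\<bar> + 1"
    by (simp add: add_nonneg_pos)
qed (simp add: indicator_def)

lemma cut_truncation: "f k \<in> borel_measurable lebesgue \<Longrightarrow> cut (f k) (truncation N f k)"
  unfolding truncation_def by (rule cut_ball)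

lemma cut_diff:
  assumes "cut f g" "cut f h" "\<And>y. norm (g y - h y) \<le> norm (f y)"
  shows "cut f (\<lambda>y. g y - h y)"
proof -
  obtain R R' where "0 < R" "\<And>y. R \<le> norm y \<Longrightarrow> g y = 0" "\<And>y. R' \<le> norm y \<Longrightarrow> h y = 0"
    using assms(1,2) unfolding cut_def by blast
  then show ?thesis
    using assms unfolding cut_def
    by (intro conjI exI[of _ "max R R'"]) (auto intro: borel_measurable_diff)
qed

context
  fixes p :: "'n::{finite,linorder} \<Rightarrow> real" and \<phi> f g
  assumes p: "\<And>j. 1 < p j" and \<phi>: "morrey_weight \<phi>" and f: "f \<in> mixed_Morrey p \<phi>" and g: "cut f g"
begin

lemma cut_mixed_Lebesgue: "g \<in> mixed_Lebesgue p"
proof -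
  have p0: "0 < p j" for j
    using p[of j] by simp
  obtain R where R: "\<And>y. R \<le> norm y \<Longrightarrow> g y = 0"
    using g unfolding cut_def by blast
  have "norm (g y) \<le> norm (f y * indicator (ball 0 R) y)" for y
    using R[of y] g by (auto simp: cut_def indicator_def not_less)
  then show ?thesis
    using g by (intro mixed_Lebesgue_mono[OF p0 Morrey_ball_in_mixed_Lebesgue[OF p0 \<phi> f]]) (auto simp: cut_def)
qed

lemma cut_L1_compact: "g \<in> L1_compact"
proof -
  obtain R where R: "0 < R" "\<And>y. R \<le> norm y \<Longrightarrow> g y = 0"
    using g unfolding cut_def by blast
  have [measurable]: "g \<in> borel_measurable lebesgue"
    using g by (simp add: cut_def)
  define p' where "p' = (\<lambda>j. 1 / (1 - 1 / p j))"
  have p': "0 < p' j" for j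
    using p[of j] by (simp add: p'_def)
  have "(\<integral>\<^sup>+ y. ennreal (norm (g y)) \<partial>lebesgue) = (\<integral>\<^sup>+ y. ennreal (norm (g y)) * indicator (ball 0 R) y \<partial>lborel)"
    unfolding nn_integral_completion using R(2)
    by (intro nn_integral_cong) (auto simp: indicator_def not_less)
  also have "\<dots> \<le> mnorm p (\<lambda>y. ennreal (norm (g y))) * mnorm p' (indicator (ball 0 R))"
    unfolding p'_def by (intro nn_integral_mult_le_mnorm p) measurable
  also have "\<dots> \<le> mixed_norm p g * ennreal ((2 * R) powr inv_sum p')"
    unfolding mixed_norm_eq by (intro mult_left_mono mnorm_ball_le p' R) auto
  also have "\<dots> < \<infinity>"
    using cut_mixed_Lebesgue by (simp add: mixed_Lebesgue_def ennreal_mult_less_top)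
  finally have "integrable lebesgue g"
    by (simp add: integrable_iff_bounded)
  moreover have "norm y \<le> R" if "g y \<noteq> 0" for y
    using R(2)[of y] that by (cases "R \<le> norm y") auto
  then have "fun_support g \<subseteq> cball 0 R"
    unfolding fun_support_def by (intro closure_minimal) auto
  then have "compact (fun_support g)"
    by (metis bounded_cball bounded_subset closed_closure compact_eq_bounded_closed fun_support_def)
  ultimately show ?thesis
    by (simp add: L1_compact_def)
qed

end

text \<open>The integrable summary part of f, its compactly supported summand, need not lie in the
  mixed Lebesgue space by itself. Off a ball containing its support f agrees with the other summand,
  and on that ball the Morrey condition bounds f.\<close>

lemma op_domain_Morrey_mixed_Lebesgue:
  fixes p :: "'n::{finite,linorder} \<Rightarrow> real"
  assumes p: "\<And>j. 0 < p j" and \<phi>: "morrey_weight \<phi>" and f: "f \<in> mixed_Morrey p \<phi>" "f \<in> op_domain p"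
  shows "f \<in> mixed_Lebesgue p"
proof -
  obtain g h where gh: "f = (\<lambda>x. g x + h x)" "g \<in> mixed_Lebesgue p" "h \<in> L1_compact"
    using f(2) unfolding op_domain_def by blast
  have "bounded (fun_support h)"
    using gh(3) by (simp add: L1_compact_def compact_imp_bounded)
  then obtain R where R: "\<And>y. y \<in> fun_support h \<Longrightarrow> norm y < R"
    unfolding bounded_pos_less by blast
  have h0: "h y = 0" if "R \<le> norm y" for y
  proof (rule ccontr)
    assume "h y \<noteq> 0"
    then have "y \<in> fun_support h"
      unfolding fun_support_def using closure_subset by fastforce
    then show False
      using R[of y] that by simp
  qed
  have "norm (f y) \<le> norm (g y) + norm (f y * indicator (ball 0 R) y)" for y
    using h0[of y] gh(1) by (auto simp: indicator_def not_less)
  then show ?thesis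
    using f(1) by (intro mixed_Lebesgue_of_le_add[OF p gh(2) Morrey_ball_in_mixed_Lebesgue[OF p \<phi> f(1)]])
      (auto simp: mixed_Morrey_def)
qed

text \<open>The reverse triangle inequality; homogeneity with factor -1 makes the two differences
  interchangeable.\<close>

lemma sublinear_diff_le:
  assumes T: "multi_sublinear_on D T" and f: "\<And>j. f j \<in> D j" and g: "g \<in> D k"
    and d: "(\<lambda>y. g y - f k y) \<in> D k" "(\<lambda>y. f k y - g y) \<in> D k"
  shows "AE x in lebesgue. \<bar>norm (T (f(k := g)) x) - norm (T f x)\<bar> \<le> norm (T (f(k := (\<lambda>y. g y - f k y))) x)"
proof -
  let ?d = "\<lambda>y. g y - f k y"
  let ?e = "\<lambda>y. f k y - g y"
  have add: "AE x in lebesgue. norm (T (f(k := (\<lambda>y. f k y + g y))) x) \<le> norm (T f x) + norm (T (f(k := g)) x)"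
    if "\<And>j. f j \<in> D j" "g \<in> D k" for f k g
    using T that unfolding multi_sublinear_on_def by blast
  have hom: "AE x in lebesgue. norm (T (f(k := (\<lambda>y. c * f k y))) x) = norm c * norm (T f x)"
    if "\<And>j. f j \<in> D j" for f k c
    using T that unfolding multi_sublinear_on_def by blast
  have 1: "AE x in lebesgue. norm (T (f(k := g)) x) \<le> norm (T f x) + norm (T (f(k := ?d)) x)"
    using add[of f ?d k] f d by simp
  have 2: "AE x in lebesgue. norm (T f x) \<le> norm (T (f(k := g)) x) + norm (T (f(k := ?e)) x)"
  proof -
    have "(f(k := g)) j \<in> D j" for j
      using f g by simp
    from add[of "f(k := g)" ?e k, OF this d(2)] show ?thesis
      by simp
  qed
  have 3: "AE x in lebesgue. norm (T (f(k := ?e)) x) = norm (T (f(k := ?d)) x)"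
  proof -
    have "(f(k := ?d)) j \<in> D j" for j
      using f d by simp
    from hom[of "f(k := ?d)" k "-1", OF this] show ?thesis
      by simp
  qed
  from 1 2 3 show ?thesis
    by eventually_elim auto
qed

text \<open>One term of the telescoping exchange of f for g: the components in A are already
  exchanged and the k-th is the difference, which vanishes wherever f and g agree in that
  component.\<close>

definition hybrid :: "('m \<Rightarrow> real ^ 'n \<Rightarrow> complex) \<Rightarrow> ('m \<Rightarrow> real ^ 'n \<Rightarrow> complex) \<Rightarrow> 'm set \<Rightarrow> 'm \<Rightarrow> 'm \<Rightarrow> real ^ 'n \<Rightarrow> complex" where
  "hybrid f g A k l = (if l = k then (\<lambda>y. g k y - f k y) else if l \<in> A then g l else f l)"

text \<open>Components are exchanged one after the other, and \<open>\<sigma> k\<close> is the set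
  exchanged before k. The order stays unspecified, because later estimates use only the difference
  in the k-th place and bounds for the other components.\<close>

lemma sublinear_telescope:
  fixes p :: "'m::finite \<Rightarrow> 'n::{finite,linorder} \<Rightarrow> real"
  assumes T: "multi_sublinear_on (\<lambda>k. op_domain (p k)) T" and p: "\<And>k j. 0 < p k j"
    and f: "\<And>k. f k \<in> mixed_Lebesgue (p k)" and g: "\<And>k. g k \<in> mixed_Lebesgue (p k)"
  obtains \<sigma> where "AE x in lebesgue. \<bar>norm (T g x) - norm (T f x)\<bar> \<le> (\<Sum>k\<in>UNIV. norm (T (hybrid f g (\<sigma> k) k) x))"
proof -
  have dom: "h \<in> op_domain (p k)" if "h \<in> mixed_Lebesgue (p k)" for h k
    using that mixed_Lebesgue_subset_op_domain by blast
  have "\<exists>\<sigma>. AE x in lebesgue. \<bar>norm (T (\<lambda>l. if l \<in> A then g l else f l) x) - norm (T f x)\<bar>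
      \<le> (\<Sum>k\<in>A. norm (T (hybrid f g (\<sigma> k) k) x))" if "finite A" for A
    using that
  proof (induction A)
    case empty
    then show ?case by simp
  next
    case (insert a A)
    then obtain \<sigma> where \<sigma>: "AE x in lebesgue. \<bar>norm (T (\<lambda>l. if l \<in> A then g l else f l) x) - norm (T f x)\<bar>
        \<le> (\<Sum>k\<in>A. norm (T (hybrid f g (\<sigma> k) k) x))"
      by blast
    let ?h = "\<lambda>l. if l \<in> A then g l else f l"
    have diff: "(\<lambda>y. u y - v y) \<in> mixed_Lebesgue (p a)" if "u \<in> mixed_Lebesgue (p a)" "v \<in> mixed_Lebesgue (p a)" for u v
      using that by (intro mixed_Lebesgue_of_le_add[OF p that]) (auto simp: mixed_Lebesgue_def norm_triangle_ineq4)
    have "AE x in lebesgue. \<bar>norm (T (?h(a := g a)) x) - norm (T ?h x)\<bar> \<le> norm (T (?h(a := (\<lambda>y. g a y - ?h a y))) x)"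
      using f g insert.hyps by (intro sublinear_diff_le[OF T]) (auto intro!: dom diff)
    moreover have "?h(a := g a) = (\<lambda>l. if l \<in> insert a A then g l else f l)"
      by (auto simp: fun_eq_iff)
    moreover have "?h(a := (\<lambda>y. g a y - ?h a y)) = hybrid f g A a"
      using insert.hyps by (auto simp: fun_eq_iff hybrid_def)
    ultimately have "AE x in lebesgue. \<bar>norm (T (\<lambda>l. if l \<in> insert a A then g l else f l) x) - norm (T ?h x)\<bar>
        \<le> norm (T (hybrid f g A a) x)"
      by simp
    with \<sigma> have "AE x in lebesgue. \<bar>norm (T (\<lambda>l. if l \<in> insert a A then g l else f l) x) - norm (T f x)\<bar>
        \<le> norm (T (hybrid f g A a) x) + (\<Sum>k\<in>A. norm (T (hybrid f g (\<sigma> k) k) x))"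
      by eventually_elim linarith
    moreover have "(\<Sum>k\<in>A. norm (T (hybrid f g (\<sigma> k) k) x)) = (\<Sum>k\<in>A. norm (T (hybrid f g ((\<sigma>(a := A)) k) k) x))" for x
      using insert.hyps by (intro sum.cong) auto
    ultimately show ?case
      using insert.hyps by (intro exI[of _ "\<sigma>(a := A)"]) simp
  qed
  from this[of UNIV] show thesis
    using that by auto
qed

lemma dyadic_term_mono:
  assumes "\<And>k j. 0 < p k j" "\<And>k y. u k y \<le> v k y"
  shows "dyadic_term p u x r j \<le> dyadic_term p v x r j"
  unfolding dyadic_term_def ball_coeff_def
  by (intro mult_left_mono prod_mono_ennreal mnorm_mono mult_right_mono assms) auto

text \<open>The series is formed with a majorant f, so that one series serves all cuts of f, and C
  does not depend on J. Since \<open>g k\<^sub>0\<close> vanishes on an open ball, its closed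
  support misses that ball, and every x' in the smaller ball is admissible in the size
  condition.\<close>

lemma size_condition_dyadic:
  fixes b :: "real ^ 'n::{finite,linorder} \<Rightarrow> complex" and p :: "'m::finite \<Rightarrow> 'n \<Rightarrow> real"
  assumes b: "b \<in> BMO" and p: "\<And>k j. 1 < p k j" and T: "size_condition b i T"
  obtains C where "0 \<le> C" "\<And>x r J g (f :: 'm \<Rightarrow> real ^ 'n::{finite,linorder} \<Rightarrow> complex) k\<^sub>0. 0 < r \<Longrightarrow> 1 \<le> J \<Longrightarrow> (\<And>k. g k \<in> L1_compact) \<Longrightarrow>
    (\<And>k y. norm (g k y) \<le> norm (f k y)) \<Longrightarrow> (\<And>z. z \<in> ball x (2 ^ J * r) \<Longrightarrow> g k\<^sub>0 z = 0) \<Longrightarrow>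
    (AE x' in lebesgue. x' \<in> ball x r \<longrightarrow> ennreal (norm (T g x'))
      \<le> ennreal (C * (norm (b x' - ball_avg b x r) + 1)) * (\<Sum>j. dyadic_term p (\<lambda>k y. ennreal (norm (f k y))) x r (j + J)))"
proof -
  have p0: "0 < p k j" for k j
    using p[of k j] by simp
  obtain C1 where C1: "0 \<le> C1" and kernel: "\<And>x r x' u k\<^sub>0 J. 0 < r \<Longrightarrow> x' \<in> ball x r \<Longrightarrow>
    (\<And>k. u k \<in> borel_measurable lebesgue) \<Longrightarrow> 1 \<le> J \<Longrightarrow> (\<And>z. z \<in> ball x (2 ^ J * r) \<Longrightarrow> u k\<^sub>0 z = 0) \<Longrightarrow>
    (\<integral>\<^sup>+ y. ennreal (norm (b x' - b (y $ i)) / norm (\<chi> k. x' - y $ k) ^ (CARD('m) * CARD('n)))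
        * (\<Prod>k\<in>UNIV. u k (y $ k)) \<partial>lebesgue)
      \<le> ennreal (C1 * (norm (b x' - ball_avg b x r) + 1)) * (\<Sum>j. dyadic_term p u x r (j + J))"
    by (rule kernel_integral_le[where b = b and p = p and i = i, OF b p]) blast
  obtain C2 where size: "\<And>f. (\<And>k. f k \<in> L1_compact) \<Longrightarrow>
        (AE x in lebesgue. x \<notin> (\<Inter>k. fun_support (f k)) \<longrightarrow>
           ennreal (norm (T f x)) \<le> ennreal C2 *
             (\<integral>\<^sup>+ y. ennreal (norm (b x - b (y $ i)) / norm (\<chi> k. x - y $ k) ^ (CARD('m) * CARD('n))
                        * norm (\<Prod>k\<in>UNIV. f k (y $ k))) \<partial>lebesgue))"
    using T unfolding size_condition_def by blast
  show thesis
  proof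
    show "0 \<le> max C2 0 * C1"
      using C1 by simp
    fix x :: "real ^ 'n::{finite,linorder}" and r :: real and J :: nat and g f :: "'m \<Rightarrow> real ^ 'n::{finite,linorder} \<Rightarrow> complex" and k\<^sub>0
    assume r: "0 < r" and J: "1 \<le> J" and g: "\<And>k. g k \<in> L1_compact"
      and gf: "\<And>k y. norm (g k y) \<le> norm (f k y)" and g0: "\<And>z. z \<in> ball x (2 ^ J * r) \<Longrightarrow> g k\<^sub>0 z = 0"
    have g_meas: "g k \<in> borel_measurable lebesgue" for k
      using g[of k] by (auto simp: L1_compact_def)
    have "fun_support (g k\<^sub>0) \<subseteq> - ball x (2 ^ J * r)"
      unfolding fun_support_def using g0 by (intro closure_minimal) auto
    moreover have "1 * r \<le> 2 ^ J * r"
      using r by (intro mult_right_mono) auto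
    then have "ball x r \<subseteq> ball x (2 ^ J * r)"
      by (intro subset_ball) simp
    ultimately have supp: "x' \<notin> (\<Inter>k. fun_support (g k))" if "x' \<in> ball x r" for x'
      using that by blast
    show "AE x' in lebesgue. x' \<in> ball x r \<longrightarrow> ennreal (norm (T g x'))
      \<le> ennreal (max C2 0 * C1 * (norm (b x' - ball_avg b x r) + 1)) * (\<Sum>j. dyadic_term p (\<lambda>k y. ennreal (norm (f k y))) x r (j + J))"
      using size[of g, OF g]
    proof eventually_elim
      case (elim x')
      show ?case
      proof
      assume x': "x' \<in> ball x r"
      then have "ennreal (norm (T g x')) \<le> ennreal C2 *
             (\<integral>\<^sup>+ y. ennreal (norm (b x' - b (y $ i)) / norm (\<chi> k. x' - y $ k) ^ (CARD('m) * CARD('n))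
                        * norm (\<Prod>k\<in>UNIV. g k (y $ k))) \<partial>lebesgue)"
        using elim supp by blast
      also have "(\<lambda>y. ennreal (norm (b x' - b (y $ i)) / norm (\<chi> k. x' - y $ k) ^ (CARD('m) * CARD('n))
                        * norm (\<Prod>k\<in>UNIV. g k (y $ k))))
          = (\<lambda>y. ennreal (norm (b x' - b (y $ i)) / norm (\<chi> k. x' - y $ k) ^ (CARD('m) * CARD('n)))
                        * (\<Prod>k\<in>UNIV. ennreal (norm (g k (y $ k)))))"
      proof
        fix y
        have "ennreal (norm (\<Prod>k\<in>UNIV. g k (y $ k))) = (\<Prod>k\<in>UNIV. ennreal (norm (g k (y $ k))))"
          unfolding prod_norm[symmetric] by (intro prod_ennreal[symmetric]) auto
        then show "ennreal (norm (b x' - b (y $ i)) / norm (\<chi> k. x' - y $ k) ^ (CARD('m) * CARD('n))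
              * norm (\<Prod>k\<in>UNIV. g k (y $ k)))
            = ennreal (norm (b x' - b (y $ i)) / norm (\<chi> k. x' - y $ k) ^ (CARD('m) * CARD('n)))
              * (\<Prod>k\<in>UNIV. ennreal (norm (g k (y $ k))))"
          by (subst ennreal_mult) auto
      qed
      also have "(\<integral>\<^sup>+ y. ennreal (norm (b x' - b (y $ i)) / norm (\<chi> k. x' - y $ k) ^ (CARD('m) * CARD('n)))
                        * (\<Prod>k\<in>UNIV. ennreal (norm (g k (y $ k)))) \<partial>lebesgue)
          \<le> ennreal (C1 * (norm (b x' - ball_avg b x r) + 1)) * (\<Sum>j. dyadic_term p (\<lambda>k y. ennreal (norm (g k y))) x r (j + J))"
        using g_meas g0 by (intro kernel[where k\<^sub>0 = k\<^sub>0] r x' J) auto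
      also have "\<dots> \<le> ennreal (C1 * (norm (b x' - ball_avg b x r) + 1)) * (\<Sum>j. dyadic_term p (\<lambda>k y. ennreal (norm (f k y))) x r (j + J))"
        using gf by (intro mult_left_mono suminf_le dyadic_term_mono p0 ennreal_leI) auto
      finally have "ennreal (norm (T g x')) \<le> ennreal C2 * (ennreal (C1 * (norm (b x' - ball_avg b x r) + 1))
          * (\<Sum>j. dyadic_term p (\<lambda>k y. ennreal (norm (f k y))) x r (j + J)))"
        by (simp add: mult_left_mono)
      \<comment> \<open>The constant of the size condition may be negative; \<open>ennreal\<close>
        sends it to 0.\<close>
      also have "ennreal C2 = ennreal (max C2 0)"
        by (cases "0 \<le> C2") (auto simp: ennreal_neg max_def)
      also have "ennreal (max C2 0) * (ennreal (C1 * (norm (b x' - ball_avg b x r) + 1))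
          * (\<Sum>j. dyadic_term p (\<lambda>k y. ennreal (norm (f k y))) x r (j + J)))
          = ennreal (max C2 0 * C1 * (norm (b x' - ball_avg b x r) + 1)) * (\<Sum>j. dyadic_term p (\<lambda>k y. ennreal (norm (f k y))) x r (j + J))"
        using C1 by (simp add: mult.assoc ennreal_mult del: ennreal_plus)
      finally show "ennreal (norm (T g x'))
        \<le> ennreal (max C2 0 * C1 * (norm (b x' - ball_avg b x r) + 1)) * (\<Sum>j. dyadic_term p (\<lambda>k y. ennreal (norm (f k y))) x r (j + J))" .
      qed
    qed
  qed
qed

section \<open>Tails of series and of mixed norms, and finite sums in a quasi-norm\<close>

lemma ennreal_suminf_tail_tendsto_0:
  fixes f :: "nat \<Rightarrow> ennreal"
  assumes "(\<Sum>j. f j) < \<infinity>"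
  shows "(\<lambda>J. \<Sum>j. f (j + J)) \<longlonglongrightarrow> 0"
proof -
  define g where "g j = enn2real (f j)" for j
  have "f j < top" for j
    using sum_le_suminf[of f "{j}"] assms by (simp add: le_less_trans)
  then have f: "f = (\<lambda>j. ennreal (g j))"
    by (simp add: g_def fun_eq_iff)
  have g: "0 \<le> g j" for j
    by (simp add: g_def)
  have sum: "summable g"
    using assms by (intro summable_suminf_not_top g) (simp add: f)
  have "(\<Sum>j. f (j + J)) = ennreal (\<Sum>j. g (j + J))" for J
    unfolding f using sum by (intro suminf_ennreal2 g) (simp add: summable_iff_shift)
  moreover have "(\<lambda>J. ennreal (\<Sum>j. g (j + J))) \<longlonglongrightarrow> ennreal 0"
    by (intro tendsto_ennrealI suminf_exist_split2 sum)
  ultimately show ?thesis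
    by simp
qed

lemma prod_less_top:
  fixes f :: "'a \<Rightarrow> ennreal"
  shows "(\<And>k. k \<in> A \<Longrightarrow> f k < \<infinity>) \<Longrightarrow> prod f A < \<infinity>"
  by (induction A rule: infinite_finite_induct) (auto simp: ennreal_mult_less_top)

lemma inverse_antimono_ennreal:
  fixes x y :: ennreal
  assumes "x \<le> y"
  shows "inverse y \<le> inverse x"
proof (cases "x = 0 \<or> y = top")
  case False
  then obtain u v where "x = ennreal u" "y = ennreal v" "0 < u"
    using assms by (cases x; cases y) (auto simp: top_unique less_le)
  then show ?thesis
    using assms by (auto simp: inverse_ennreal ennreal_le_iff2 intro!: ennreal_leI le_imp_inverse_le)
qed auto

lemma mnorm_0: "(\<And>j. 0 < p j) \<Longrightarrow> mnorm p (\<lambda>_. 0) = 0"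
  using mnorm_cmult[of p "\<lambda>_. 0" 0] by simp

lemma mnorm_sum_le:
  fixes p :: "'n::{finite,linorder} \<Rightarrow> real"
  assumes p: "\<And>j. 0 < p j" and "finite A"
  shows "\<exists>K<\<infinity>. \<forall>g. (\<forall>k. g k \<in> borel_measurable lebesgue) \<longrightarrow>
    mnorm p (\<lambda>x. \<Sum>k\<in>A. g k x) \<le> K * (\<Sum>k\<in>A. mnorm p (g k))"
  using assms(2)
proof (induction A)
  case empty
  show ?case
    by (intro exI[of _ 0]) (simp add: mnorm_0 p)
next
  case (insert a A)
  then obtain K where K: "K < \<infinity>" and le: "\<And>g. (\<And>k. g k \<in> borel_measurable lebesgue) \<Longrightarrow>
      mnorm p (\<lambda>x. \<Sum>k\<in>A. g k x) \<le> K * (\<Sum>k\<in>A. mnorm p (g k))"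
    by (elim exE conjE) blast
  obtain K' where K': "K' < \<infinity>" "1 \<le> K'" and add: "\<And>g h. g \<in> borel_measurable lebesgue \<Longrightarrow> h \<in> borel_measurable lebesgue \<Longrightarrow>
      mnorm p (\<lambda>x. g x + h x) \<le> K' * (mnorm p g + mnorm p h)"
    by (rule mnorm_add_le[where p = p, OF p]) blast
  have "mnorm p (\<lambda>x. \<Sum>k\<in>insert a A. g k x) \<le> K' * max 1 K * (\<Sum>k\<in>insert a A. mnorm p (g k))"
    if [measurable]: "\<And>k. g k \<in> borel_measurable lebesgue" for g
  proof -
    have "mnorm p (\<lambda>x. \<Sum>k\<in>insert a A. g k x) = mnorm p (\<lambda>x. g a x + (\<Sum>k\<in>A. g k x))"
      using insert.hyps by simp
    also have "\<dots> \<le> K' * (mnorm p (g a) + mnorm p (\<lambda>x. \<Sum>k\<in>A. g k x))"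
      by (intro add) measurable
    also have "\<dots> \<le> K' * (max 1 K * mnorm p (g a) + max 1 K * (\<Sum>k\<in>A. mnorm p (g k)))"
    proof (intro mult_left_mono add_mono)
      show "mnorm p (g a) \<le> max 1 K * mnorm p (g a)"
        using mult_right_mono[of 1 "max 1 K" "mnorm p (g a)"] by simp
      show "mnorm p (\<lambda>x. \<Sum>k\<in>A. g k x) \<le> max 1 K * (\<Sum>k\<in>A. mnorm p (g k))"
        using that by (intro order_trans[OF le mult_right_mono]) auto
    qed auto
    also have "\<dots> = K' * max 1 K * (\<Sum>k\<in>insert a A. mnorm p (g k))"
      using insert.hyps by (simp add: distrib_left mult.assoc)
    finally show ?thesis .
  qed
  moreover have "K' * max 1 K < \<infinity>"
    using K K' by (auto simp: ennreal_mult_less_top max_def)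
  ultimately show ?case
    by blast
qed

lemma mixed_Lebesgue_tail:
  fixes p :: "'n::{finite,linorder} \<Rightarrow> real"
  assumes p: "\<And>j. 0 < p j" and f: "f \<in> mixed_Lebesgue p"
  shows "(\<lambda>N. mnorm p (\<lambda>y. ennreal (norm (f y)) * indicator (- ball 0 (real N)) y)) \<longlonglongrightarrow> 0"
proof -
  have [measurable]: "f \<in> borel_measurable lebesgue" and fin: "mixed_norm p f < \<infinity>"
    using f by (auto simp: mixed_Lebesgue_def)
  have "(\<lambda>y. ennreal (norm (f y))) \<in> borel_measurable lebesgue"
    by measurable
  then obtain u where u [measurable]: "u \<in> borel_measurable borel" and AE: "AE y in lborel. ennreal (norm (f y)) = u y"
    by (rule lebesgue_borel_version)
  have "(\<lambda>N. mnorm p (\<lambda>y. u y * indicator (- ball 0 (real N)) y)) \<longlonglongrightarrow> 0"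
  proof (rule mnorm_tendsto_0[OF p])
    show "(\<lambda>y. u y * indicator (- ball 0 (real N)) y) \<in> borel_measurable borel" for N
      by measurable
    show "u y * indicator (- ball 0 (real N)) y \<le> u y * indicator (- ball 0 (real 0)) y" for N y
      by (simp add: indicator_def)
    have "mnorm p (\<lambda>y. u y * indicator (- ball 0 (real 0)) y) = mixed_norm p f"
      unfolding mixed_norm_eq using AE by (intro mnorm_cong_AE p) (auto elim!: eventually_mono)
    then show "mnorm p (\<lambda>y. u y * indicator (- ball 0 (real 0)) y) < \<infinity>"
      using fin by simp
    have "(\<lambda>N. u y * indicator (- ball 0 (real N)) y) \<longlonglongrightarrow> 0" for y
    proof -
      obtain N0 :: nat where "norm y < real N0"
        using reals_Archimedean2 by blast
      then have "eventually (\<lambda>N. u y * indicator (- ball 0 (real N)) y = 0) sequentially"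
        by (intro eventually_sequentiallyI[of N0]) (auto simp: indicator_def)
      then show ?thesis
        by (rule tendsto_eventually)
    qed
    then show "AE y in lborel. u y * indicator (- ball 0 (real 0)) y < \<infinity> \<longrightarrow>
        (\<lambda>N. u y * indicator (- ball 0 (real N)) y) \<longlonglongrightarrow> 0"
      by simp
  qed
  moreover have "mnorm p (\<lambda>y. ennreal (norm (f y)) * indicator (- ball 0 (real N)) y)
      = mnorm p (\<lambda>y. u y * indicator (- ball 0 (real N)) y)" for N
    using AE by (intro mnorm_cong_AE p) (auto elim!: eventually_mono)
  ultimately show ?thesis
    by simp
qed

section \<open>Boundedness on Morrey spaces\<close>

context
  fixes i :: "'m::finite"
    and p :: "'m \<Rightarrow> ('n::{finite,linorder}) \<Rightarrow> real" and q :: "'n::{finite,linorder} \<Rightarrow> real"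
    and \<phi> :: "real ^ 'n::{finite,linorder} \<Rightarrow> real \<Rightarrow> real" and \<phi>s :: "'m \<Rightarrow> real ^ 'n::{finite,linorder} \<Rightarrow> real \<Rightarrow> real"
    and C\<^sub>0 :: real
    and b :: "real ^ 'n::{finite,linorder} \<Rightarrow> complex"
    and T :: "('m \<Rightarrow> real ^ 'n::{finite,linorder} \<Rightarrow> complex) \<Rightarrow> real ^ 'n::{finite,linorder} \<Rightarrow> complex"
  assumes p: "\<And>k j. 1 < p k j"
    and q: "\<And>j. 1 / q j = (\<Sum>k\<in>UNIV. 1 / p k j)"
    and \<phi>: "morrey_weight \<phi>"
    and \<phi>s: "\<And>k. morrey_weight (\<phi>s k)"
    and C\<^sub>0: "C\<^sub>0 > 0"
    and weights: "\<And>x r. r > 0 \<Longrightarrow>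
           (\<integral>\<^sup>+ t\<in>{r<..}. ennreal ((1 + ln (t / r)) * (\<phi>s i x t / t)) \<partial>lebesgue)
             * (\<Prod>k\<in>UNIV - {i}. \<integral>\<^sup>+ t\<in>{r<..}. ennreal (\<phi>s k x t / t) \<partial>lebesgue)
           \<le> ennreal (C\<^sub>0 * \<phi> x r)"
    and b: "b \<in> BMO"
    and subl: "multi_sublinear_on (\<lambda>k. op_domain (p k)) T"
    and size: "size_condition b i T"
    and bdd: "multi_bounded (\<lambda>k. mixed_Lebesgue (p k)) (\<lambda>k. mixed_norm (p k)) (mixed_norm q) T"
begin

private definition Morrey :: "('m \<Rightarrow> real ^ 'n::{finite,linorder} \<Rightarrow> complex) \<Rightarrow> bool" where
  "Morrey f \<longleftrightarrow> (\<forall>k. f k \<in> mixed_Morrey (p k) (\<phi>s k))"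

text \<open>The tail of the dyadic series from radius 2^J * r on. Its value at J = 0 bounds norms on
  the ball, and its decay in J gives convergence of the truncations.\<close>

private definition \<Theta> :: "('m \<Rightarrow> real ^ 'n::{finite,linorder} \<Rightarrow> complex) \<Rightarrow> real ^ 'n::{finite,linorder} \<Rightarrow> real \<Rightarrow> nat \<Rightarrow> ennreal" where
  "\<Theta> f x r J = (\<Sum>j. dyadic_term p (\<lambda>k y. ennreal (norm (f k y))) x r (j + J))"

private lemma p0: "0 < p k j"
  using p[of k j] by simp

private lemma q0: "0 < q j"
proof -
  have "0 < (\<Sum>k\<in>(UNIV :: 'm set). 1 / p k j)"
    by (intro sum_pos) (auto simp: p0)
  then show ?thesis
    by (simp flip: q)
qed

private lemma inv_sum_q: "inv_sum q = (\<Sum>k\<in>UNIV. inv_sum (p k))"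
  unfolding inv_sum_def q by (rule sum.swap)

private lemma Morrey_measurable: "Morrey f \<Longrightarrow> f k \<in> borel_measurable lebesgue"
  by (simp add: Morrey_def mixed_Morrey_def)

private lemma cut_in:
  assumes "Morrey f" "cut (f k) g"
  shows "g \<in> mixed_Lebesgue (p k)" "g \<in> L1_compact"
proof -
  have f: "f k \<in> mixed_Morrey (p k) (\<phi>s k)"
    using assms(1) by (simp add: Morrey_def)
  show "g \<in> mixed_Lebesgue (p k)" "g \<in> L1_compact"
    by (rule cut_mixed_Lebesgue[where p = "p k", OF p \<phi>s f assms(2)],
        rule cut_L1_compact[where p = "p k", OF p \<phi>s f assms(2)])
qed

text \<open>The condition on the weights enters here; finiteness of the series and decay of its
  tails are consequences.\<close>

private lemma \<Theta>_le:
  obtains D where "0 \<le> D" "\<And>f x r. Morrey f \<Longrightarrow> 0 < r \<Longrightarrow>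
    \<Theta> f x r 0 \<le> ennreal D * (\<Prod>k\<in>UNIV. morrey_norm (p k) (\<phi>s k) (f k)) * ennreal (\<phi> x r)"
proof
  let ?E = "2 * (\<Prod>k\<in>(UNIV :: 'm set). 2 * 4 powr inv_sum (p k))"
  have E: "0 \<le> ?E"
    by (auto intro!: prod_nonneg)
  then show "0 \<le> ?E * C\<^sub>0"
    using C\<^sub>0 by simp
  fix f x r assume f: "Morrey f" and r: "(0 :: real) < r"
  have "\<Theta> f x r 0 \<le> ennreal ?E * (\<Prod>k\<in>UNIV. morrey_norm (p k) (\<phi>s k) (f k))
      * ((\<integral>\<^sup>+ t\<in>{r<..}. ennreal ((1 + ln (t / r)) * (\<phi>s i x t / t)) \<partial>lebesgue)
        * (\<Prod>k\<in>UNIV - {i}. \<integral>\<^sup>+ t\<in>{r<..}. ennreal (\<phi>s k x t / t) \<partial>lebesgue))"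
    unfolding \<Theta>_def add_0_right
    using f by (intro suminf_dyadic_term_le p0 \<phi>s r) (auto simp: Morrey_def mixed_Morrey_def)
  also have "\<dots> \<le> ennreal ?E * (\<Prod>k\<in>UNIV. morrey_norm (p k) (\<phi>s k) (f k)) * ennreal (C\<^sub>0 * \<phi> x r)"
    by (intro mult_left_mono weights r) auto
  also have "ennreal (C\<^sub>0 * \<phi> x r) = ennreal C\<^sub>0 * ennreal (\<phi> x r)"
    using C\<^sub>0 \<phi> r by (intro ennreal_mult) (auto simp: morrey_weight_def less_imp_le)
  also have "ennreal ?E * (\<Prod>k\<in>UNIV. morrey_norm (p k) (\<phi>s k) (f k)) * (ennreal C\<^sub>0 * ennreal (\<phi> x r))
      = (ennreal ?E * ennreal C\<^sub>0) * (\<Prod>k\<in>UNIV. morrey_norm (p k) (\<phi>s k) (f k)) * ennreal (\<phi> x r)"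
    by (simp only: mult_ac)
  also have "ennreal ?E * ennreal C\<^sub>0 = ennreal (?E * C\<^sub>0)"
    using E C\<^sub>0 by (intro ennreal_mult[symmetric]) auto
  finally show "\<Theta> f x r 0 \<le> ennreal (?E * C\<^sub>0) * (\<Prod>k\<in>UNIV. morrey_norm (p k) (\<phi>s k) (f k)) * ennreal (\<phi> x r)" .
qed

private lemma \<Theta>_finite:
  assumes "Morrey f" "0 < r"
  shows "\<Theta> f x r 0 < \<infinity>"
proof -
  obtain D where le: "\<Theta> f x r 0 \<le> ennreal D * (\<Prod>k\<in>UNIV. morrey_norm (p k) (\<phi>s k) (f k)) * ennreal (\<phi> x r)"
    using \<Theta>_le assms by metis
  have "(\<Prod>k\<in>UNIV. morrey_norm (p k) (\<phi>s k) (f k)) < \<infinity>"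
    using assms(1) by (intro prod_less_top) (auto simp: Morrey_def mixed_Morrey_def)
  then have "ennreal D * (\<Prod>k\<in>UNIV. morrey_norm (p k) (\<phi>s k) (f k)) * ennreal (\<phi> x r) < \<infinity>"
    by (simp add: ennreal_mult_less_top)
  with le show ?thesis
    by (rule le_less_trans)
qed

private lemma \<Theta>_tail:
  assumes "Morrey f" "0 < r"
  shows "(\<lambda>J. \<Theta> f x r J) \<longlonglongrightarrow> 0"
  using \<Theta>_finite[OF assms, of x] unfolding \<Theta>_def by (intro ennreal_suminf_tail_tendsto_0) simp

text \<open>Each tuple of the telescoping exchange has a component vanishing on the ball of radius
  2^J * r, so the size condition bounds it by the tail from J on. Two truncations are compared as J
  grows; a truncation is compared with the restriction to the doubled ball at J = 1.\<close>

private lemma cut_tuple_diff_le: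
  obtains C where "0 \<le> C" "\<And>f x r J g h. Morrey f \<Longrightarrow> 0 < r \<Longrightarrow> 1 \<le> J \<Longrightarrow>
    (\<And>k. cut (f k) (g k)) \<Longrightarrow> (\<And>k. cut (f k) (h k)) \<Longrightarrow> (\<And>k y. norm (g k y - h k y) \<le> norm (f k y)) \<Longrightarrow>
    (\<And>k z. z \<in> ball x (2 ^ J * r) \<Longrightarrow> g k z = h k z) \<Longrightarrow>
    (AE y in lebesgue. y \<in> ball x r \<longrightarrow> ennreal \<bar>norm (T g y) - norm (T h y)\<bar>
      \<le> ennreal (C * (norm (b y - ball_avg b x r) + 1)) * \<Theta> f x r J)"
proof -
  obtain C where C: "0 \<le> C" and point: "\<And>x r J g (f :: 'm \<Rightarrow> real ^ 'n::{finite,linorder} \<Rightarrow> complex) k\<^sub>0. 0 < r \<Longrightarrow> 1 \<le> J \<Longrightarrow> (\<And>k. g k \<in> L1_compact) \<Longrightarrow>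
    (\<And>k y. norm (g k y) \<le> norm (f k y)) \<Longrightarrow> (\<And>z. z \<in> ball x (2 ^ J * r) \<Longrightarrow> g k\<^sub>0 z = 0) \<Longrightarrow>
    (AE x' in lebesgue. x' \<in> ball x r \<longrightarrow> ennreal (norm (T g x'))
      \<le> ennreal (C * (norm (b x' - ball_avg b x r) + 1)) * (\<Sum>j. dyadic_term p (\<lambda>k y. ennreal (norm (f k y))) x r (j + J)))"
    by (rule size_condition_dyadic[where p = p, OF b p size]) blast
  let ?m = "real CARD('m)"
  show thesis
  proof
    show "0 \<le> ?m * C"
      using C by simp
    fix f x and r :: real and J g h
    assume f: "Morrey f" and r: "0 < r" and J: "1 \<le> J" and g: "\<And>k. cut (f k) (g k)" and h: "\<And>k. cut (f k) (h k)"
      and d: "\<And>k y. norm (g k y - h k y) \<le> norm (f k y)"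
      and eq: "\<And>k z. z \<in> ball x (2 ^ J * r) \<Longrightarrow> g k z = h k z"
    obtain \<sigma> where \<sigma>: "AE y in lebesgue. \<bar>norm (T g y) - norm (T h y)\<bar> \<le> (\<Sum>k\<in>UNIV. norm (T (hybrid h g (\<sigma> k) k) y))"
      by (rule sublinear_telescope[OF subl p0 cut_in(1)[OF f h] cut_in(1)[OF f g]])
    have hyb_cut: "cut (f l) (hybrid h g (\<sigma> k) k l)" for k l
      using g h d by (auto simp: hybrid_def intro: cut_diff)
    have "AE y in lebesgue. y \<in> ball x r \<longrightarrow> ennreal (norm (T (hybrid h g (\<sigma> k) k) y))
        \<le> ennreal (C * (norm (b y - ball_avg b x r) + 1)) * \<Theta> f x r J" for k
      unfolding \<Theta>_def
    proof (rule point[OF r J, where k\<^sub>0 = k])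
      show "hybrid h g (\<sigma> k) k l \<in> L1_compact" for l
        by (rule cut_in(2)[OF f hyb_cut])
      show "norm (hybrid h g (\<sigma> k) k l y) \<le> norm (f l y)" for l y
        using hyb_cut[of l k] by (simp add: cut_def)
      show "hybrid h g (\<sigma> k) k k z = 0" if "z \<in> ball x (2 ^ J * r)" for z
        using eq[OF that] by (simp add: hybrid_def)
    qed
    then have "AE y in lebesgue. \<forall>k\<in>(UNIV :: 'm set). y \<in> ball x r \<longrightarrow> ennreal (norm (T (hybrid h g (\<sigma> k) k) y))
        \<le> ennreal (C * (norm (b y - ball_avg b x r) + 1)) * \<Theta> f x r J"
      by (intro AE_finite_allI) auto
    with \<sigma> show "AE y in lebesgue. y \<in> ball x r \<longrightarrow> ennreal \<bar>norm (T g y) - norm (T h y)\<bar>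
      \<le> ennreal (?m * C * (norm (b y - ball_avg b x r) + 1)) * \<Theta> f x r J"
    proof eventually_elim
      case (elim y)
      show ?case
      proof
        assume y: "y \<in> ball x r"
        have "ennreal \<bar>norm (T g y) - norm (T h y)\<bar> \<le> ennreal (\<Sum>k\<in>UNIV. norm (T (hybrid h g (\<sigma> k) k) y))"
          by (intro ennreal_leI elim)
        also have "\<dots> = (\<Sum>k\<in>UNIV. ennreal (norm (T (hybrid h g (\<sigma> k) k) y)))"
          by (intro sum_ennreal[symmetric]) auto
        also have "\<dots> \<le> (\<Sum>k\<in>(UNIV :: 'm set). ennreal (C * (norm (b y - ball_avg b x r) + 1)) * \<Theta> f x r J)"
          using elim y by (intro sum_mono) auto
        also have "\<dots> = of_nat CARD('m) * ennreal (C * (norm (b y - ball_avg b x r) + 1)) * \<Theta> f x r J"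
          by (simp add: mult.assoc)
        also have "of_nat CARD('m) * ennreal (C * (norm (b y - ball_avg b x r) + 1))
            = ennreal (?m * C * (norm (b y - ball_avg b x r) + 1))"
          using C by (simp add: ennreal_of_nat_eq_real_of_nat mult.assoc ennreal_mult del: ennreal_plus)
        finally show "ennreal \<bar>norm (T g y) - norm (T h y)\<bar>
          \<le> ennreal (?m * C * (norm (b y - ball_avg b x r) + 1)) * \<Theta> f x r J" .
      qed
    qed
  qed
qed

section \<open>Convergence of the truncations and identification of the limit\<close>

private lemma truncation_convergent:
  assumes f: "Morrey f"
  shows "AE x in lebesgue. convergent (\<lambda>N. norm (T (truncation N f) x))"
proof -
  obtain C where C: "0 \<le> C" and diff: "\<And>f x r J g h. Morrey f \<Longrightarrow> 0 < r \<Longrightarrow> 1 \<le> J \<Longrightarrow>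
    (\<And>k. cut (f k) (g k)) \<Longrightarrow> (\<And>k. cut (f k) (h k)) \<Longrightarrow> (\<And>k y. norm (g k y - h k y) \<le> norm (f k y)) \<Longrightarrow>
    (\<And>k z. z \<in> ball x (2 ^ J * r) \<Longrightarrow> g k z = h k z) \<Longrightarrow>
    (AE y in lebesgue. y \<in> ball x r \<longrightarrow> ennreal \<bar>norm (T g y) - norm (T h y)\<bar>
      \<le> ennreal (C * (norm (b y - ball_avg b x r) + 1)) * \<Theta> f x r J)"
    by (rule cut_tuple_diff_le) blast
  \<comment> \<open>The exceptional null set depends on the ball, on J and on both truncations.
    Integer radii around 0 leave countably many of them, and the successor keeps the radius
    positive.\<close>
  let ?r = "\<lambda>n. real (Suc n)"
  have "AE y in lebesgue. 1 \<le> J \<longrightarrow> 2 ^ J * ?r n \<le> real N \<longrightarrow> 2 ^ J * ?r n \<le> real M \<longrightarrow> y \<in> ball 0 (?r n) \<longrightarrow>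
      ennreal \<bar>norm (T (truncation N f) y) - norm (T (truncation M f) y)\<bar>
        \<le> ennreal (C * (norm (b y - ball_avg b 0 (?r n)) + 1)) * \<Theta> f 0 (?r n) J" for n J N M
  proof (cases "1 \<le> J \<and> 2 ^ J * ?r n \<le> real N \<and> 2 ^ J * ?r n \<le> real M")
    case True
    have "AE y in lebesgue. y \<in> ball 0 (?r n) \<longrightarrow>
      ennreal \<bar>norm (T (truncation N f) y) - norm (T (truncation M f) y)\<bar>
        \<le> ennreal (C * (norm (b y - ball_avg b 0 (?r n)) + 1)) * \<Theta> f 0 (?r n) J"
    proof (rule diff[OF f])
      show "cut (f k) (truncation N f k)" "cut (f k) (truncation M f k)" for k
        by (auto intro: cut_truncation Morrey_measurable[OF f])
      show "norm (truncation N f k y - truncation M f k y) \<le> norm (f k y)" for k y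
        by (auto simp: truncation_def indicator_def)
      show "truncation N f k z = truncation M f k z" if "z \<in> ball 0 (2 ^ J * ?r n)" for k z
        using that True by (auto simp: truncation_def indicator_def)
    qed (use True in auto)
    then show ?thesis
      by (auto elim: eventually_mono)
  qed auto
  then have "AE y in lebesgue. \<forall>n J N M. 1 \<le> J \<longrightarrow> 2 ^ J * ?r n \<le> real N \<longrightarrow> 2 ^ J * ?r n \<le> real M \<longrightarrow> y \<in> ball 0 (?r n) \<longrightarrow>
      ennreal \<bar>norm (T (truncation N f) y) - norm (T (truncation M f) y)\<bar>
        \<le> ennreal (C * (norm (b y - ball_avg b 0 (?r n)) + 1)) * \<Theta> f 0 (?r n) J"
    by (simp only: AE_all_countable) blast
  then show ?thesis
  proof eventually_elim
    case (elim y)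
    obtain n :: nat where "norm y < ?r n"
      by (metis less_SucI lessI reals_Archimedean2 of_nat_less_iff less_trans)
    then have y: "y \<in> ball 0 (?r n)"
      by simp
    let ?c = "ennreal (C * (norm (b y - ball_avg b 0 (?r n)) + 1))"
    have "(\<lambda>J. ?c * \<Theta> f 0 (?r n) J) \<longlonglongrightarrow> ?c * 0"
      by (intro ennreal_tendsto_cmult \<Theta>_tail f) auto
    then have lim: "(\<lambda>J. ?c * \<Theta> f 0 (?r n) J) \<longlonglongrightarrow> 0"
      by simp
    have "Cauchy (\<lambda>N. norm (T (truncation N f) y))"
    proof (rule CauchyI)
      fix e :: real assume "0 < e"
      then have "eventually (\<lambda>J. ?c * \<Theta> f 0 (?r n) J < ennreal e \<and> 1 \<le> J) sequentially"
        by (intro eventually_conj order_tendstoD[OF lim] eventually_ge_at_top) auto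
      then obtain J where J: "?c * \<Theta> f 0 (?r n) J < ennreal e" "1 \<le> J"
        by (auto simp: eventually_sequentially)
      obtain N0 :: nat where N0: "2 ^ J * ?r n \<le> real N0"
        using real_arch_simple by blast
      have "norm (norm (T (truncation N f) y) - norm (T (truncation M f) y)) < e" if "N0 \<le> N" "N0 \<le> M" for N M
      proof -
        have "2 ^ J * ?r n \<le> real N" "2 ^ J * ?r n \<le> real M"
          using N0 that by (meson of_nat_le_iff order_trans)+
        then have "ennreal \<bar>norm (T (truncation N f) y) - norm (T (truncation M f) y)\<bar> \<le> ?c * \<Theta> f 0 (?r n) J"
          using elim J(2) y by blast
        also have "\<dots> < ennreal e"
          by (rule J(1))
        finally show ?thesis
          by (subst (asm) ennreal_less_iff) auto
      qed
      then show "\<exists>N0. \<forall>N\<ge>N0. \<forall>M\<ge>N0. norm (norm (T (truncation N f) y) - norm (T (truncation M f) y)) < e"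
        by blast
    qed
    then show ?case
      by (rule Cauchy_convergent)
  qed
qed

private lemma T_bound:
  obtains CT where "0 \<le> CT" "\<And>f. (\<And>k. f k \<in> mixed_Lebesgue (p k)) \<Longrightarrow> T f \<in> borel_measurable lebesgue"
    "\<And>f. (\<And>k. f k \<in> mixed_Lebesgue (p k)) \<Longrightarrow> mixed_norm q (T f) \<le> ennreal CT * (\<Prod>k\<in>UNIV. mixed_norm (p k) (f k))"
proof -
  obtain C :: real where C: "\<And>f. (\<And>k. f k \<in> mixed_Lebesgue (p k)) \<Longrightarrow>
      T f \<in> borel_measurable lebesgue \<and> mixed_norm q (T f) \<le> ennreal C * (\<Prod>k\<in>UNIV. mixed_norm (p k) (f k))"
    using bdd unfolding multi_bounded_def by blast
  have "ennreal C = ennreal (max C 0)"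
    by (cases "0 \<le> C") (auto simp: ennreal_neg max_def)
  then show thesis
    using C by (intro that[of "max C 0"]) auto
qed

private lemma truncation_limit:
  assumes f: "Morrey f" and dom: "\<And>k. f k \<in> mixed_Lebesgue (p k)"
  shows "AE x in lebesgue. (\<lambda>N. norm (T (truncation N f) x)) \<longlonglongrightarrow> norm (T f x)"
proof -
  obtain CT where T_meas: "\<And>f. (\<And>k. f k \<in> mixed_Lebesgue (p k)) \<Longrightarrow> T f \<in> borel_measurable lebesgue"
    and T_le: "\<And>f. (\<And>k. f k \<in> mixed_Lebesgue (p k)) \<Longrightarrow> mixed_norm q (T f) \<le> ennreal CT * (\<Prod>k\<in>UNIV. mixed_norm (p k) (f k))"
    by (rule T_bound) blast
  obtain K where K: "K < \<infinity>" and sum_le: "\<And>g :: 'm \<Rightarrow> _. (\<And>k. g k \<in> borel_measurable lebesgue) \<Longrightarrow>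
    mnorm q (\<lambda>x. \<Sum>k\<in>UNIV. g k x) \<le> K * (\<Sum>k\<in>UNIV. mnorm q (g k))"
    using mnorm_sum_le[where p = q and A = "UNIV :: 'm set", OF q0 finite] by (elim exE conjE) blast
  have tr: "truncation N f k \<in> mixed_Lebesgue (p k)" for N k
    by (rule cut_in(1)[OF f cut_truncation[of f k, OF Morrey_measurable[OF f]]])
  define E where "E N x = \<bar>norm (T (truncation N f) x) - norm (T f x)\<bar>" for N x
  have T_meas' [measurable]: "T f \<in> borel_measurable lebesgue" "T (truncation N f) \<in> borel_measurable lebesgue" for N
    by (intro T_meas dom tr)+
  have E_meas [measurable]: "(\<lambda>x. ennreal (E N x)) \<in> borel_measurable lebesgue" for N
    unfolding E_def by measurable
  \<comment> \<open>In the k-th telescoping tuple the k-th component is, up to sign, the part of f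
    cut away, with norm \<delta>; the others are dominated by f and contribute at most B.\<close>
  define \<delta> where "\<delta> k N = mnorm (p k) (\<lambda>y. ennreal (norm (f k y)) * indicator (- ball 0 (real N)) y)" for k N
  define B where "B k = (\<Prod>l\<in>UNIV - {k}. mixed_norm (p l) (f l))" for k
  have B: "B k < \<infinity>" for k
    unfolding B_def using dom by (intro prod_less_top) (auto simp: mixed_Lebesgue_def)
  have E_le: "mnorm q (\<lambda>x. ennreal (E N x)) \<le> K * (\<Sum>k\<in>UNIV. ennreal CT * (B k * \<delta> k N))" for N
  proof -
    obtain \<sigma> where \<sigma>: "AE x in lebesgue. \<bar>norm (T (truncation N f) x) - norm (T f x)\<bar>
        \<le> (\<Sum>k\<in>UNIV. norm (T (hybrid f (truncation N f) (\<sigma> k) k) x))"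
      by (rule sublinear_telescope[OF subl p0 dom tr])
    let ?h = "\<lambda>k. hybrid f (truncation N f) (\<sigma> k) k"
    have diff: "(\<lambda>y. truncation N f k y - f k y) = (\<lambda>y. - (f k y * indicator (- ball 0 (real N)) y))" for k
      by (auto simp: truncation_def fun_eq_iff indicator_def)
    have h_dom: "?h k l \<in> mixed_Lebesgue (p l)" for k l
    proof (cases "l = k")
      case True
      have "(\<lambda>y. truncation N f k y - f k y) \<in> mixed_Lebesgue (p k)"
        using dom[of k] tr[of N k] by (intro mixed_Lebesgue_of_le_add[OF p0 tr[of N] dom])
          (auto simp: mixed_Lebesgue_def norm_triangle_ineq4 intro!: borel_measurable_diff)
      then show ?thesis
        using True by (simp add: hybrid_def)
    next
      case False
      then show ?thesis
        using dom[of l] tr[of N l] by (simp add: hybrid_def)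
    qed
    have [measurable]: "T (?h k) \<in> borel_measurable lebesgue" for k
      by (intro T_meas h_dom)
    have h_le: "mixed_norm q (T (?h k)) \<le> ennreal CT * (B k * \<delta> k N)" for k
    proof -
      have "(\<Prod>l\<in>UNIV. mixed_norm (p l) (?h k l)) = mixed_norm (p k) (?h k k) * (\<Prod>l\<in>UNIV - {k}. mixed_norm (p l) (?h k l))"
        by (rule prod.remove) auto
      also have "mixed_norm (p k) (?h k k) = \<delta> k N"
        unfolding hybrid_def diff mixed_norm_eq \<delta>_def by (simp add: norm_indicator_mult)
      also have "(\<Prod>l\<in>UNIV - {k}. mixed_norm (p l) (?h k l)) \<le> B k"
        unfolding B_def
      proof (rule prod_mono_ennreal)
        fix l assume "l \<in> UNIV - {k}"
        then have "norm (?h k l y) \<le> norm (f l y)" for y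
          by (auto simp: hybrid_def truncation_def indicator_def)
        then show "mixed_norm (p l) (?h k l) \<le> mixed_norm (p l) (f l)"
          unfolding mixed_norm_eq by (intro mnorm_mono p0 ennreal_leI)
      qed
      finally have "(\<Prod>l\<in>UNIV. mixed_norm (p l) (?h k l)) \<le> \<delta> k N * B k"
        by (simp add: mult_left_mono)
      also have "\<dots> = B k * \<delta> k N"
        by (rule mult.commute)
      finally have "(\<Prod>l\<in>UNIV. mixed_norm (p l) (?h k l)) \<le> B k * \<delta> k N" .
      then show ?thesis
        using T_le[of "?h k", OF h_dom] by (meson mult_left_mono order_trans zero_le)
    qed
    have "mnorm q (\<lambda>x. ennreal (E N x)) \<le> mnorm q (\<lambda>x. \<Sum>k\<in>UNIV. ennreal (norm (T (?h k) x)))"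
    proof (rule mnorm_mono_AE[OF q0])
      show "AE x in lborel. ennreal (E N x) \<le> (\<Sum>k\<in>UNIV. ennreal (norm (T (?h k) x)))"
        using \<sigma> unfolding AE_completion_iff
        by eventually_elim (simp add: E_def sum_ennreal ennreal_leI)
    qed
    also have "\<dots> \<le> K * (\<Sum>k\<in>UNIV. mixed_norm q (T (?h k)))"
      unfolding mixed_norm_eq by (intro sum_le) measurable
    also have "\<dots> \<le> K * (\<Sum>k\<in>UNIV. ennreal CT * (B k * \<delta> k N))"
      by (intro mult_left_mono sum_mono h_le) auto
    finally show ?thesis .
  qed
  have "(\<lambda>N. K * (\<Sum>k\<in>UNIV. ennreal CT * (B k * \<delta> k N))) \<longlonglongrightarrow> K * (\<Sum>k\<in>(UNIV :: 'm set). ennreal CT * (B k * 0))"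
    using K B unfolding \<delta>_def
    by (intro ennreal_tendsto_cmult tendsto_sum mixed_Lebesgue_tail p0 dom) auto
  then have lim0: "(\<lambda>N. K * (\<Sum>k\<in>UNIV. ennreal CT * (B k * \<delta> k N))) \<longlonglongrightarrow> 0"
    by simp
  \<comment> \<open>In place of an almost everywhere convergent subsequence: the infimum of the
    errors from N on has norm at most every later error norm, hence norm 0, and so vanishes almost
    everywhere. A convergent sequence with this property for all N has limit |T f|.\<close>
  have inf0: "AE x in lborel. (INF M\<in>{N..}. ennreal (E M x)) = 0" for N
  proof (rule mnorm_eq_0D[OF q0])
    show "(\<lambda>x. INF M\<in>{N..}. ennreal (E M x)) \<in> borel_measurable lebesgue"
      by (intro borel_measurable_INF) auto
    have "mnorm q (\<lambda>x. INF M\<in>{N..}. ennreal (E M x)) \<le> K * (\<Sum>k\<in>UNIV. ennreal CT * (B k * \<delta> k M))" if "N \<le> M" for M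
      using that by (intro order_trans[OF mnorm_mono[OF q0] E_le]) (auto intro: INF_lower)
    then have "mnorm q (\<lambda>x. INF M\<in>{N..}. ennreal (E M x)) \<le> 0"
      by (intro LIMSEQ_le_const[OF lim0]) auto
    then show "mnorm q (\<lambda>x. INF M\<in>{N..}. ennreal (E M x)) = 0"
      by simp
  qed
  have inf: "AE x in lebesgue. \<forall>N. (INF M\<in>{N..}. ennreal (E M x)) = 0"
    unfolding AE_all_countable AE_completion_iff using inf0 by blast
  from inf truncation_convergent[OF f] show ?thesis
  proof eventually_elim
    case (elim x)
    then obtain L where L: "(\<lambda>N. norm (T (truncation N f) x)) \<longlonglongrightarrow> L"
      by (auto simp: convergent_def)
    have "L = norm (T f x)"
    proof (rule ccontr)
      assume "L \<noteq> norm (T f x)"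
      then have e: "0 < \<bar>L - norm (T f x)\<bar> / 2"
        by simp
      have "(\<lambda>N. E N x) \<longlonglongrightarrow> \<bar>L - norm (T f x)\<bar>"
        unfolding E_def by (intro tendsto_intros L)
      then have "eventually (\<lambda>N. \<bar>L - norm (T f x)\<bar> / 2 < E N x) sequentially"
        using e by (intro order_tendstoD) auto
      then obtain N where N: "\<And>M. N \<le> M \<Longrightarrow> \<bar>L - norm (T f x)\<bar> / 2 < E M x"
        by (auto simp: eventually_sequentially)
      have "ennreal (\<bar>L - norm (T f x)\<bar> / 2) \<le> (INF M\<in>{N..}. ennreal (E M x))"
        using N by (intro INF_greatest ennreal_leI) (auto intro: less_imp_le)
      then show False
        using elim(1) e by (simp add: ennreal_eq_0_iff del: abs_divide)
    qed
    then show ?case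
      using L by simp
  qed
qed

section \<open>The norm on a single ball and the Morrey bound\<close>

private lemma mixed_norm_ball_eq:
  assumes "0 < s"
  shows "mixed_norm (p k) (\<lambda>y. f k y * indicator (ball x s) y)
    = ennreal (s powr inv_sum (p k)) * ball_coeff (p k) (\<lambda>y. ennreal (norm (f k y))) x s"
proof -
  have "ennreal (s powr inv_sum (p k)) * ennreal (s powr - inv_sum (p k)) = 1"
    using assms by (subst ennreal_mult[symmetric]) (auto simp flip: powr_add)
  then show ?thesis
    by (simp add: ball_coeff_def mixed_norm_eq norm_indicator_mult flip: mult.assoc)
qed

private lemma ball_norm_limit_le:
  obtains C where "0 \<le> C" "\<And>f g x r. Morrey f \<Longrightarrow> 0 < r \<Longrightarrow> g \<in> borel_measurable lebesgue \<Longrightarrow>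
    (AE y in lebesgue. (\<lambda>N. norm (T (truncation N f) y)) \<longlonglongrightarrow> norm (g y)) \<Longrightarrow>
    mixed_norm q (\<lambda>y. g y * indicator (ball x r) y) \<le> ennreal (C * r powr inv_sum q) * \<Theta> f x r 0"
proof -
  obtain C1 where C1: "0 \<le> C1" and diff: "\<And>f x r J g h. Morrey f \<Longrightarrow> 0 < r \<Longrightarrow> 1 \<le> J \<Longrightarrow>
    (\<And>k. cut (f k) (g k)) \<Longrightarrow> (\<And>k. cut (f k) (h k)) \<Longrightarrow> (\<And>k y. norm (g k y - h k y) \<le> norm (f k y)) \<Longrightarrow>
    (\<And>k z. z \<in> ball x (2 ^ J * r) \<Longrightarrow> g k z = h k z) \<Longrightarrow>
    (AE y in lebesgue. y \<in> ball x r \<longrightarrow> ennreal \<bar>norm (T g y) - norm (T h y)\<bar>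
      \<le> ennreal (C1 * (norm (b y - ball_avg b x r) + 1)) * \<Theta> f x r J)"
    by (rule cut_tuple_diff_le) blast
  obtain CT where CT: "0 \<le> CT" and T_meas: "\<And>f. (\<And>k. f k \<in> mixed_Lebesgue (p k)) \<Longrightarrow> T f \<in> borel_measurable lebesgue"
    and T_le: "\<And>f. (\<And>k. f k \<in> mixed_Lebesgue (p k)) \<Longrightarrow> mixed_norm q (T f) \<le> ennreal CT * (\<Prod>k\<in>UNIV. mixed_norm (p k) (f k))"
    by (rule T_bound) blast
  obtain K where K: "K < \<infinity>" and add: "\<And>g h. g \<in> borel_measurable lebesgue \<Longrightarrow> h \<in> borel_measurable lebesgue \<Longrightarrow>
      mnorm q (\<lambda>x. g x + h x) \<le> K * (mnorm q g + mnorm q h)"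
    by (rule mnorm_add_le[where p = q, OF q0]) blast
  obtain C2 where C2: "0 \<le> C2" and BMO_le: "\<And>x r. 0 < r \<Longrightarrow>
    mnorm q (\<lambda>y. ennreal (norm (b y - ball_avg b x r) + 1) * indicator (ball x r) y) \<le> ennreal (C2 * r powr inv_sum q)"
    by (rule mnorm_BMO[where p = q, OF b q0]) blast
  have [measurable]: "b \<in> borel_measurable lebesgue"
    using b by (simp add: BMO_def locally_integrable_measurable)
  obtain K' where K': "K = ennreal K'" "0 \<le> K'"
    using K by (cases K) auto
  \<comment> \<open>The first summand is the contribution of the part of f in the doubled ball, the
    second that of the rest.\<close>
  define C3 where "C3 = CT * 2 powr inv_sum q + C1 * C2"
  have C3: "0 \<le> C3"
    using CT C1 C2 by (simp add: C3_def)
  show thesis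
  proof
    show "0 \<le> K' * C3"
      using K' C3 by simp
    fix f x and g :: "real ^ 'n::{finite,linorder} \<Rightarrow> complex" and r :: real
    assume f: "Morrey f" and r: "0 < r" and g: "g \<in> borel_measurable lebesgue"
      and lim: "AE y in lebesgue. (\<lambda>N. norm (T (truncation N f) y)) \<longlonglongrightarrow> norm (g y)"
    \<comment> \<open>The doubled radius corresponds to J = 1, the smallest index for which the
      kernel is controlled on the ball of radius r.\<close>
    define h where "h k y = f k y * indicator (ball x (2 * r)) y" for k y
    have h_cut: "cut (f k) (h k)" for k
      unfolding h_def by (intro cut_ball Morrey_measurable[OF f])
    have h_dom: "h k \<in> mixed_Lebesgue (p k)" for k
      by (rule cut_in(1)[OF f h_cut])
    have [measurable]: "T h \<in> borel_measurable lebesgue"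
      by (intro T_meas h_dom)
    let ?v = "\<lambda>y. ennreal (norm (b y - ball_avg b x r) + 1) * indicator (ball x r) y"
    let ?X = "ennreal C1 * \<Theta> f x r 0"
    have \<Theta>_shift: "\<Theta> f x r 1 \<le> \<Theta> f x r 0"
    proof -
      have "(\<lambda>J. \<Sum>j<J. F (j + 1)) \<longlonglongrightarrow> (\<Sum>j. F (j + 1))" for F :: "nat \<Rightarrow> ennreal"
        using summableI[of "\<lambda>j. F (j + 1)"] by (rule summable_LIMSEQ)
      moreover have "(\<Sum>j<J. F (j + 1)) \<le> (\<Sum>j. F j)" for J and F :: "nat \<Rightarrow> ennreal"
      proof -
        have "(\<Sum>j<J. F (j + 1)) = sum F (Suc ` {..<J})"
          by (simp add: sum.reindex)
        also have "\<dots> \<le> (\<Sum>j. F j)"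
          by (intro sum_le_suminf) auto
        finally show ?thesis .
      qed
      ultimately have "(\<Sum>j. F (j + 1)) \<le> (\<Sum>j. F j)" for F :: "nat \<Rightarrow> ennreal"
        by (meson LIMSEQ_le_const2)
      then show ?thesis
        by (simp add: \<Theta>_def)
    qed
    have "AE y in lebesgue. norm x + 2 * r \<le> real N \<longrightarrow> y \<in> ball x r \<longrightarrow>
        ennreal \<bar>norm (T (truncation N f) y) - norm (T h y)\<bar>
          \<le> ennreal (C1 * (norm (b y - ball_avg b x r) + 1)) * \<Theta> f x r 1" for N
    proof (cases "norm x + 2 * r \<le> real N")
      case True
      have "AE y in lebesgue. y \<in> ball x r \<longrightarrow> ennreal \<bar>norm (T (truncation N f) y) - norm (T h y)\<bar>
          \<le> ennreal (C1 * (norm (b y - ball_avg b x r) + 1)) * \<Theta> f x r 1"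
      proof (rule diff[OF f r _ _ h_cut])
        show "cut (f k) (truncation N f k)" for k
          by (rule cut_truncation[OF Morrey_measurable[OF f]])
        show "norm (truncation N f k y - h k y) \<le> norm (f k y)" for k y
          by (auto simp: truncation_def h_def indicator_def)
        fix k z assume z: "z \<in> ball x (2 ^ 1 * r)"
        have "norm z \<le> norm x + dist x z"
          using norm_triangle_sub[of z x] by (simp add: dist_norm norm_minus_commute)
        then have "norm z < real N"
          using z True by simp
        then show "truncation N f k z = h k z"
          using z by (simp add: truncation_def h_def)
      qed simp
      then show ?thesis
        by (auto elim: eventually_mono)
    qed auto
    then have "AE y in lebesgue. \<forall>N. norm x + 2 * r \<le> real N \<longrightarrow> y \<in> ball x r \<longrightarrow>
        ennreal \<bar>norm (T (truncation N f) y) - norm (T h y)\<bar>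
          \<le> ennreal (C1 * (norm (b y - ball_avg b x r) + 1)) * \<Theta> f x r 1"
      unfolding AE_all_countable by blast
    with lim have point: "AE y in lebesgue. ennreal (norm (g y)) * indicator (ball x r) y
        \<le> ennreal (norm (T h y)) + ?X * ?v y"
    proof eventually_elim
      case (elim y)
      show ?case
      proof (cases "y \<in> ball x r")
        case True
        obtain N0 :: nat where N0: "norm x + 2 * r \<le> real N0"
          using real_arch_simple by blast
        have "ennreal (norm (T (truncation N f) y)) \<le> ennreal (norm (T h y)) + ?X * ?v y" if "N0 \<le> N" for N
        proof -
          have N: "norm x + 2 * r \<le> real N"
            using N0 that by (meson of_nat_le_iff order_trans)
          have "norm (T (truncation N f) y) \<le> norm (T h y) + \<bar>norm (T (truncation N f) y) - norm (T h y)\<bar>"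
            by simp
          then have "ennreal (norm (T (truncation N f) y))
              \<le> ennreal (norm (T h y) + \<bar>norm (T (truncation N f) y) - norm (T h y)\<bar>)"
            by (rule ennreal_leI)
          also have "\<dots> = ennreal (norm (T h y)) + ennreal \<bar>norm (T (truncation N f) y) - norm (T h y)\<bar>"
            by simp
          also have "\<dots> \<le> ennreal (norm (T h y)) + ennreal (C1 * (norm (b y - ball_avg b x r) + 1)) * \<Theta> f x r 1"
            using elim(2) N True by (intro add_left_mono) blast
          also have "\<dots> \<le> ennreal (norm (T h y)) + ennreal (C1 * (norm (b y - ball_avg b x r) + 1)) * \<Theta> f x r 0"
            by (intro add_left_mono mult_left_mono \<Theta>_shift) auto
          also have "ennreal (C1 * (norm (b y - ball_avg b x r) + 1)) * \<Theta> f x r 0 = ?X * ?v y"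
            using C1 True by (subst ennreal_mult) (auto simp: mult_ac)
          finally show ?thesis .
        qed
        then have "ennreal (norm (g y)) \<le> ennreal (norm (T h y)) + ?X * ?v y"
          by (intro Lim_bounded[OF tendsto_ennrealI[OF elim(1)]]) auto
        then show ?thesis
          using True by simp
      qed simp
    qed
    have "mixed_norm q (\<lambda>y. g y * indicator (ball x r) y) \<le> mnorm q (\<lambda>y. ennreal (norm (T h y)) + ?X * ?v y)"
      unfolding mixed_norm_eq norm_indicator_mult
      using point unfolding AE_completion_iff by (intro mnorm_mono_AE q0)
    also have "\<dots> \<le> K * (mixed_norm q (T h) + mnorm q (\<lambda>y. ?X * ?v y))"
      unfolding mixed_norm_eq by (intro add) measurable
    also have "mnorm q (\<lambda>y. ?X * ?v y) = ?X * mnorm q ?v"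
      by (intro mnorm_cmult q0) measurable
    also have "K * (mixed_norm q (T h) + ?X * mnorm q ?v)
        \<le> K * (ennreal (CT * (2 * r) powr inv_sum q) * \<Theta> f x r 0 + ?X * ennreal (C2 * r powr inv_sum q))"
    proof (intro mult_left_mono add_mono BMO_le r)
      let ?P = "\<Prod>k\<in>UNIV. ball_coeff (p k) (\<lambda>y. ennreal (norm (f k y))) x (2 * r)"
      have "mixed_norm q (T h) \<le> ennreal CT * (\<Prod>k\<in>UNIV. mixed_norm (p k) (h k))"
        by (rule T_le[OF h_dom])
      also have "(\<Prod>k\<in>UNIV. mixed_norm (p k) (h k)) = (\<Prod>k\<in>UNIV. ennreal ((2 * r) powr inv_sum (p k))) * ?P"
        unfolding h_def using r by (simp add: mixed_norm_ball_eq prod.distrib)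
      also have "(\<Prod>k\<in>UNIV. ennreal ((2 * r) powr inv_sum (p k))) = ennreal ((2 * r) powr inv_sum q)"
        using r by (simp add: prod_ennreal inv_sum_q powr_sum)
      \<comment> \<open>The product of the averaged norms on the doubled ball occurs in the term j =
        1 of the series, so the local part is bounded by the same series as the rest.\<close>
      also have "?P \<le> dyadic_term p (\<lambda>k y. ennreal (norm (f k y))) x r 1"
        unfolding dyadic_term_def using mult_right_mono[of 1 2 ?P] by simp
      also have "\<dots> \<le> \<Theta> f x r 0"
        unfolding \<Theta>_def using sum_le_suminf[of "dyadic_term p (\<lambda>k y. ennreal (norm (f k y))) x r" "{1}"] by simp
      finally show "mixed_norm q (T h) \<le> ennreal (CT * (2 * r) powr inv_sum q) * \<Theta> f x r 0"
        using CT by (simp add: ennreal_mult mult.assoc mult_left_mono)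
    qed auto
    also have "\<dots> = ennreal (K' * C3 * r powr inv_sum q) * \<Theta> f x r 0"
    proof -
      have "ennreal (K' * C3 * r powr inv_sum q) * \<Theta> f x r 0
          = K * (ennreal (C3 * r powr inv_sum q) * \<Theta> f x r 0)"
        using K' C3 by (simp add: ennreal_mult mult.assoc)
      also have "C3 * r powr inv_sum q = CT * (2 * r) powr inv_sum q + C1 * (C2 * r powr inv_sum q)"
        using r by (simp add: C3_def powr_mult algebra_simps)
      also have "ennreal \<dots> = ennreal (CT * (2 * r) powr inv_sum q) + ennreal C1 * ennreal (C2 * r powr inv_sum q)"
        using CT C1 C2 by (simp add: ennreal_mult)
      finally show ?thesis
        by (simp only: distrib_left distrib_right mult_ac)
    qed
    finally show "mixed_norm q (\<lambda>y. g y * indicator (ball x r) y) \<le> ennreal (K' * C3 * r powr inv_sum q) * \<Theta> f x r 0" .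
  qed
qed

private lemma morrey_norm_limit_le:
  obtains C where "\<And>f g. Morrey f \<Longrightarrow> g \<in> borel_measurable lebesgue \<Longrightarrow>
    (AE y in lebesgue. (\<lambda>N. norm (T (truncation N f) y)) \<longlonglongrightarrow> norm (g y)) \<Longrightarrow>
    morrey_norm q \<phi> g \<le> ennreal C * (\<Prod>k\<in>UNIV. morrey_norm (p k) (\<phi>s k) (f k))"
proof -
  obtain C where C: "0 \<le> C" and ball_le: "\<And>f g x r. Morrey f \<Longrightarrow> 0 < r \<Longrightarrow> g \<in> borel_measurable lebesgue \<Longrightarrow>
    (AE y in lebesgue. (\<lambda>N. norm (T (truncation N f) y)) \<longlonglongrightarrow> norm (g y)) \<Longrightarrow>
    mixed_norm q (\<lambda>y. g y * indicator (ball x r) y) \<le> ennreal (C * r powr inv_sum q) * \<Theta> f x r 0"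
    by (rule ball_norm_limit_le) blast
  obtain D where D: "0 \<le> D" and \<Theta>: "\<And>f x r. Morrey f \<Longrightarrow> 0 < r \<Longrightarrow>
    \<Theta> f x r 0 \<le> ennreal D * (\<Prod>k\<in>UNIV. morrey_norm (p k) (\<phi>s k) (f k)) * ennreal (\<phi> x r)"
    by (rule \<Theta>_le) blast
  \<comment> \<open>By \<open>mnorm_ball_ge\<close> the norm of the ball is at least c times
    \<open>r powr inv_sum q\<close>, so the powers of r cancel in the Morrey quotient.\<close>
  define c where "c = (2 / real CARD('n)) powr inv_sum q"
  have c: "0 < c"
    by (simp add: c_def)
  show thesis
  proof
    fix f and g :: "real ^ 'n::{finite,linorder} \<Rightarrow> complex"
    assume f: "Morrey f" and g: "g \<in> borel_measurable lebesgue"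
      and lim: "AE y in lebesgue. (\<lambda>N. norm (T (truncation N f) y)) \<longlonglongrightarrow> norm (g y)"
    let ?F = "\<Prod>k\<in>UNIV. morrey_norm (p k) (\<phi>s k) (f k)"
    have "inverse (ennreal (\<phi> x r)) * inverse (mixed_norm q (indicator (ball x r)))
          * mixed_norm q (\<lambda>y. g y * indicator (ball x r) y) \<le> ennreal (C * D / c) * ?F" if r: "0 < r" for x r
    proof -
      define R where "R = r powr inv_sum q"
      have R: "0 < R"
        using r by (simp add: R_def)
      have \<phi>_pos: "0 < \<phi> x r"
        using \<phi> r by (simp add: morrey_weight_def)
      have "ennreal (c * R) = ennreal ((2 * r / real CARD('n)) powr inv_sum q)"
        using r by (simp add: c_def R_def flip: powr_mult)
      also have "\<dots> \<le> mixed_norm q (indicator (ball x r))"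
        unfolding mixed_norm_indicator by (rule mnorm_ball_ge[OF q0 r])
      finally have "inverse (mixed_norm q (indicator (ball x r))) \<le> inverse (ennreal (c * R))"
        by (rule inverse_antimono_ennreal)
      also have "\<dots> = ennreal (1 / (c * R))"
        using c R by (simp add: inverse_ennreal divide_inverse)
      finally have inv: "inverse (mixed_norm q (indicator (ball x r))) \<le> ennreal (1 / (c * R))" .
      have "mixed_norm q (\<lambda>y. g y * indicator (ball x r) y) \<le> ennreal (C * R) * \<Theta> f x r 0"
        unfolding R_def by (rule ball_le[OF f r g lim])
      also have "\<dots> \<le> ennreal (C * R) * (ennreal D * ?F * ennreal (\<phi> x r))"
        by (intro mult_left_mono \<Theta> f r) auto
      finally have "inverse (ennreal (\<phi> x r)) * inverse (mixed_norm q (indicator (ball x r)))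
            * mixed_norm q (\<lambda>y. g y * indicator (ball x r) y)
          \<le> inverse (ennreal (\<phi> x r)) * ennreal (1 / (c * R)) * (ennreal (C * R) * (ennreal D * ?F * ennreal (\<phi> x r)))"
        using inv by (intro mult_mono) auto
      also have "\<dots> = (ennreal (1 / \<phi> x r) * ennreal (1 / (c * R)) * ennreal (C * R) * ennreal D * ennreal (\<phi> x r)) * ?F"
        using \<phi>_pos by (simp only: inverse_ennreal inverse_eq_divide mult_ac)
      also have "ennreal (1 / \<phi> x r) * ennreal (1 / (c * R)) * ennreal (C * R) * ennreal D * ennreal (\<phi> x r)
          = ennreal (1 / \<phi> x r * (1 / (c * R)) * (C * R) * D * \<phi> x r)"
      proof -
        have "0 \<le> 1 / \<phi> x r" "0 \<le> 1 / (c * R)" "0 \<le> C * R" "0 \<le> \<phi> x r"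
          using \<phi>_pos c R C by auto
        then show ?thesis
          using D by (simp only: ennreal_mult mult_nonneg_nonneg)
      qed
      also have "1 / \<phi> x r * (1 / (c * R)) * (C * R) * D * \<phi> x r = C * D / c"
        using \<phi>_pos c R by (simp add: field_simps)
      finally show ?thesis .
    qed
    then show "morrey_norm q \<phi> g \<le> ennreal (C * D / c) * ?F"
      unfolding morrey_norm_def by (intro SUP_least) auto
  qed
qed

lemma Morrey_extension:
  "\<exists>S. extends_by_truncation (\<lambda>k. op_domain (p k)) (\<lambda>k. mixed_Morrey (p k) (\<phi>s k)) T S \<and>
     multi_bounded (\<lambda>k. mixed_Morrey (p k) (\<phi>s k)) (\<lambda>k. morrey_norm (p k) (\<phi>s k)) (morrey_norm q \<phi>) S"
proof -
  obtain CT where T_meas: "\<And>f. (\<And>k. f k \<in> mixed_Lebesgue (p k)) \<Longrightarrow> T f \<in> borel_measurable lebesgue"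
    by (rule T_bound) blast
  obtain C where bound: "\<And>f g. Morrey f \<Longrightarrow> g \<in> borel_measurable lebesgue \<Longrightarrow>
    (AE y in lebesgue. (\<lambda>N. norm (T (truncation N f) y)) \<longlonglongrightarrow> norm (g y)) \<Longrightarrow>
    morrey_norm q \<phi> g \<le> ennreal C * (\<Prod>k\<in>UNIV. morrey_norm (p k) (\<phi>s k) (f k))"
    by (rule morrey_norm_limit_le) blast
  \<comment> \<open>On tuples in the domain S must equal T itself, phase included. Elsewhere only
    the size is prescribed, and the limit of the sizes, read as a complex number, is one choice;
    where the sizes do not converge, on a null set, \<open>lim\<close> has an unspecified
    value.\<close>
  define S where "S f = (if \<forall>k. f k \<in> op_domain (p k) \<inter> mixed_Morrey (p k) (\<phi>s k) then T f
    else (\<lambda>x. complex_of_real (lim (\<lambda>N. norm (T (truncation N f) x)))))" for f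
  have S: "S f \<in> borel_measurable lebesgue \<and>
      (AE x in lebesgue. (\<lambda>N. norm (T (truncation N f) x)) \<longlonglongrightarrow> norm (S f x))" if f: "Morrey f" for f
  proof (cases "\<forall>k. f k \<in> op_domain (p k) \<inter> mixed_Morrey (p k) (\<phi>s k)")
    case True
    have "f k \<in> mixed_Lebesgue (p k)" for k
      using True by (intro op_domain_Morrey_mixed_Lebesgue[OF p0 \<phi>s]) auto
    then show ?thesis
      using True truncation_limit[OF f] T_meas by (simp add: S_def)
  next
    case False
    then have S_eq: "S f = (\<lambda>x. complex_of_real (lim (\<lambda>N. norm (T (truncation N f) x))))"
      by (simp only: S_def if_False)
    have tr: "T (truncation N f) \<in> borel_measurable lebesgue" for N
      by (intro T_meas cut_in(1)[OF f cut_truncation] Morrey_measurable f)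
    have "(\<lambda>x. lim (\<lambda>N. norm (T (truncation N f) x))) \<in> borel_measurable lebesgue"
      using tr by (intro borel_measurable_lim_metric) auto
    then have "S f \<in> borel_measurable lebesgue"
      unfolding S_eq by simp
    moreover have "AE x in lebesgue. (\<lambda>N. norm (T (truncation N f) x)) \<longlonglongrightarrow> norm (S f x)"
      using truncation_convergent[OF f]
    proof eventually_elim
      case (elim x)
      then have L: "(\<lambda>N. norm (T (truncation N f) x)) \<longlonglongrightarrow> lim (\<lambda>N. norm (T (truncation N f) x))"
        by (simp add: convergent_LIMSEQ_iff)
      then have "0 \<le> lim (\<lambda>N. norm (T (truncation N f) x))"
        by (rule LIMSEQ_le_const) simp
      with L show ?case
        by (simp add: S_eq)
    qed
    ultimately show ?thesis
      by blast
  qed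
  show ?thesis
  proof (intro exI[of _ S] conjI)
    show "extends_by_truncation (\<lambda>k. op_domain (p k)) (\<lambda>k. mixed_Morrey (p k) (\<phi>s k)) T S"
      unfolding extends_by_truncation_def using S by (auto simp: S_def Morrey_def)
    show "multi_bounded (\<lambda>k. mixed_Morrey (p k) (\<phi>s k)) (\<lambda>k. morrey_norm (p k) (\<phi>s k)) (morrey_norm q \<phi>) S"
      unfolding multi_bounded_def using S bound by (intro exI[of _ C]) (auto simp: Morrey_def)
  qed
qed

end

theorem theorem4p1:
  fixes i :: "'m::finite"
    and qs :: "'m \<Rightarrow> ('n::{finite,linorder}) \<Rightarrow> real" and q :: "'n::{finite,linorder} \<Rightarrow> real"
    and \<phi> :: "real ^ 'n::{finite,linorder} \<Rightarrow> real \<Rightarrow> real" and \<phi>s :: "'m \<Rightarrow> real ^ 'n::{finite,linorder} \<Rightarrow> real \<Rightarrow> real"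
    and C\<^sub>0 :: real
    and b :: "real ^ 'n::{finite,linorder} \<Rightarrow> complex"
    and T :: "('m \<Rightarrow> real ^ 'n::{finite,linorder} \<Rightarrow> complex) \<Rightarrow> real ^ 'n::{finite,linorder} \<Rightarrow> complex"
  assumes "CARD('m) \<ge> 2"
    and "\<And>k j. 1 < qs k j"
    and "\<And>j. 1 / q j = (\<Sum>k\<in>UNIV. 1 / qs k j)"
    and "morrey_weight \<phi>"
    and "\<And>k. morrey_weight (\<phi>s k)"
    and "C\<^sub>0 > 0"
    and "\<And>x r. r > 0 \<Longrightarrow>
           (\<integral>\<^sup>+ t\<in>{r<..}. ennreal ((1 + ln (t / r)) * (\<phi>s i x t / t)) \<partial>lebesgue)
             * (\<Prod>k\<in>UNIV - {i}. \<integral>\<^sup>+ t\<in>{r<..}. ennreal (\<phi>s k x t / t) \<partial>lebesgue)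
           \<le> ennreal (C\<^sub>0 * \<phi> x r)"
    and "b \<in> BMO"
    and "multi_sublinear_on (\<lambda>k. op_domain (qs k)) T"
    and "size_condition b i T"
    and "multi_bounded (\<lambda>k. mixed_Lebesgue (qs k)) (\<lambda>k. mixed_norm (qs k)) (mixed_norm q) T"
  shows "\<exists>S. extends_by_truncation (\<lambda>k. op_domain (qs k)) (\<lambda>k. mixed_Morrey (qs k) (\<phi>s k)) T S \<and>
             multi_bounded (\<lambda>k. mixed_Morrey (qs k) (\<phi>s k)) (\<lambda>k. morrey_norm (qs k) (\<phi>s k))
               (morrey_norm q \<phi>) S"
  by (rule Morrey_extension[where i = i and C\<^sub>0 = C\<^sub>0 and b = b]) (fact assms)+

end
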